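(* Let $A$ be an RSLR type, $\mathsf a$ an aspect, and $t,s$ closed RSLR terms of type $\mathsf a\mathsf{Str}\to A$. Then $t$ and $s$ are parametrically trace equivalent if and only if they are parametrically context equivalent.
   Context: \textbf{The calculus RSLR.} Aspects are $\square$ and $\blacksquare$, ordered by $\square<:\square$, $\square<:\blacksquare$, $\blacksquare<:\blacksquare$. Types: $A::=\mathsf{Str}\mid\mathsf aA\to A$. Subtyping: least reflexive transitive relation with $\mathsf aA\to C<:\mathsf bB\to D$ whenever $B<:A$, $C<:D$, $\mathsf a<:\mathsf b$. Terms: $t::=x\mid\underline m\mid\lambda x:\mathsf aA.t\mid\mathsf0(t)\mid\mathsf1(t)\mid\mathsf{tail}(t)\mid t\,t\mid\mathsf{case}_A(t,t_0,t_1,t_\epsilon)\mid\mathsf{rec}_A(t,t_0,t_1,t_\epsilon)\mid\mathsf{rand}$ with $m\in\{0,1\}^*$ ($\underline\epsilon$ empty string, $\underline{1^n}$ the string of $n$ ones); values are string constants and abstractions. Typing contexts are finite sets of declarations $x:\mathsf aA$; $\Gamma;\Delta$ denotes disjoint union where $\Gamma$ declares only $\mathsf{Str}$ variables; $\Gamma<:\mathsf a$ means all declared aspects $\mathsf b$ satisfy $\mathsf b<:\mathsf a$. Typing rules: variables, string constants of type $\mathsf{Str}$, $\mathsf0,\mathsf1,\mathsf{tail}$ from $\mathsf{Str}$ to $\mathsf{Str}$, $\vdash\mathsf{rand}:\mathsf{Str}$, abstraction, subsumption; application: $\Gamma;\Delta_1\vdash t:\mathsf aA\to B$, $\Gamma;\Delta_2\vdash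 s:A$, $\Gamma,\Delta_2<:\mathsf a$ give $\Gamma;\Delta_1,\Delta_2\vdash ts:B$; case: $\Gamma;\Delta_1\vdash t:\mathsf{Str}$, $\Gamma;\Delta_2\vdash t_0:A$, $\Gamma;\Delta_3\vdash t_1:A$, $\Gamma;\Delta_4\vdash t_\epsilon:A$ give $\Gamma;\Delta_1,\dots,\Delta_4\vdash\mathsf{case}_A(t,t_0,t_1,t_\epsilon):A$; recursion: $\Gamma_1;\Delta_1\vdash t:\mathsf{Str}$, $\Gamma_1,\Gamma_2\vdash t_0:\square\mathsf{Str}\to\blacksquare A\to A$, $\Gamma_1,\Gamma_3\vdash t_1:\square\mathsf{Str}\to\blacksquare A\to A$, $\Gamma_1,\Gamma_2,\Gamma_3;\Delta_2\vdash t_\epsilon:A$, $\Gamma_1,\Delta_1<:\square$, $A$ $\square$-free give $\Gamma_1,\Gamma_2,\Gamma_3;\Delta_1,\Delta_2\vdash\mathsf{rec}_A(t,t_0,t_1,t_\epsilon):A$. Every closed typable $t$ has a value distribution $[\![t]\!]$ given by probabilistic call-by-value big-step semantics: values evaluate to themselves; $\mathsf{rand}$ yields $\underline0,\underline1$ with probability $1/2$ each; $\mathsf0,\mathsf1$ prepend a bit, $\mathsf{tail}$ drops the first bit ($\mathrm{tail}(\epsilon)=\epsilon$); $[\![ts]\!]=\sum[\![t]\!](\lambda x.r)[\![s]\!](v)[\![r\{v/x\}]\!]$; $\mathsf{case}$ continues with $t_0$, $t_1$ or $t_\epsilon$ according to whether the evaluated string begins with $0$, with $1$, or is empty; $\mathsf{rec}_A(\underline\epsilon,\dots)$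 continues as $t_\epsilon$, $\mathsf{rec}_A(\underline{bn},t_0,t_1,t_\epsilon)$ as $(t_b\,\underline{bn})(\mathsf{rec}_A(\underline n,t_0,t_1,t_\epsilon))$. \textbf{Contexts.} Generated by $C::=t\mid[\cdot]\mid\lambda x.C\mid C\,t\mid t\,C\mid\mathsf0(C)\mid\mathsf1(C)\mid\mathsf{tail}(C)\mid\mathsf{case}_A(C,t,t,t)\mid\mathsf{case}_A(t,C,C,C)\mid\mathsf{rec}_A(C,t,t,t)$, hole occurring at most once; $C[t]$ fills the hole with the closed term $t$; $\vdash C[\vdash A]:B$ means that for every closed $t$ with $\vdash t:A$, $\vdash C[t]:B$. \textbf{Definitions.} A function $f:\mathbb N\to\mathbb R$ is negligible if for every polynomial $p$, $|f(n)|<1/p(n)$ for all sufficiently large $n$. Closed $t,s$ of type $\mathsf a\mathsf{Str}\to A$ are parametrically context equivalent if for every context $C$ with $\vdash C[\vdash A]:\mathsf{Str}$, $n\mapsto|[\![C[t\,\underline{1^n}]]\!](\underline\epsilon)-[\![C[s\,\underline{1^n}]]\!](\underline\epsilon)|$ is negligible. A distinguisher is a closed term $\mathtt D$ of type $\mathsf b\mathsf{Str}\to\mathsf{Str}$ for some aspect $\mathsf b$. Actions are $\mathsf{pass}(v)$ ($v$ closed value) and $\mathsf{view}(\mathtt D)$ ($\mathtt D$ a distinguisher). Traces compatible with $\mathsf{Str}$: $\mathsf{view}(\mathtt D)$; with $\mathsf bB\to C$: $\mathsf{pass}(v)\cdot S$, $\vdash v:B$, $S$ compatible with $C$. A trace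 is parametrically compatible with $\mathsf a\mathsf{Str}\to A$ if it is compatible with $A$. For $u$ closed of type $\mathsf a_1A_1\to\cdots\to\mathsf a_kA_k\to\mathsf{Str}$ and $T=\mathsf{pass}(v_1)\cdots\mathsf{pass}(v_k)\mathsf{view}(\mathtt D)$: $\mathcal D_0=[\![u]\!]$, $\mathcal D_i=\sum_{\lambda x.r}\mathcal D_{i-1}(\lambda x.r)[\![r\{v_i/x\}]\!]$, and $\Pr(u,T)=\sum_m\mathcal D_k(\underline m)\,[\![\mathtt D\,\underline m]\!](\underline\epsilon)$. Closed $t,s$ of type $\mathsf a\mathsf{Str}\to A$ are parametrically trace equivalent if for every trace $T$ parametrically compatible with $\mathsf a\mathsf{Str}\to A$ there is a negligible $\mathit{negl}:\mathbb N\to[0,1]$ with $|\Pr(t,\mathsf{pass}(\underline{1^n})\cdot T)-\Pr(s,\mathsf{pass}(\underline{1^n})\cdot T)|\le\mathit{negl}(n)$ for all $n$. *)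

theory Defs
  imports "HOL-Probability.Probability" "HOL-Computational_Algebra.Polynomial"
begin

section \<open>Aspects, types, subtyping\<close>

datatype aspect = Box | BlackBox

fun asp_le :: "aspect \<Rightarrow> aspect \<Rightarrow> bool" (infix "\<preceq>" 50) where
  "BlackBox \<preceq> Box \<longleftrightarrow> False"
| "_ \<preceq> _ \<longleftrightarrow> True"

datatype ty = Str | Arr aspect ty ty

inductive subty :: "ty \<Rightarrow> ty \<Rightarrow> bool" (infix "<:" 50) where
  sub_refl: "A <: A"
| sub_trans: "A <: B \<Longrightarrow> B <: C \<Longrightarrow> A <: C"
| sub_arr: "B <: A \<Longrightarrow> C <: D \<Longrightarrow> a \<preceq> b \<Longrightarrow> Arr a A C <: Arr b B D"

fun box_free :: "ty \<Rightarrow> bool" where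
  "box_free Str \<longleftrightarrow> True"
| "box_free (Arr a A B) \<longleftrightarrow> a = BlackBox \<and> box_free A \<and> box_free B"

section \<open>Terms\<close>

type_synonym name = nat

text \<open>The bits 0 and 1 are \<open>False\<close> and \<open>True\<close>. In \<open>Case A t t0 t1 te\<close> and \<open>Rec A t t0 t1 te\<close> the
  last argument belongs to the empty string.\<close>

datatype tm =
    Var name
  | Const "bool list"
  | Lam name aspect ty tm
  | S0 tm
  | S1 tm
  | Tail tm
  | App tm tm
  | Case ty tm tm tm tm
  | Rec ty tm tm tm tm
  | Rand

fun is_value :: "tm \<Rightarrow> bool" where
  "is_value (Const m) \<longleftrightarrow> True"
| "is_value (Lam x a A t) \<longleftrightarrow> True"
| "is_value _ \<longleftrightarrow> False"

text \<open>\<open>subst x v t\<close> is \<open>t{v/x}\<close>. It is only ever applied to closed \<open>v\<close>, so that no variable can be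
  captured and bound variables need not be renamed.\<close>

fun subst :: "name \<Rightarrow> tm \<Rightarrow> tm \<Rightarrow> tm" where
  "subst x v (Var y) = (if y = x then v else Var y)"
| "subst x v (Const m) = Const m"
| "subst x v (Lam y a A t) = Lam y a A (if y = x then t else subst x v t)"
| "subst x v (S0 t) = S0 (subst x v t)"
| "subst x v (S1 t) = S1 (subst x v t)"
| "subst x v (Tail t) = Tail (subst x v t)"
| "subst x v (App t s) = App (subst x v t) (subst x v s)"
| "subst x v (Case A t t0 t1 te) =
     Case A (subst x v t) (subst x v t0) (subst x v t1) (subst x v te)"
| "subst x v (Rec A t t0 t1 te) =
     Rec A (subst x v t) (subst x v t0) (subst x v t1) (subst x v te)"
| "subst x v Rand = Rand"

section \<open>Typing\<close>

text \<open>Finiteness of typing contexts is not imposed: every context in a derivation whose conclusion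
  has the empty context is finite.\<close>

type_synonym tctx = "name \<rightharpoonup> aspect \<times> ty"

definition str_only :: "tctx \<Rightarrow> bool" where
  "str_only \<Gamma> \<longleftrightarrow> (\<forall>(b, B) \<in> ran \<Gamma>. B = Str)"

definition ctx_le :: "tctx \<Rightarrow> aspect \<Rightarrow> bool" where
  "ctx_le \<Gamma> a \<longleftrightarrow> (\<forall>(b, B) \<in> ran \<Gamma>. b \<preceq> a)"

definition disjoint_ctxs :: "tctx list \<Rightarrow> bool" where
  "disjoint_ctxs Gs \<longleftrightarrow> sorted_wrt (\<lambda>\<Gamma> \<Delta>. dom \<Gamma> \<inter> dom \<Delta> = {}) Gs"

text \<open>The axioms hold in arbitrary contexts (the system is affine). Terms are not identified up to
  renaming of bound variables; instead a binder may shadow a declaration of the same name.\<close>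

inductive typing :: "tctx \<Rightarrow> tm \<Rightarrow> ty \<Rightarrow> bool" ("_ \<turnstile> _ \<Ztypecolon> _" [50, 50, 50] 50) where
  ty_var: "\<Gamma> x = Some (a, A) \<Longrightarrow> \<Gamma> \<turnstile> Var x \<Ztypecolon> A"
| ty_const: "\<Gamma> \<turnstile> Const m \<Ztypecolon> Str"
| ty_rand: "\<Gamma> \<turnstile> Rand \<Ztypecolon> Str"
| ty_S0: "\<Gamma> \<turnstile> t \<Ztypecolon> Str \<Longrightarrow> \<Gamma> \<turnstile> S0 t \<Ztypecolon> Str"
| ty_S1: "\<Gamma> \<turnstile> t \<Ztypecolon> Str \<Longrightarrow> \<Gamma> \<turnstile> S1 t \<Ztypecolon> Str"
| ty_tail: "\<Gamma> \<turnstile> t \<Ztypecolon> Str \<Longrightarrow> \<Gamma> \<turnstile> Tail t \<Ztypecolon> Str"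
| ty_lam: "\<Gamma>(x \<mapsto> (a, A)) \<turnstile> t \<Ztypecolon> B \<Longrightarrow> \<Gamma> \<turnstile> Lam x a A t \<Ztypecolon> Arr a A B"
| ty_sub: "\<Gamma> \<turnstile> t \<Ztypecolon> A \<Longrightarrow> A <: B \<Longrightarrow> \<Gamma> \<turnstile> t \<Ztypecolon> B"
| ty_app:
    "\<lbrakk>str_only \<Gamma>; disjoint_ctxs [\<Gamma>, \<Delta>1, \<Delta>2];
      \<Gamma> ++ \<Delta>1 \<turnstile> t \<Ztypecolon> Arr a A B; \<Gamma> ++ \<Delta>2 \<turnstile> s \<Ztypecolon> A; ctx_le \<Gamma> a; ctx_le \<Delta>2 a\<rbrakk>
     \<Longrightarrow> \<Gamma> ++ \<Delta>1 ++ \<Delta>2 \<turnstile> App t s \<Ztypecolon> B"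
| ty_case:
    "\<lbrakk>str_only \<Gamma>; disjoint_ctxs [\<Gamma>, \<Delta>1, \<Delta>2, \<Delta>3, \<Delta>4];
      \<Gamma> ++ \<Delta>1 \<turnstile> t \<Ztypecolon> Str; \<Gamma> ++ \<Delta>2 \<turnstile> t0 \<Ztypecolon> A; \<Gamma> ++ \<Delta>3 \<turnstile> t1 \<Ztypecolon> A; \<Gamma> ++ \<Delta>4 \<turnstile> te \<Ztypecolon> A\<rbrakk>
     \<Longrightarrow> \<Gamma> ++ \<Delta>1 ++ \<Delta>2 ++ \<Delta>3 ++ \<Delta>4 \<turnstile> Case A t t0 t1 te \<Ztypecolon> A"
| ty_rec:
    "\<lbrakk>str_only \<Gamma>1; str_only \<Gamma>2; str_only \<Gamma>3; disjoint_ctxs [\<Gamma>1, \<Gamma>2, \<Gamma>3, \<Delta>1, \<Delta>2];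
      \<Gamma>1 ++ \<Delta>1 \<turnstile> t \<Ztypecolon> Str;
      \<Gamma>1 ++ \<Gamma>2 \<turnstile> t0 \<Ztypecolon> Arr Box Str (Arr BlackBox A A);
      \<Gamma>1 ++ \<Gamma>3 \<turnstile> t1 \<Ztypecolon> Arr Box Str (Arr BlackBox A A);
      \<Gamma>1 ++ \<Gamma>2 ++ \<Gamma>3 ++ \<Delta>2 \<turnstile> te \<Ztypecolon> A;
      ctx_le \<Gamma>1 Box; ctx_le \<Delta>1 Box; box_free A\<rbrakk>
     \<Longrightarrow> \<Gamma>1 ++ \<Gamma>2 ++ \<Gamma>3 ++ \<Delta>1 ++ \<Delta>2 \<turnstile> Rec A t t0 t1 te \<Ztypecolon> A"

text \<open>A term with a type in the empty context is closed.\<close>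

abbreviation has_type :: "tm \<Rightarrow> ty \<Rightarrow> bool" ("\<turnstile> _ \<Ztypecolon> _" [50, 50] 50) where
  "\<turnstile> t \<Ztypecolon> A \<equiv> Map.empty \<turnstile> t \<Ztypecolon> A"

section \<open>Semantics\<close>

fun the_str :: "tm \<Rightarrow> bool list spmf" where
  "the_str (Const m) = return_spmf m"
| "the_str _ = return_pmf None"

fun the_lam :: "tm \<Rightarrow> (name \<times> tm) spmf" where
  "the_lam (Lam x a A r) = return_spmf (x, r)"
| "the_lam _ = return_pmf None"

text \<open>\<open>spmf (eval t) v\<close> is the probability that \<open>t\<close> evaluates to the value \<open>v\<close>. The function is the
  least solution of the big-step equations among subdistributions; stuck terms, which cannot be both
  closed and typable, have the empty subdistribution.\<close>

partial_function (spmf) eval :: "tm \<Rightarrow> tm spmf" where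
  "eval u = (case u of
     Var x \<Rightarrow> return_pmf None
   | Const m \<Rightarrow> return_spmf (Const m)
   | Lam x a A r \<Rightarrow> return_spmf (Lam x a A r)
   | S0 t \<Rightarrow> bind_spmf (eval t) (\<lambda>v. bind_spmf (the_str v) (\<lambda>m. return_spmf (Const (False # m))))
   | S1 t \<Rightarrow> bind_spmf (eval t) (\<lambda>v. bind_spmf (the_str v) (\<lambda>m. return_spmf (Const (True # m))))
   | Tail t \<Rightarrow> bind_spmf (eval t) (\<lambda>v. bind_spmf (the_str v) (\<lambda>m. return_spmf (Const (tl m))))
   | App t s \<Rightarrow>
       bind_spmf (eval t) (\<lambda>f. bind_spmf (eval s) (\<lambda>v.
       bind_spmf (the_lam f) (\<lambda>(x, r). eval (subst x v r))))
   | Case A t t0 t1 te \<Rightarrow>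
       bind_spmf (eval t) (\<lambda>v. bind_spmf (the_str v) (\<lambda>m.
         case m of [] \<Rightarrow> eval te | b # n \<Rightarrow> eval (if b then t1 else t0)))
   | Rec A t t0 t1 te \<Rightarrow>
       bind_spmf (eval t) (\<lambda>v. bind_spmf (the_str v) (\<lambda>m.
         case m of
           [] \<Rightarrow> eval te
         | b # n \<Rightarrow> eval (App (App (if b then t1 else t0) (Const (b # n)))
                              (Rec A (Const n) t0 t1 te))))
   | Rand \<Rightarrow> map_spmf (\<lambda>b. Const [b]) coin_spmf)"

definition prob_eps :: "tm \<Rightarrow> real" where
  "prob_eps t = spmf (eval t) (Const [])"

section \<open>Contexts\<close>

datatype ctxt =
    CTerm tm
  | Hole
  | CLam name aspect ty ctxt
  | CAppL ctxt tm
  | CAppR tm ctxt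
  | CS0 ctxt
  | CS1 ctxt
  | CTail ctxt
  | CCaseArg ty ctxt tm tm tm
  | CCaseBranch ty tm ctxt ctxt ctxt
  | CRec ty ctxt tm tm tm

fun holes :: "ctxt \<Rightarrow> nat" where
  "holes (CTerm t) = 0"
| "holes Hole = 1"
| "holes (CLam x a A C) = holes C"
| "holes (CAppL C t) = holes C"
| "holes (CAppR t C) = holes C"
| "holes (CS0 C) = holes C"
| "holes (CS1 C) = holes C"
| "holes (CTail C) = holes C"
| "holes (CCaseArg A C t0 t1 te) = holes C"
| "holes (CCaseBranch A t C0 C1 Ce) = holes C0 + holes C1 + holes Ce"
| "holes (CRec A C t0 t1 te) = holes C"

fun fill :: "ctxt \<Rightarrow> tm \<Rightarrow> tm" where
  "fill (CTerm t) u = t"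
| "fill Hole u = u"
| "fill (CLam x a A C) u = Lam x a A (fill C u)"
| "fill (CAppL C t) u = App (fill C u) t"
| "fill (CAppR t C) u = App t (fill C u)"
| "fill (CS0 C) u = S0 (fill C u)"
| "fill (CS1 C) u = S1 (fill C u)"
| "fill (CTail C) u = Tail (fill C u)"
| "fill (CCaseArg A C t0 t1 te) u = Case A (fill C u) t0 t1 te"
| "fill (CCaseBranch A t C0 C1 Ce) u = Case A t (fill C0 u) (fill C1 u) (fill Ce u)"
| "fill (CRec A C t0 t1 te) u = Rec A (fill C u) t0 t1 te"

definition ctx_typed :: "ctxt \<Rightarrow> ty \<Rightarrow> ty \<Rightarrow> bool" where
  "ctx_typed C A B \<longleftrightarrow> (\<forall>t. \<turnstile> t \<Ztypecolon> A \<longrightarrow> \<turnstile> fill C t \<Ztypecolon> B)"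

section \<open>Parametric equivalences\<close>

text \<open>The usual convention that \<open>p\<close> is a polynomial that is (eventually) positive is made explicit.\<close>

definition negligible :: "(nat \<Rightarrow> real) \<Rightarrow> bool" where
  "negligible f \<longleftrightarrow>
     (\<forall>p :: real poly. (\<forall>\<^sub>F n in sequentially. 0 < poly p (real n)) \<longrightarrow>
        (\<forall>\<^sub>F n in sequentially. \<bar>f n\<bar> < 1 / poly p (real n)))"

abbreviation ones :: "nat \<Rightarrow> tm" where
  "ones n \<equiv> Const (replicate n True)"

text \<open>Both equivalences below are meant for terms of type \<open>Arr a Str A\<close>, with \<open>a\<close> an arbitrary
  aspect.\<close>

definition param_context_equiv :: "ty \<Rightarrow> tm \<Rightarrow> tm \<Rightarrow> bool" where
  "param_context_equiv A t s \<longleftrightarrow>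
     (\<forall>C. holes C \<le> 1 \<and> ctx_typed C A Str \<longrightarrow>
        negligible (\<lambda>n. \<bar>prob_eps (fill C (App t (ones n))) - prob_eps (fill C (App s (ones n)))\<bar>))"

definition distinguisher :: "tm \<Rightarrow> bool" where
  "distinguisher d \<longleftrightarrow> (\<exists>b. \<turnstile> d \<Ztypecolon> Arr b Str Str)"

datatype trace = View tm | Pass tm trace

inductive compatible :: "trace \<Rightarrow> ty \<Rightarrow> bool" where
  "distinguisher d \<Longrightarrow> compatible (View d) Str"
| "is_value v \<Longrightarrow> \<turnstile> v \<Ztypecolon> B \<Longrightarrow> compatible T C \<Longrightarrow> compatible (Pass v T) (Arr b B C)"

definition pass_dist :: "tm spmf \<Rightarrow> tm \<Rightarrow> tm spmf" where
  "pass_dist D v = bind_spmf D (\<lambda>w. bind_spmf (the_lam w) (\<lambda>(x, r). eval (subst x v r)))"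

fun trace_prob_from :: "tm spmf \<Rightarrow> trace \<Rightarrow> real" where
  "trace_prob_from D (View d) = (\<Sum>\<^sub>\<infinity>m. spmf D (Const m) * prob_eps (App d (Const m)))"
| "trace_prob_from D (Pass v T) = trace_prob_from (pass_dist D v) T"

definition trace_prob :: "tm \<Rightarrow> trace \<Rightarrow> real" where
  "trace_prob u T = trace_prob_from (eval u) T"

text \<open>A trace is parametrically compatible with \<open>Arr a Str A\<close> if it is compatible with \<open>A\<close>.\<close>

definition param_trace_equiv :: "ty \<Rightarrow> tm \<Rightarrow> tm \<Rightarrow> bool" where
  "param_trace_equiv A t s \<longleftrightarrow>
     (\<forall>T. compatible T A \<longrightarrow>
        (\<exists>negl. negligible negl \<and> range negl \<subseteq> {0..1} \<and>
           (\<forall>n. \<bar>trace_prob t (Pass (ones n) T) - trace_prob s (Pass (ones n) T)\<bar> \<le> negl n)))"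

end

theory Submission
  imports Defs
begin

text \<open>A trace is a context, so one direction only compares two semantics. For the other direction, fix a
  typed context and evaluate it with an unknown term in its hole. Functions are used at most once, so
  the hole is never copied. Evaluation reaches the hole at most once, then possibly moves the value
  found there until it is applied to a closed value, continues with the result, and so on; when the
  type of the hole has come down to \<open>Str\<close>, the rest of the computation is a distinguisher. Each such
  course of evaluation is a trace. Since typable terms terminate, only finitely many traces occur, so the
  probability of \<open>Const []\<close> is a constant plus a finite linear combination of trace probabilities whose
  traces and coefficients do not depend on the unknown term. Negligible differences are preserved by
  finite linear combinations. Termination is Tait's reducibility argument, in which aspects and
  linearity play no role.\<close>

section \<open>Subtyping and typing\<close>

text \<open>Once the hole is reached, the course of evaluation depends on the unknown term, so the
  traces cannot be read off one evaluation. This is met by families indexed by all possible fillings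
  and by two modes for the hole. With arbitrary fillings, evaluation stops at the hole and leaves a
  continuation that waits for a value of type \<open>A\<close>. If \<open>A\<close> is an arrow,
  that value is put into the continuation and becomes a hole filled with values, which evaluation
  can only move about until it is applied. The application has the smaller result type, so induction
  on \<open>A\<close> finishes the argument. Values of type \<open>Str\<close> are kept out of the
  second mode, because string variables may be shared and strings can be inspected. Within one mode,
  induction runs along the evaluation of a single reference member of the family, although the
  conclusion concerns all members: until the hole is used, it does not influence the evaluation, so
  all members make the same choices.\<close>

lemma subty_Str_left: "A <: B \<Longrightarrow> A = Str \<Longrightarrow> B = Str"
  by (induction rule: subty.induct) auto

lemma subty_Str_right: "A <: B \<Longrightarrow> B = Str \<Longrightarrow> A = Str"
  by (induction rule: subty.induct) auto

lemma asp_le_refl [simp]: "a \<preceq> a"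
  by (cases a) auto

lemma asp_le_Box [simp]: "Box \<preceq> a"
  by (cases a) auto

lemma asp_le_trans: "a \<preceq> b \<Longrightarrow> b \<preceq> c \<Longrightarrow> a \<preceq> c"
  by (cases a; cases b; cases c) auto

lemma subty_Arr_left:
  "X <: Y \<Longrightarrow> X = Arr a A B \<Longrightarrow> \<exists>b A' B'. Y = Arr b A' B' \<and> A' <: A \<and> B <: B' \<and> a \<preceq> b"
proof (induction arbitrary: a A B rule: subty.induct)
  case (sub_trans X Y Z)
  obtain b A' B' where Y: "Y = Arr b A' B'" "A' <: A" "B <: B'" "a \<preceq> b"
    using sub_trans.IH(1)[OF sub_trans.prems] by blast
  obtain c A'' B'' where Z: "Z = Arr c A'' B''" "A'' <: A'" "B' <: B''" "b \<preceq> c"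
    using sub_trans.IH(2)[OF Y(1)] by blast
  show ?case
    using Y Z subty.sub_trans[OF Z(2) Y(2)] subty.sub_trans[OF Y(3) Z(3)] asp_le_trans by blast
qed (auto intro: sub_refl)

lemma subty_Arr_right:
  "X <: Y \<Longrightarrow> Y = Arr b A' B' \<Longrightarrow> \<exists>a A B. X = Arr a A B \<and> A' <: A \<and> B <: B' \<and> a \<preceq> b"
proof (induction arbitrary: b A' B' rule: subty.induct)
  case (sub_trans X Y Z)
  obtain a A B where Y: "Y = Arr a A B" "A' <: A" "B <: B'" "a \<preceq> b"
    using sub_trans.IH(2)[OF sub_trans.prems] by blast
  obtain c A'' B'' where X: "X = Arr c A'' B''" "A <: A''" "B'' <: B" "c \<preceq> a"
    using sub_trans.IH(1)[OF Y(1)] by blast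
  show ?case
    using X Y subty.sub_trans[OF Y(2) X(2)] subty.sub_trans[OF X(3) Y(3)] asp_le_trans by blast
qed (auto intro: sub_refl)

lemma subty_Arr_Arr: "Arr a A B <: Arr b A' B' \<longleftrightarrow> A' <: A \<and> B <: B' \<and> a \<preceq> b"
  using subty_Arr_left[of "Arr a A B" "Arr b A' B'" a A B] sub_arr by auto

section \<open>Splitting and restricting typing contexts\<close>

lemma map_le_add_right: "\<Gamma> \<subseteq>\<^sub>m \<Delta> \<Longrightarrow> dom \<Gamma> \<inter> dom \<Theta> = {} \<Longrightarrow> \<Gamma> \<subseteq>\<^sub>m \<Delta> ++ \<Theta>"
  by (force simp: map_le_def map_add_def split: option.splits)

lemma map_le_add_mono: "\<Gamma> \<subseteq>\<^sub>m \<Delta> \<Longrightarrow> \<Gamma> ++ \<Theta> \<subseteq>\<^sub>m \<Delta> ++ \<Theta>"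
  by (force simp: map_le_def map_add_def split: option.splits)

lemma disjoint_ctxs_Nil [simp]: "disjoint_ctxs []"
  by (simp add: disjoint_ctxs_def)

lemma disjoint_ctxs_Cons [simp]:
  "disjoint_ctxs (\<Gamma> # Gs) \<longleftrightarrow> (\<forall>\<Delta>\<in>set Gs. dom \<Gamma> \<inter> dom \<Delta> = {}) \<and> disjoint_ctxs Gs"
  by (simp add: disjoint_ctxs_def)

lemma str_only_empty [simp]: "str_only Map.empty"
  by (simp add: str_only_def)

lemma ctx_le_empty [simp]: "ctx_le Map.empty a"
  by (simp add: ctx_le_def)

lemma ctx_le_Box [simp]: "ctx_le [x \<mapsto> (Box, A)] a"
  by (simp add: ctx_le_def)

text \<open>A constant of its own, so that deletion can be pushed through \<open>++\<close> and
  pulled out again with \<open>ctx_del_add\<close> as a rewrite rule.\<close>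

definition ctx_del :: "name \<Rightarrow> tctx \<Rightarrow> tctx" where
  "ctx_del x \<Gamma> = \<Gamma>(x := None)"

lemma str_only_del: "str_only \<Gamma> \<Longrightarrow> str_only (ctx_del x \<Gamma>)"
  by (auto simp: str_only_def ran_def ctx_del_def)

lemma ctx_le_del: "ctx_le \<Gamma> a \<Longrightarrow> ctx_le (ctx_del x \<Gamma>) a"
  by (auto simp: ctx_le_def ran_def ctx_del_def)

lemma dom_del [simp]: "dom (ctx_del x \<Gamma>) = dom \<Gamma> - {x}"
  by (auto simp: ctx_del_def)

lemma ctx_del_add: "ctx_del x (\<Gamma> ++ \<Delta>) = ctx_del x \<Gamma> ++ ctx_del x \<Delta>"
  by (auto simp: ctx_del_def map_add_def fun_eq_iff split: option.splits)

lemma ctx_del_upd [simp]: "(ctx_del x \<Gamma>)(x \<mapsto> p) = \<Gamma>(x \<mapsto> p)"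
  by (auto simp: ctx_del_def)

lemma ctx_del_upd_other: "y \<noteq> x \<Longrightarrow> ctx_del x (\<Gamma>(y \<mapsto> p)) = (ctx_del x \<Gamma>)(y \<mapsto> p)"
  by (auto simp: ctx_del_def fun_eq_iff)

lemma ctx_del_single [simp]: "ctx_del x [x \<mapsto> p] = Map.empty"
  by (auto simp: ctx_del_def)

lemma ctx_del_empty [simp]: "ctx_del x Map.empty = Map.empty"
  by (auto simp: ctx_del_def)

text \<open>The premises of a rule that splits the context are typed in parts of the context of its
  conclusion. Disjointness is essential, as \<open>++\<close> lets its right operand override the
  left one.\<close>

lemma split2:
  assumes "disjoint_ctxs [\<Gamma>, \<Delta>1, \<Delta>2]"
  shows "\<Gamma> ++ \<Delta>1 \<subseteq>\<^sub>m \<Gamma> ++ \<Delta>1 ++ \<Delta>2" "\<Gamma> ++ \<Delta>2 \<subseteq>\<^sub>m \<Gamma> ++ \<Delta>1 ++ \<Delta>2"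
  by (rule map_le_refl map_le_add_mono map_le_add_right | use assms in \<open>auto; fail\<close>)+

lemma split4:
  assumes "disjoint_ctxs [\<Gamma>, \<Delta>1, \<Delta>2, \<Delta>3, \<Delta>4]"
  shows "\<Gamma> ++ \<Delta>1 \<subseteq>\<^sub>m \<Gamma> ++ \<Delta>1 ++ \<Delta>2 ++ \<Delta>3 ++ \<Delta>4"
    "\<Gamma> ++ \<Delta>2 \<subseteq>\<^sub>m \<Gamma> ++ \<Delta>1 ++ \<Delta>2 ++ \<Delta>3 ++ \<Delta>4"
    "\<Gamma> ++ \<Delta>3 \<subseteq>\<^sub>m \<Gamma> ++ \<Delta>1 ++ \<Delta>2 ++ \<Delta>3 ++ \<Delta>4"
    "\<Gamma> ++ \<Delta>4 \<subseteq>\<^sub>m \<Gamma> ++ \<Delta>1 ++ \<Delta>2 ++ \<Delta>3 ++ \<Delta>4"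
  by (rule map_le_refl map_le_add_mono map_le_add_right | use assms in \<open>auto; fail\<close>)+

lemma split_rec:
  assumes "disjoint_ctxs [\<Gamma>1, \<Gamma>2, \<Gamma>3, \<Delta>1, \<Delta>2]"
  shows "\<Gamma>1 ++ \<Delta>1 \<subseteq>\<^sub>m \<Gamma>1 ++ \<Gamma>2 ++ \<Gamma>3 ++ \<Delta>1 ++ \<Delta>2"
    "\<Gamma>1 ++ \<Gamma>2 \<subseteq>\<^sub>m \<Gamma>1 ++ \<Gamma>2 ++ \<Gamma>3 ++ \<Delta>1 ++ \<Delta>2"
    "\<Gamma>1 ++ \<Gamma>3 \<subseteq>\<^sub>m \<Gamma>1 ++ \<Gamma>2 ++ \<Gamma>3 ++ \<Delta>1 ++ \<Delta>2"
    "\<Gamma>1 ++ \<Gamma>2 ++ \<Gamma>3 ++ \<Delta>2 \<subseteq>\<^sub>m \<Gamma>1 ++ \<Gamma>2 ++ \<Gamma>3 ++ \<Delta>1 ++ \<Delta>2"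
  by (rule map_le_refl map_le_add_mono map_le_add_right | use assms in \<open>auto; fail\<close>)+

lemma map_le_SomeD: "\<Gamma> \<subseteq>\<^sub>m \<Delta> \<Longrightarrow> \<Gamma> x = Some p \<Longrightarrow> \<Delta> x = Some p"
  by (force simp: map_le_def)

lemma map_le_NoneD: "\<Gamma> \<subseteq>\<^sub>m \<Delta> \<Longrightarrow> \<Delta> x = None \<Longrightarrow> \<Gamma> x = None"
  by (metis map_le_SomeD not_None_eq)

text \<open>Does the work of a free-variable function: only declared variables can occur free in a
  typable term.\<close>

lemma typing_subst_fresh: "\<Gamma> \<turnstile> t \<Ztypecolon> A \<Longrightarrow> \<Gamma> x = None \<Longrightarrow> subst x v t = t"
proof (induction rule: typing.induct)
  case (ty_app \<Gamma> \<Delta>1 \<Delta>2)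
  note le = split2[OF ty_app.hyps(2)]
  show ?case using ty_app.IH ty_app.prems le[THEN map_le_NoneD] by simp
next
  case (ty_case \<Gamma> \<Delta>1 \<Delta>2 \<Delta>3 \<Delta>4)
  note le = split4[OF ty_case.hyps(2)]
  show ?case using ty_case.IH ty_case.prems le[THEN map_le_NoneD] by simp
next
  case (ty_rec \<Gamma>1 \<Gamma>2 \<Gamma>3 \<Delta>1 \<Delta>2)
  note le = split_rec[OF ty_rec.hyps(4)]
  show ?case using ty_rec.IH ty_rec.prems le[THEN map_le_NoneD] by simp
qed auto

lemma split_rest:
  fixes \<Gamma> \<Gamma>' :: tctx
  assumes "\<Gamma> \<subseteq>\<^sub>m \<Gamma>'"
  obtains \<Theta> where "\<Gamma>' = \<Gamma> ++ \<Theta>" "dom \<Gamma> \<inter> dom \<Theta> = {}"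
proof
  show "\<Gamma>' = \<Gamma> ++ (\<Gamma>' |` (- dom \<Gamma>))"
  proof
    show "\<Gamma>' x = (\<Gamma> ++ (\<Gamma>' |` (- dom \<Gamma>))) x" for x
      using assms map_le_SomeD[of \<Gamma> \<Gamma>' x]
      by (cases "\<Gamma> x") (auto simp: map_add_def restrict_map_def dom_def split: option.splits)
  qed
qed auto

text \<open>The surplus declarations may violate the conditions on aspects and on
  \<open>Str\<close>, so they go into a component free of both: that of the function in an
  application, that of the empty-string branch in a recursion and, by choice, in a case
  distinction.\<close>

lemma typing_weaken: "\<Gamma> \<turnstile> t \<Ztypecolon> A \<Longrightarrow> \<Gamma> \<subseteq>\<^sub>m \<Gamma>' \<Longrightarrow> \<Gamma>' \<turnstile> t \<Ztypecolon> A"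
proof (induction arbitrary: \<Gamma>' rule: typing.induct)
  case (ty_var \<Gamma> x a A)
  then show ?case by (meson map_le_SomeD typing.ty_var)
next
  case (ty_lam \<Gamma> x a A t B)
  show ?case by (intro typing.ty_lam ty_lam.IH map_le_upd ty_lam.prems)
next
  case (ty_app \<Gamma> \<Delta>1 \<Delta>2 t a A B s)
  obtain \<Theta> where \<Theta>: "\<Gamma>' = \<Gamma> ++ \<Delta>1 ++ \<Delta>2 ++ \<Theta>" "dom (\<Gamma> ++ \<Delta>1 ++ \<Delta>2) \<inter> dom \<Theta> = {}"
    using split_rest[OF ty_app.prems] .
  have "\<Gamma> ++ (\<Delta>1 ++ \<Theta>) ++ \<Delta>2 \<turnstile> App t s \<Ztypecolon> B"
  proof (rule typing.ty_app)
    show "\<Gamma> ++ (\<Delta>1 ++ \<Theta>) \<turnstile> t \<Ztypecolon> Arr a A B"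
      using \<Theta>(2) unfolding map_add_assoc
      by (intro ty_app.IH map_le_add_right[OF map_le_refl]) (auto simp: Int_Un_distrib2)
  qed (use ty_app \<Theta>(2) in \<open>auto\<close>)
  moreover have "\<Gamma> ++ (\<Delta>1 ++ \<Theta>) ++ \<Delta>2 = \<Gamma>'"
  proof -
    have "\<Delta>2 ++ \<Theta> = \<Theta> ++ \<Delta>2"
      using \<Theta>(2) by (intro map_add_comm) auto
    then show ?thesis
      unfolding \<Theta>(1) by (metis map_add_assoc)
  qed
  ultimately show ?case by simp
next
  case (ty_case \<Gamma> \<Delta>1 \<Delta>2 \<Delta>3 \<Delta>4 t t0 A t1 te)
  obtain \<Theta> where \<Theta>: "\<Gamma>' = \<Gamma> ++ \<Delta>1 ++ \<Delta>2 ++ \<Delta>3 ++ \<Delta>4 ++ \<Theta>"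
    "dom (\<Gamma> ++ \<Delta>1 ++ \<Delta>2 ++ \<Delta>3 ++ \<Delta>4) \<inter> dom \<Theta> = {}"
    using split_rest[OF ty_case.prems] .
  have "\<Gamma> ++ \<Delta>1 ++ \<Delta>2 ++ \<Delta>3 ++ (\<Delta>4 ++ \<Theta>) \<turnstile> Case A t t0 t1 te \<Ztypecolon> A"
  proof (rule typing.ty_case)
    show "\<Gamma> ++ (\<Delta>4 ++ \<Theta>) \<turnstile> te \<Ztypecolon> A"
      using \<Theta>(2) unfolding map_add_assoc
      by (intro ty_case.IH map_le_add_right[OF map_le_refl]) (auto simp: Int_Un_distrib2)
  qed (use ty_case \<Theta>(2) in auto)
  then show ?case using \<Theta>(1) by simp
next
  case (ty_rec \<Gamma>1 \<Gamma>2 \<Gamma>3 \<Delta>1 \<Delta>2 t t0 A t1 te)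
  obtain \<Theta> where \<Theta>: "\<Gamma>' = \<Gamma>1 ++ \<Gamma>2 ++ \<Gamma>3 ++ \<Delta>1 ++ \<Delta>2 ++ \<Theta>"
    "dom (\<Gamma>1 ++ \<Gamma>2 ++ \<Gamma>3 ++ \<Delta>1 ++ \<Delta>2) \<inter> dom \<Theta> = {}"
    using split_rest[OF ty_rec.prems] .
  have "\<Gamma>1 ++ \<Gamma>2 ++ \<Gamma>3 ++ \<Delta>1 ++ (\<Delta>2 ++ \<Theta>) \<turnstile> Rec A t t0 t1 te \<Ztypecolon> A"
  proof (rule typing.ty_rec)
    show "\<Gamma>1 ++ \<Gamma>2 ++ \<Gamma>3 ++ (\<Delta>2 ++ \<Theta>) \<turnstile> te \<Ztypecolon> A"
      using \<Theta>(2) unfolding map_add_assoc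
      by (intro ty_rec.IH map_le_add_right[OF map_le_refl]) (auto simp: Int_Un_distrib2)
  qed (use ty_rec \<Theta>(2) in auto)
  then show ?case using \<Theta>(1) by simp
qed (auto intro: typing.intros)

lemma typing_weaken_closed: "\<turnstile> t \<Ztypecolon> A \<Longrightarrow> \<Gamma> \<turnstile> t \<Ztypecolon> A"
  by (rule typing_weaken) auto

text \<open>As \<open>v\<close> is closed, its copies need no share of the context, and the splits
  survive the deletion of \<open>x\<close>. The hypothesis on \<open>v\<close> is conditional, so
  that it passes to premises whose part of the context lacks \<open>x\<close>.\<close>

lemma typing_subst:
  assumes "\<Gamma> \<turnstile> t \<Ztypecolon> B" "\<And>a A. \<Gamma> x = Some (a, A) \<Longrightarrow> \<turnstile> v \<Ztypecolon> A"
  shows "ctx_del x \<Gamma> \<turnstile> subst x v t \<Ztypecolon> B"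
  using assms
proof (induction rule: typing.induct)
  case (ty_var \<Gamma> y a A)
  then show ?case by (auto intro: typing_weaken_closed typing.ty_var simp: ctx_del_def)
next
  case (ty_lam \<Gamma> y a A t B)
  show ?case
  proof (cases "y = x")
    case True
    then show ?thesis using ty_lam.hyps by (simp add: typing.ty_lam)
  next
    case False
    have "ctx_del x (\<Gamma>(y \<mapsto> (a, A))) \<turnstile> subst x v t \<Ztypecolon> B"
      by (rule ty_lam.IH) (use False ty_lam.prems in simp)
    then show ?thesis using False typing.ty_lam by (simp add: ctx_del_upd_other)
  qed
next
  case (ty_app \<Gamma> \<Delta>1 \<Delta>2 t a A B s)
  note le = split2[OF ty_app.hyps(2), THEN map_le_SomeD]
  note ih = ty_app.IH(1)[OF ty_app.prems[OF le(1)]] ty_app.IH(2)[OF ty_app.prems[OF le(2)]]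
  show ?case unfolding ctx_del_add subst.simps
    by (intro typing.ty_app[where a = a and A = A] str_only_del ctx_le_del ty_app.hyps ih[unfolded ctx_del_add])
      (use ty_app.hyps(2) in auto)
next
  case (ty_case \<Gamma> \<Delta>1 \<Delta>2 \<Delta>3 \<Delta>4 t t0 A t1 te)
  note le = split4[OF ty_case.hyps(2), THEN map_le_SomeD]
  note ih = ty_case.IH(1)[OF ty_case.prems[OF le(1)]] ty_case.IH(2)[OF ty_case.prems[OF le(2)]]
    ty_case.IH(3)[OF ty_case.prems[OF le(3)]] ty_case.IH(4)[OF ty_case.prems[OF le(4)]]
  show ?case unfolding ctx_del_add subst.simps
    by (intro typing.ty_case str_only_del ty_case.hyps ih[unfolded ctx_del_add])
      (use ty_case.hyps(2) in auto)
next
  case (ty_rec \<Gamma>1 \<Gamma>2 \<Gamma>3 \<Delta>1 \<Delta>2 t t0 A t1 te)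
  note le = split_rec[OF ty_rec.hyps(4), THEN map_le_SomeD]
  note ih = ty_rec.IH(1)[OF ty_rec.prems[OF le(1)]] ty_rec.IH(2)[OF ty_rec.prems[OF le(2)]]
    ty_rec.IH(3)[OF ty_rec.prems[OF le(3)]] ty_rec.IH(4)[OF ty_rec.prems[OF le(4)]]
  show ?case unfolding ctx_del_add subst.simps
    by (intro typing.ty_rec str_only_del ctx_le_del ty_rec.hyps ih[unfolded ctx_del_add])
      (use ty_rec.hyps(4) in auto)
qed (auto intro: typing.intros)

lemma typing_subst1: "[x \<mapsto> (a, A)] \<turnstile> t \<Ztypecolon> B \<Longrightarrow> \<turnstile> v \<Ztypecolon> A \<Longrightarrow> \<turnstile> subst x v t \<Ztypecolon> B"
  using typing_subst[of "[x \<mapsto> (a, A)]" t B x v] by (auto split: if_splits)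

section \<open>Inversion, evaluation and termination\<close>

lemma typing_ConstD: "\<Gamma> \<turnstile> Const m \<Ztypecolon> B \<Longrightarrow> B = Str"
  by (induction \<Gamma> "Const m" B rule: typing.induct) (auto dest: subty_Str_left)

lemma typing_RandD: "\<Gamma> \<turnstile> Rand \<Ztypecolon> B \<Longrightarrow> B = Str"
  by (induction \<Gamma> Rand B rule: typing.induct) (auto dest: subty_Str_left)

lemma typing_S0D: "\<Gamma> \<turnstile> S0 t \<Ztypecolon> B \<Longrightarrow> \<Gamma> \<turnstile> t \<Ztypecolon> Str \<and> B = Str"
  by (induction \<Gamma> "S0 t" B rule: typing.induct) (auto dest: subty_Str_left)

lemma typing_S1D: "\<Gamma> \<turnstile> S1 t \<Ztypecolon> B \<Longrightarrow> \<Gamma> \<turnstile> t \<Ztypecolon> Str \<and> B = Str"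
  by (induction \<Gamma> "S1 t" B rule: typing.induct) (auto dest: subty_Str_left)

lemma typing_TailD: "\<Gamma> \<turnstile> Tail t \<Ztypecolon> B \<Longrightarrow> \<Gamma> \<turnstile> t \<Ztypecolon> Str \<and> B = Str"
  by (induction \<Gamma> "Tail t" B rule: typing.induct) (auto dest: subty_Str_left)

text \<open>Subsumption can follow any rule; transitivity merges such steps into one subtyping at
  the end. The inversions for application, case and recursion have the same form.\<close>

lemma typing_LamD:
  "\<Gamma> \<turnstile> Lam x a A t \<Ztypecolon> B \<Longrightarrow> \<exists>B'. \<Gamma>(x \<mapsto> (a, A)) \<turnstile> t \<Ztypecolon> B' \<and> Arr a A B' <: B"
  by (induction \<Gamma> "Lam x a A t" B rule: typing.induct) (blast intro: sub_refl sub_trans)+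

lemma typing_AppD:
  "\<Gamma> \<turnstile> App t s \<Ztypecolon> B \<Longrightarrow>
    \<exists>\<Theta> \<Delta>1 \<Delta>2 a A B'. \<Gamma> = \<Theta> ++ \<Delta>1 ++ \<Delta>2 \<and> str_only \<Theta> \<and> disjoint_ctxs [\<Theta>, \<Delta>1, \<Delta>2] \<and>
      \<Theta> ++ \<Delta>1 \<turnstile> t \<Ztypecolon> Arr a A B' \<and> \<Theta> ++ \<Delta>2 \<turnstile> s \<Ztypecolon> A \<and> ctx_le \<Theta> a \<and> ctx_le \<Delta>2 a \<and> B' <: B"
proof (induction \<Gamma> "App t s" B rule: typing.induct)
  case (ty_app \<Gamma> \<Delta>1 \<Delta>2 a A B)
  then show ?case using sub_refl by blast
next
  case (ty_sub \<Gamma> A B)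
  then show ?case using sub_trans by blast
qed

lemma typing_CaseD:
  "\<Gamma> \<turnstile> Case A t t0 t1 te \<Ztypecolon> B \<Longrightarrow>
    \<exists>\<Theta> \<Delta>1 \<Delta>2 \<Delta>3 \<Delta>4. \<Gamma> = \<Theta> ++ \<Delta>1 ++ \<Delta>2 ++ \<Delta>3 ++ \<Delta>4 \<and> str_only \<Theta> \<and>
      disjoint_ctxs [\<Theta>, \<Delta>1, \<Delta>2, \<Delta>3, \<Delta>4] \<and> \<Theta> ++ \<Delta>1 \<turnstile> t \<Ztypecolon> Str \<and> \<Theta> ++ \<Delta>2 \<turnstile> t0 \<Ztypecolon> A \<and>
      \<Theta> ++ \<Delta>3 \<turnstile> t1 \<Ztypecolon> A \<and> \<Theta> ++ \<Delta>4 \<turnstile> te \<Ztypecolon> A \<and> A <: B"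
proof (induction \<Gamma> "Case A t t0 t1 te" B rule: typing.induct)
  case (ty_sub \<Gamma> A B)
  then show ?case using sub_trans by blast
next
  case (ty_case \<Gamma> \<Delta>1 \<Delta>2 \<Delta>3 \<Delta>4)
  then show ?case using sub_refl by blast
qed

lemma typing_RecD:
  "\<Gamma> \<turnstile> Rec A t t0 t1 te \<Ztypecolon> B \<Longrightarrow>
    \<exists>\<Gamma>1 \<Gamma>2 \<Gamma>3 \<Delta>1 \<Delta>2. \<Gamma> = \<Gamma>1 ++ \<Gamma>2 ++ \<Gamma>3 ++ \<Delta>1 ++ \<Delta>2 \<and> str_only \<Gamma>1 \<and> str_only \<Gamma>2 \<and>
      str_only \<Gamma>3 \<and> disjoint_ctxs [\<Gamma>1, \<Gamma>2, \<Gamma>3, \<Delta>1, \<Delta>2] \<and> \<Gamma>1 ++ \<Delta>1 \<turnstile> t \<Ztypecolon> Str \<and>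
      \<Gamma>1 ++ \<Gamma>2 \<turnstile> t0 \<Ztypecolon> Arr Box Str (Arr BlackBox A A) \<and>
      \<Gamma>1 ++ \<Gamma>3 \<turnstile> t1 \<Ztypecolon> Arr Box Str (Arr BlackBox A A) \<and>
      \<Gamma>1 ++ \<Gamma>2 ++ \<Gamma>3 ++ \<Delta>2 \<turnstile> te \<Ztypecolon> A \<and>
      ctx_le \<Gamma>1 Box \<and> ctx_le \<Delta>1 Box \<and> box_free A \<and> A <: B"
proof (induction \<Gamma> "Rec A t t0 t1 te" B rule: typing.induct)
  case (ty_sub \<Gamma> A B)
  then show ?case using sub_trans by blast
next
  case (ty_rec \<Gamma>1 \<Gamma>2 \<Gamma>3 \<Delta>1 \<Delta>2)
  show ?case
    by (rule exI[of _ \<Gamma>1], rule exI[of _ \<Gamma>2], rule exI[of _ \<Gamma>3], rule exI[of _ \<Delta>1], rule exI[of _ \<Delta>2])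
      (use ty_rec.hyps sub_refl in simp)
qed

lemma closed_AppI: "\<turnstile> t \<Ztypecolon> Arr a A B \<Longrightarrow> \<turnstile> s \<Ztypecolon> A \<Longrightarrow> \<turnstile> App t s \<Ztypecolon> B"
  using ty_app[of Map.empty Map.empty Map.empty t a A B s] by simp

lemma closed_RecI:
  "\<lbrakk>\<turnstile> t \<Ztypecolon> Str; \<turnstile> t0 \<Ztypecolon> Arr Box Str (Arr BlackBox A A); \<turnstile> t1 \<Ztypecolon> Arr Box Str (Arr BlackBox A A);
    \<turnstile> te \<Ztypecolon> A; box_free A\<rbrakk> \<Longrightarrow> \<turnstile> Rec A t t0 t1 te \<Ztypecolon> A"
  using ty_rec[of Map.empty Map.empty Map.empty Map.empty Map.empty t t0 A t1 te] by simp

text \<open>The empty context splits only into empty parts, and the final subtyping is absorbed into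
  the result type of the function.\<close>

lemma closed_AppD: "\<turnstile> App t s \<Ztypecolon> B \<Longrightarrow> \<exists>a A. \<turnstile> t \<Ztypecolon> Arr a A B \<and> \<turnstile> s \<Ztypecolon> A"
  by (drule typing_AppD) (auto intro: ty_sub[OF _ sub_arr[OF sub_refl _ asp_le_refl]])

lemma closed_CaseD:
  "\<turnstile> Case A t t0 t1 te \<Ztypecolon> B \<Longrightarrow>
    \<turnstile> t \<Ztypecolon> Str \<and> \<turnstile> t0 \<Ztypecolon> A \<and> \<turnstile> t1 \<Ztypecolon> A \<and> \<turnstile> te \<Ztypecolon> A \<and> A <: B"
  by (drule typing_CaseD) auto

lemma closed_RecD:
  "\<turnstile> Rec A t t0 t1 te \<Ztypecolon> B \<Longrightarrow>
    \<turnstile> t \<Ztypecolon> Str \<and> \<turnstile> t0 \<Ztypecolon> Arr Box Str (Arr BlackBox A A) \<and>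
    \<turnstile> t1 \<Ztypecolon> Arr Box Str (Arr BlackBox A A) \<and> \<turnstile> te \<Ztypecolon> A \<and> box_free A \<and> A <: B"
  by (drule typing_RecD) auto

lemma closed_LamD:
  assumes "\<turnstile> Lam x b C r \<Ztypecolon> Arr a A B"
  shows "[x \<mapsto> (b, C)] \<turnstile> r \<Ztypecolon> B \<and> A <: C"
proof -
  obtain B' where "[x \<mapsto> (b, C)] \<turnstile> r \<Ztypecolon> B'" "Arr b C B' <: Arr a A B"
    using typing_LamD[OF assms] by blast
  then show ?thesis using ty_sub by (auto simp: subty_Arr_Arr)
qed

lemma closed_beta: "\<turnstile> Lam x b C r \<Ztypecolon> Arr a A B \<Longrightarrow> \<turnstile> v \<Ztypecolon> A \<Longrightarrow> \<turnstile> subst x v r \<Ztypecolon> B"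
  using closed_LamD typing_subst1 ty_sub by blast

lemma Lam_not_Str: "\<not> \<Gamma> \<turnstile> Lam x a A t \<Ztypecolon> Str"
  by (metis subty_Str_right ty.distinct(1) typing_LamD)

lemma closed_value_Str: "\<turnstile> v \<Ztypecolon> Str \<Longrightarrow> is_value v \<Longrightarrow> \<exists>m. v = Const m"
  by (cases v) (auto simp: Lam_not_Str)

lemma closed_value_Arr: "\<turnstile> v \<Ztypecolon> Arr a A B \<Longrightarrow> is_value v \<Longrightarrow> \<exists>x b C r. v = Lam x b C r"
  by (cases v) (auto dest: typing_ConstD)

section \<open>Possible results and well-founded evaluation\<close>

lemma eval_simps [simp]:
  "eval (Var x) = return_pmf None"
  "eval (Const m) = return_spmf (Const m)"
  "eval (Lam x a A r) = return_spmf (Lam x a A r)"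
  "eval (S0 t) = bind_spmf (eval t) (\<lambda>v. bind_spmf (the_str v) (\<lambda>m. return_spmf (Const (False # m))))"
  "eval (S1 t) = bind_spmf (eval t) (\<lambda>v. bind_spmf (the_str v) (\<lambda>m. return_spmf (Const (True # m))))"
  "eval (Tail t) = bind_spmf (eval t) (\<lambda>v. bind_spmf (the_str v) (\<lambda>m. return_spmf (Const (tl m))))"
  "eval (App t s) = bind_spmf (eval t) (\<lambda>f. bind_spmf (eval s) (\<lambda>v.
     bind_spmf (the_lam f) (\<lambda>(x, r). eval (subst x v r))))"
  "eval (Case A t t0 t1 te) = bind_spmf (eval t) (\<lambda>v. bind_spmf (the_str v) (\<lambda>m.
     case m of [] \<Rightarrow> eval te | b # n \<Rightarrow> eval (if b then t1 else t0)))"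
  "eval Rand = map_spmf (\<lambda>b. Const [b]) coin_spmf"
  by (subst eval.simps; simp)+

lemma eval_Rec:
  "eval (Rec A t t0 t1 te) = bind_spmf (eval t) (\<lambda>v. bind_spmf (the_str v) (\<lambda>m.
     case m of [] \<Rightarrow> eval te
       | b # n \<Rightarrow> eval (App (App (if b then t1 else t0) (Const (b # n))) (Rec A (Const n) t0 t1 te))))"
  by (subst eval.simps) simp

lemma eval_value: "is_value v \<Longrightarrow> eval v = return_spmf v"
  by (cases v) auto

abbreviation results :: "tm \<Rightarrow> tm set" where
  "results t \<equiv> set_spmf (eval t)"

definition is_str :: "tm \<Rightarrow> bool" where
  "is_str v \<longleftrightarrow> (\<exists>m. v = Const m)"

definition is_lam :: "tm \<Rightarrow> bool" where
  "is_lam v \<longleftrightarrow> (\<exists>x a A r. v = Lam x a A r)"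

text \<open>Accessibility for evaluation: each rule demands halting of the evaluations that may
  follow, and \<open>is_str\<close> and \<open>is_lam\<close> exclude stuck terms. Its rule
  induction is the induction along a computation that serves below for finiteness, preservation and
  the analysis of holes.\<close>

inductive halts :: "tm \<Rightarrow> bool" where
  halts_Const: "halts (Const m)"
| halts_Lam: "halts (Lam x a A t)"
| halts_Rand: "halts Rand"
| halts_S0: "halts t \<Longrightarrow> Ball (results t) is_str \<Longrightarrow> halts (S0 t)"
| halts_S1: "halts t \<Longrightarrow> Ball (results t) is_str \<Longrightarrow> halts (S1 t)"
| halts_Tail: "halts t \<Longrightarrow> Ball (results t) is_str \<Longrightarrow> halts (Tail t)"
| halts_App:
    "\<lbrakk>halts t; halts s; Ball (results t) is_lam;
      \<And>x a A r v. Lam x a A r \<in> results t \<Longrightarrow> v \<in> results s \<Longrightarrow> halts (subst x v r)\<rbrakk>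
     \<Longrightarrow> halts (App t s)"
| halts_Case:
    "\<lbrakk>halts t; Ball (results t) is_str; Const [] \<in> results t \<Longrightarrow> halts te;
      \<And>b n. Const (b # n) \<in> results t \<Longrightarrow> halts (if b then t1 else t0)\<rbrakk>
     \<Longrightarrow> halts (Case A t t0 t1 te)"
| halts_Rec:
    "\<lbrakk>halts t; Ball (results t) is_str; Const [] \<in> results t \<Longrightarrow> halts te;
      \<And>b n. Const (b # n) \<in> results t \<Longrightarrow>
        halts (App (App (if b then t1 else t0) (Const (b # n))) (Rec A (Const n) t0 t1 te))\<rbrakk>
     \<Longrightarrow> halts (Rec A t t0 t1 te)"

lemma results_bind_str:
  assumes "Ball (results t) is_str"
  shows "set_spmf (bind_spmf (eval t) (\<lambda>v. bind_spmf (the_str v) g)) =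
    (\<Union>m\<in>{m. Const m \<in> results t}. set_spmf (g m))"
proof -
  define M where "M = {m. Const m \<in> results t}"
  have *: "results t = Const ` M"
    using assms by (auto simp: is_str_def M_def)
  show ?thesis
    unfolding M_def[symmetric] set_bind_spmf bind_UNION * by (auto simp: o_def)
qed

lemma results_str:
  assumes "Ball (results t) is_str"
  shows "results (S0 t) = (\<Union>m\<in>{m. Const m \<in> results t}. {Const (False # m)})"
    "results (S1 t) = (\<Union>m\<in>{m. Const m \<in> results t}. {Const (True # m)})"
    "results (Tail t) = (\<Union>m\<in>{m. Const m \<in> results t}. {Const (tl m)})"
    "results (Case A t t0 t1 te) = (\<Union>m\<in>{m. Const m \<in> results t}.
       case m of [] \<Rightarrow> results te | b # n \<Rightarrow> results (if b then t1 else t0))"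
    "results (Rec A t t0 t1 te) = (\<Union>m\<in>{m. Const m \<in> results t}.
       case m of [] \<Rightarrow> results te | b # n \<Rightarrow>
         results (App (App (if b then t1 else t0) (Const (b # n))) (Rec A (Const n) t0 t1 te)))"
  unfolding eval_simps(4-6,8) eval_Rec results_bind_str[OF assms]
  by (rule SUP_cong; simp del: eval_simps split: list.split)+

lemma results_Case_cases:
  assumes "v \<in> results (Case A t t0 t1 te)" "Ball (results t) is_str"
  obtains "Const [] \<in> results t" "v \<in> results te"
  | b n where "Const (b # n) \<in> results t" "v \<in> results (if b then t1 else t0)"
proof -
  obtain m where "Const m \<in> results t"
    "v \<in> (case m of [] \<Rightarrow> results te | b # n \<Rightarrow> results (if b then t1 else t0))"
    using assms(1) unfolding results_str[OF assms(2)] by blast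
  with that show thesis by (cases m) simp_all
qed

lemma results_Rec_cases:
  assumes "v \<in> results (Rec A t t0 t1 te)" "Ball (results t) is_str"
  obtains "Const [] \<in> results t" "v \<in> results te"
  | b n where "Const (b # n) \<in> results t"
      "v \<in> results (App (App (if b then t1 else t0) (Const (b # n))) (Rec A (Const n) t0 t1 te))"
proof -
  obtain m where "Const m \<in> results t" "v \<in> (case m of [] \<Rightarrow> results te | b # n \<Rightarrow>
         results (App (App (if b then t1 else t0) (Const (b # n))) (Rec A (Const n) t0 t1 te)))"
    using assms(1) unfolding results_str[OF assms(2)] by blast
  with that show thesis by (cases m) (simp_all del: eval_simps)
qed

lemma results_App:
  "results (App t s) =
    (\<Union>f\<in>results t. \<Union>v\<in>results s. \<Union>(x, r)\<in>set_spmf (the_lam f). results (subst x v r))"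
  by (simp add: set_bind_spmf bind_UNION split_def o_def)

lemma halts_value: "halts t \<Longrightarrow> v \<in> results t \<Longrightarrow> is_value v"
proof (induction arbitrary: v rule: halts.induct)
  case (halts_App t s)
  obtain f w x r where "f \<in> results t" "w \<in> results s" "(x, r) \<in> set_spmf (the_lam f)"
    "v \<in> results (subst x w r)"
    using halts_App.prems unfolding results_App by auto
  moreover from this(1) halts_App.hyps(3) have "is_lam f" by auto
  ultimately show ?case using halts_App.IH(3) by (auto simp: is_lam_def)
next
  case (halts_Case t te t1 t0 A)
  show ?case using results_Case_cases[OF halts_Case.prems halts_Case.hyps(2)] halts_Case.IH by metis
next
  case (halts_Rec t te t1 t0 A)
  show ?case using results_Rec_cases[OF halts_Rec.prems halts_Rec.hyps(2)] halts_Rec.IH by metis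
qed (auto simp: results_str simp del: eval_simps(4-6))

lemma finite_strs: "finite (results t) \<Longrightarrow> finite {m. Const m \<in> results t}"
  by (rule finite_vimageI[of _ Const, unfolded vimage_def]) (auto intro: injI)

text \<open>\<open>Rand\<close> has two results, and every other construct continues from finitely
  many results of its parts. Finiteness later turns expectations into finite linear
  combinations.\<close>

lemma halts_finite: "halts t \<Longrightarrow> finite (results t)"
proof (induction rule: halts.induct)
  case (halts_App t s)
  have "finite (results (subst x v r))"
    if "f \<in> results t" "v \<in> results s" "(x, r) \<in> set_spmf (the_lam f)" for f v x r
    using that halts_App.hyps(3) halts_App.IH(3) by (fastforce simp: is_lam_def)
  moreover have "finite (set_spmf (the_lam f))" for f
    by (cases f) auto
  ultimately show ?case
    unfolding results_App using halts_App.IH(1,2) by (intro finite_UN_I) auto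
next
  case (halts_Case t te t1 t0 A)
  have "finite (case m of [] \<Rightarrow> results te | b # n \<Rightarrow> results (if b then t1 else t0))"
    if "Const m \<in> results t" for m
    using halts_Case.IH that by (cases m) simp_all
  then show ?case
    unfolding results_str[OF halts_Case.hyps(2)] by (auto intro!: finite_strs halts_Case.IH)
next
  case (halts_Rec t te t1 t0 A)
  have "finite (case m of [] \<Rightarrow> results te | b # n \<Rightarrow>
      results (App (App (if b then t1 else t0) (Const (b # n))) (Rec A (Const n) t0 t1 te)))"
    if "Const m \<in> results t" for m
    using halts_Rec.IH that by (cases m) (simp_all del: eval_simps)
  then show ?case
    unfolding results_str[OF halts_Rec.hyps(2)] by (auto intro!: finite_strs halts_Rec.IH simp del: eval_simps)
qed (auto simp: results_str finite_strs simp del: eval_simps(4-6))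

text \<open>Neither divergence nor a stuck term takes away probability mass. Total mass 1 is needed
  later to average a constant over the results.\<close>

lemma halts_lossless: "halts t \<Longrightarrow> lossless_spmf (eval t)"
proof (induction rule: halts.induct)
  case (halts_App t s)
  then show ?case by (force simp: is_lam_def)
next
  case (halts_Case t te t1 t0 A)
  then show ?case by (fastforce simp: is_str_def split: list.splits)
next
  case (halts_Rec t te t1 t0 A)
  then show ?case by (fastforce simp: is_str_def eval_Rec split: list.splits simp del: eval_simps)
qed (auto simp: is_str_def)

lemma preservation: "halts t \<Longrightarrow> \<turnstile> t \<Ztypecolon> B \<Longrightarrow> v \<in> results t \<Longrightarrow> \<turnstile> v \<Ztypecolon> B"
proof (induction arbitrary: B v rule: halts.induct)
  case halts_Rand
  then show ?case by (auto dest!: typing_RandD intro: typing.intros)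
next
  case (halts_S0 t)
  then show ?case by (auto dest!: typing_S0D simp: results_str simp del: eval_simps intro: typing.intros)
next
  case (halts_S1 t)
  then show ?case by (auto dest!: typing_S1D simp: results_str simp del: eval_simps intro: typing.intros)
next
  case (halts_Tail t)
  then show ?case by (auto dest!: typing_TailD simp: results_str simp del: eval_simps intro: typing.intros)
next
  case (halts_App t s)
  obtain a A where ty: "\<turnstile> t \<Ztypecolon> Arr a A B" "\<turnstile> s \<Ztypecolon> A"
    using closed_AppD[OF halts_App.prems(1)] by blast
  obtain x b C r w where w: "Lam x b C r \<in> results t" "w \<in> results s" "v \<in> results (subst x w r)"
    using halts_App.prems(2) halts_App.hyps(3) unfolding results_App is_lam_def by fastforce
  show ?case
    using halts_App.IH(3)[OF w(1,2) closed_beta w(3)] halts_App.IH(1)[OF ty(1) w(1)] halts_App.IH(2)[OF ty(2) w(2)]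
    by blast
next
  case (halts_Case t te t1 t0 A)
  from closed_CaseD[OF halts_Case.prems(1)] have ty: "\<turnstile> t0 \<Ztypecolon> A" "\<turnstile> t1 \<Ztypecolon> A" "\<turnstile> te \<Ztypecolon> A" "A <: B"
    by auto
  have "\<turnstile> v \<Ztypecolon> A"
  proof (cases rule: results_Case_cases[OF halts_Case.prems(2) halts_Case.hyps(2)])
    case 1
    then show ?thesis using halts_Case.IH(2) ty by blast
  next
    case (2 b n)
    have "\<turnstile> (if b then t1 else t0) \<Ztypecolon> A"
      using ty by simp
    with 2 show ?thesis using halts_Case.IH(3) by blast
  qed
  with ty(4) show ?case using ty_sub by blast
next
  case (halts_Rec t te t1 t0 A)
  from closed_RecD[OF halts_Rec.prems(1)] have ty: "\<turnstile> t0 \<Ztypecolon> Arr Box Str (Arr BlackBox A A)"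
    "\<turnstile> t1 \<Ztypecolon> Arr Box Str (Arr BlackBox A A)" "\<turnstile> te \<Ztypecolon> A" "box_free A" "A <: B"
    by auto
  \<comment> \<open>The unrolled recursion is typable at the annotated type \<open>A\<close>, not
    merely at its supertype \<open>B\<close>, since the step functions map \<open>A\<close> to
    \<open>A\<close>.\<close>
  have unroll: "\<turnstile> App (App (if b then t1 else t0) (Const m)) (Rec A (Const n) t0 t1 te) \<Ztypecolon> A" for b m n
    using ty by (intro closed_AppI[of _ BlackBox A] closed_AppI[of _ Box Str] closed_RecI ty_const) auto
  have "\<turnstile> v \<Ztypecolon> A"
  proof (cases rule: results_Rec_cases[OF halts_Rec.prems(2) halts_Rec.hyps(2)])
    case 1
    then show ?thesis using halts_Rec.IH(2) ty by blast
  next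
    case (2 b n)
    have "\<turnstile> App (App (if b then t1 else t0) (Const (b # n))) (Rec A (Const n) t0 t1 te) \<Ztypecolon> A"
      by (rule unroll)
    with 2 show ?thesis using halts_Rec.IH(3) by blast
  qed
  with ty(5) show ?case using ty_sub by blast
qed auto

section \<open>Typable closed terms terminate\<close>

text \<open>Closedness without free variables: as \<open>v\<close> is arbitrary, a free
  \<open>x\<close> would show.\<close>

definition closed :: "tm \<Rightarrow> bool" where
  "closed t \<longleftrightarrow> (\<forall>x v. subst x v t = t)"

lemma closedD: "closed t \<Longrightarrow> subst x v t = t"
  by (simp add: closed_def)

lemma typing_closed: "\<turnstile> t \<Ztypecolon> A \<Longrightarrow> closed t"
  by (simp add: closed_def typing_subst_fresh)

text \<open>Tait's predicate on values. It includes closedness at arrows because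
  \<open>subst\<close> does not rename binders and environments must therefore consist of closed
  terms; for strings this is automatic.\<close>

fun red_val :: "ty \<Rightarrow> tm \<Rightarrow> bool" where
  "red_val Str v \<longleftrightarrow> is_str v"
| "red_val (Arr a A B) v \<longleftrightarrow> closed v \<and> (\<exists>x b C r. v = Lam x b C r \<and>
     (\<forall>w. red_val A w \<longrightarrow> halts (subst x w r) \<and> (\<forall>u \<in> results (subst x w r). red_val B u)))"

definition red :: "ty \<Rightarrow> tm \<Rightarrow> bool" where
  "red A t \<longleftrightarrow> halts t \<and> Ball (results t) (red_val A)"

text \<open>Subtypes differ only in aspects, and \<open>red_val\<close> depends on the arrow
  structure alone, so contravariance is harmless.\<close>

lemma red_val_subty: "A <: B \<Longrightarrow> red_val A = red_val B"
  by (induction rule: subty.induct) (auto simp: fun_eq_iff)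

lemma red_val_closed: "red_val A v \<Longrightarrow> closed v"
  by (cases A) (auto simp: is_str_def closed_def)

lemma red_App:
  assumes "red (Arr a A B) t" "red A s"
  shows "red B (App t s)"
proof -
  have "Ball (results t) is_lam"
    using assms by (auto simp: red_def is_lam_def)
  moreover have "red B (subst x v r)" if "Lam x b C r \<in> results t" "v \<in> results s" for x b C r v
    using assms that by (force simp: red_def)
  ultimately show ?thesis
    using assms unfolding red_def results_App
    by (fastforce intro!: halts_App simp: is_lam_def)
qed

lemma red_Str: "red Str t \<longleftrightarrow> halts t \<and> Ball (results t) is_str"
  by (auto simp: red_def)

lemma red_Const: "red Str (Const m)"
  by (simp add: red_Str halts_Const is_str_def)

lemma red_Case:
  assumes "red Str t" "red A t0" "red A t1" "red A te"
  shows "red A (Case B t t0 t1 te)"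
proof -
  have "red_val A v" if "v \<in> results (Case B t t0 t1 te)" for v
    using that
    by (rule results_Case_cases) (use assms in \<open>auto simp: red_def split: if_splits\<close>)
  then show ?thesis
    using assms by (auto simp: red_def simp del: eval_simps intro!: halts_Case)
qed

lemma red_Rec_unroll:
  assumes "red Str t" "red A te"
    and "\<And>b n. Const (b # n) \<in> results t \<Longrightarrow>
      red A (App (App (if b then t1 else t0) (Const (b # n))) (Rec B (Const n) t0 t1 te))"
  shows "red A (Rec B t t0 t1 te)"
proof -
  have "red_val A v" if "v \<in> results (Rec B t t0 t1 te)" for v
    using that
    by (rule results_Rec_cases) (use assms in \<open>auto simp: red_def simp del: eval_simps\<close>)
  then show ?thesis
    using assms unfolding red_def by (simp add: halts_Rec del: eval_simps)
qed

text \<open>Unrolling produces a recursion again, but on the tail of the string, so induction on the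
  string applies.\<close>

lemma red_Rec_Const:
  assumes "red (Arr a Str (Arr b A A)) t0" "red (Arr a Str (Arr b A A)) t1" "red A te"
  shows "red A (Rec B (Const m) t0 t1 te)"
proof (induction m)
  case Nil
  show ?case using assms red_Const by (intro red_Rec_unroll) auto
next
  case (Cons c m)
  show ?case
  proof (rule red_Rec_unroll)
    fix d n assume "Const (d # n) \<in> results (Const (c # m))"
    then have "d = c" "n = m" by auto
    then show "red A (App (App (if d then t1 else t0) (Const (d # n))) (Rec B (Const n) t0 t1 te))"
      using assms Cons red_Const by (intro red_App[of b A] red_App[of a Str]) auto
  qed (use assms red_Const in auto)
qed

lemma red_Rec:
  assumes "red Str t" "red (Arr a Str (Arr b A A)) t0" "red (Arr a Str (Arr b A A)) t1" "red A te"
  shows "red A (Rec B t t0 t1 te)"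
proof (rule red_Rec_unroll)
  fix d n
  show "red A (App (App (if d then t1 else t0) (Const (d # n))) (Rec B (Const n) t0 t1 te))"
    using assms red_Const red_Rec_Const[OF assms(2-4)]
    by (intro red_App[of b A] red_App[of a Str]) auto
qed (use assms in auto)

section \<open>Simultaneous substitution and the fundamental lemma\<close>

fun msubst :: "(name \<rightharpoonup> tm) \<Rightarrow> tm \<Rightarrow> tm" where
  "msubst \<sigma> (Var y) = (case \<sigma> y of None \<Rightarrow> Var y | Some v \<Rightarrow> v)"
| "msubst \<sigma> (Const m) = Const m"
| "msubst \<sigma> (Lam y a A t) = Lam y a A (msubst (\<sigma>(y := None)) t)"
| "msubst \<sigma> (S0 t) = S0 (msubst \<sigma> t)"
| "msubst \<sigma> (S1 t) = S1 (msubst \<sigma> t)"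
| "msubst \<sigma> (Tail t) = Tail (msubst \<sigma> t)"
| "msubst \<sigma> (App t s) = App (msubst \<sigma> t) (msubst \<sigma> s)"
| "msubst \<sigma> (Case A t t0 t1 te) =
     Case A (msubst \<sigma> t) (msubst \<sigma> t0) (msubst \<sigma> t1) (msubst \<sigma> te)"
| "msubst \<sigma> (Rec A t t0 t1 te) =
     Rec A (msubst \<sigma> t) (msubst \<sigma> t0) (msubst \<sigma> t1) (msubst \<sigma> te)"
| "msubst \<sigma> Rand = Rand"

lemma msubst_empty: "msubst Map.empty t = t"
  by (induction t) auto

lemma ran_delete: "Ball (ran \<sigma>) P \<Longrightarrow> Ball (ran (\<sigma>(x := None))) P"
  by (auto simp: ran_def)

text \<open>Connects a beta step with an extended environment: what \<open>\<sigma>\<close> inserts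
  is closed, so the substitution for \<open>x\<close> meets only the occurrences that
  \<open>\<sigma>(x := None)\<close> has left.\<close>

lemma subst_msubst:
  "Ball (ran \<sigma>) closed \<Longrightarrow>
    subst x v (msubst (\<sigma>(x := None)) t) = msubst (\<sigma>(x \<mapsto> v)) t"
proof (induction t arbitrary: \<sigma>)
  case (Var y)
  then show ?case by (auto simp: closedD ran_def split: option.splits)
next
  case (Lam y a A t)
  show ?case
  proof (cases "y = x")
    case True
    then show ?thesis
      unfolding msubst.simps subst.simps if_P[OF True] True by (simp only: fun_upd_upd if_True)
  next
    case False
    have "subst x v (msubst ((\<sigma>(y := None))(x := None)) t) = msubst ((\<sigma>(y := None))(x \<mapsto> v)) t"
      by (intro Lam.IH ran_delete Lam.prems)
    then have "subst x v (msubst ((\<sigma>(x := None))(y := None)) t) = msubst ((\<sigma>(x \<mapsto> v))(y := None)) t"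
      by (simp add: fun_upd_twist[OF False, of \<sigma> None None] fun_upd_twist[OF False, of \<sigma> None "Some v"])
    then show ?thesis
      unfolding msubst.simps subst.simps if_not_P[OF False] by (rule arg_cong)
  qed
qed auto

lemma map_le_not_None: "\<Gamma> \<subseteq>\<^sub>m \<Delta> \<Longrightarrow> \<Gamma> x \<noteq> None \<Longrightarrow> \<Delta> x \<noteq> None"
  using map_le_SomeD[of \<Gamma> \<Delta> x] by auto

text \<open>An environment that covers the declared variables closes the term. This supplies the
  closedness that \<open>red_val\<close> demands of abstractions.\<close>

lemma subst_msubst_fresh:
  assumes "\<Gamma> \<turnstile> t \<Ztypecolon> A" "Ball (ran \<sigma>) closed" "\<Gamma> y \<noteq> None \<Longrightarrow> \<sigma> y \<noteq> None"
  shows "subst y w (msubst \<sigma> t) = msubst \<sigma> t"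
  using assms
proof (induction arbitrary: \<sigma> rule: typing.induct)
  case (ty_var \<Gamma> x a A)
  then show ?case by (auto simp: closedD ran_def split: option.splits)
next
  case (ty_lam \<Gamma> x a A t B)
  have "subst y w (msubst (\<sigma>(x := None)) t) = msubst (\<sigma>(x := None)) t" if "x \<noteq> y"
    using ty_lam.prems(2) that by (intro ty_lam.IH ran_delete ty_lam.prems(1)) auto
  then show ?case by auto
next
  case (ty_app \<Gamma> \<Delta>1 \<Delta>2 t a A B s)
  note le = split2[OF ty_app.hyps(2), THEN map_le_not_None, of y]
  show ?case
    using ty_app.IH(1)[OF ty_app.prems(1) ty_app.prems(2)[OF le(1)]]
      ty_app.IH(2)[OF ty_app.prems(1) ty_app.prems(2)[OF le(2)]]
    by simp
next
  case (ty_case \<Gamma> \<Delta>1 \<Delta>2 \<Delta>3 \<Delta>4 t t0 A t1 te)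
  note le = split4[OF ty_case.hyps(2), THEN map_le_not_None, of y]
  show ?case
    using ty_case.IH(1)[OF ty_case.prems(1) ty_case.prems(2)[OF le(1)]]
      ty_case.IH(2)[OF ty_case.prems(1) ty_case.prems(2)[OF le(2)]]
      ty_case.IH(3)[OF ty_case.prems(1) ty_case.prems(2)[OF le(3)]]
      ty_case.IH(4)[OF ty_case.prems(1) ty_case.prems(2)[OF le(4)]]
    by simp
next
  case (ty_rec \<Gamma>1 \<Gamma>2 \<Gamma>3 \<Delta>1 \<Delta>2 t t0 A t1 te)
  note le = split_rec[OF ty_rec.hyps(4), THEN map_le_not_None, of y]
  show ?case
    using ty_rec.IH(1)[OF ty_rec.prems(1) ty_rec.prems(2)[OF le(1)]]
      ty_rec.IH(2)[OF ty_rec.prems(1) ty_rec.prems(2)[OF le(2)]]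
      ty_rec.IH(3)[OF ty_rec.prems(1) ty_rec.prems(2)[OF le(3)]]
      ty_rec.IH(4)[OF ty_rec.prems(1) ty_rec.prems(2)[OF le(4)]]
    by simp
qed auto

lemma red_val_value: "red_val A v \<Longrightarrow> is_value v"
  by (cases A) (auto simp: is_str_def)

text \<open>\<open>\<sigma>\<close> may be defined on more than the declared variables, so one
  environment serves all parts of a split context; its range is closed also beyond them.\<close>

definition red_env :: "tctx \<Rightarrow> (name \<rightharpoonup> tm) \<Rightarrow> bool" where
  "red_env \<Gamma> \<sigma> \<longleftrightarrow> (\<forall>x a A. \<Gamma> x = Some (a, A) \<longrightarrow> (\<exists>v. \<sigma> x = Some v \<and> red_val A v)) \<and>
     Ball (ran \<sigma>) closed"

lemma red_env_mono: "red_env \<Gamma>' \<sigma> \<Longrightarrow> \<Gamma> \<subseteq>\<^sub>m \<Gamma>' \<Longrightarrow> red_env \<Gamma> \<sigma>"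
  unfolding red_env_def by (meson map_le_SomeD)

lemma halts_is_value: "is_value v \<Longrightarrow> halts v"
  by (cases v) (auto intro: halts.intros)

lemma red_fundamental: "\<Gamma> \<turnstile> t \<Ztypecolon> A \<Longrightarrow> red_env \<Gamma> \<sigma> \<Longrightarrow> red A (msubst \<sigma> t)"
proof (induction arbitrary: \<sigma> rule: typing.induct)
  case (ty_var \<Gamma> x a A)
  then obtain v where "\<sigma> x = Some v" "red_val A v"
    unfolding red_env_def by blast
  then show ?case by (simp add: red_def eval_value halts_is_value red_val_value)
next
  case (ty_rand \<Gamma>)
  show ?case by (auto simp: red_Str is_str_def intro: halts_Rand)
next
  case (ty_S0 \<Gamma> t)
  then show ?case by (force simp: red_Str results_str is_str_def simp del: eval_simps intro: halts_S0)
next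
  case (ty_S1 \<Gamma> t)
  then show ?case by (force simp: red_Str results_str is_str_def simp del: eval_simps intro: halts_S1)
next
  case (ty_tail \<Gamma> t)
  then show ?case by (force simp: red_Str results_str is_str_def simp del: eval_simps intro: halts_Tail)
next
  case (ty_lam \<Gamma> x a A t B)
  have cl: "Ball (ran \<sigma>) closed" and dom: "\<And>y. \<Gamma> y \<noteq> None \<Longrightarrow> \<sigma> y \<noteq> None"
    using ty_lam.prems unfolding red_env_def by (blast, force)
  have "closed (msubst \<sigma> (Lam x a A t))"
    unfolding closed_def
    using subst_msubst_fresh[OF typing.ty_lam[OF ty_lam.hyps] cl dom] by blast
  moreover have "red B (subst x w (msubst (\<sigma>(x := None)) t))" if "red_val A w" for w
  proof -
    have "red_env (\<Gamma>(x \<mapsto> (a, A))) (\<sigma>(x \<mapsto> w))"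
      using ty_lam.prems that by (auto simp: red_env_def red_val_closed ran_def)
    then show ?thesis
      unfolding subst_msubst[OF cl] by (rule ty_lam.IH)
  qed
  ultimately show ?case by (auto simp: red_def intro: halts_Lam)
next
  case (ty_sub \<Gamma> t A B)
  then show ?case by (simp add: red_def red_val_subty)
next
  case (ty_app \<Gamma> \<Delta>1 \<Delta>2 t a A B s)
  show ?case
    unfolding msubst.simps
    by (rule red_App[OF ty_app.IH[OF red_env_mono[OF ty_app.prems]]]; rule split2[OF ty_app.hyps(2)])
next
  case (ty_case \<Gamma> \<Delta>1 \<Delta>2 \<Delta>3 \<Delta>4 t t0 A t1 te)
  show ?case
    unfolding msubst.simps
    by (rule red_Case[OF ty_case.IH[OF red_env_mono[OF ty_case.prems]]]; rule split4[OF ty_case.hyps(2)])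
next
  case (ty_rec \<Gamma>1 \<Gamma>2 \<Gamma>3 \<Delta>1 \<Delta>2 t t0 A t1 te)
  show ?case
    unfolding msubst.simps
    by (rule red_Rec[OF ty_rec.IH[OF red_env_mono[OF ty_rec.prems]]]; rule split_rec[OF ty_rec.hyps(4)])
qed (auto simp: red_Const)

lemma typing_halts: "\<turnstile> t \<Ztypecolon> A \<Longrightarrow> halts t"
  using red_fundamental[of Map.empty t A Map.empty] by (simp add: red_env_def msubst_empty red_def)

section \<open>Continuations\<close>

text \<open>The continuation \<open>x, r\<close> binds its argument with aspect \<open>Box\<close>, the least one, so that no
  side condition on aspects can forbid a use of \<open>x\<close>.\<close>

definition kont :: "name \<Rightarrow> tm \<Rightarrow> ty \<Rightarrow> bool" where
  "kont x r B \<longleftrightarrow> [x \<mapsto> (Box, B)] \<turnstile> r \<Ztypecolon> Str"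

text \<open>Amounts to \<open>prob_eps (App (Lam x a B r) t)\<close> for any annotation
  \<open>a\<close>, \<open>B\<close>.\<close>

definition prob_kont :: "name \<Rightarrow> tm \<Rightarrow> tm \<Rightarrow> real" where
  "prob_kont x r t = spmf (bind_spmf (eval t) (\<lambda>v. eval (subst x v r))) (Const [])"

lemma spmf_bind_finite:
  assumes "finite (set_spmf p)"
  shows "spmf (bind_spmf p f) y = (\<Sum>v\<in>set_spmf p. spmf p v * spmf (f v) y)"
proof -
  have "spmf (bind_spmf p f) y = (\<integral>v. spmf (f v) y \<partial>measure_spmf p)"
    by (rule spmf_bind)
  also have "\<dots> = (\<integral>v. spmf p v * spmf (f v) y \<partial>count_space UNIV)"
    by (intro integral_measure_spmf measure_spmf.integrable_const_bound[where B = 1]) (auto simp: pmf_le_1)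
  also have "\<dots> = (\<Sum>v | v \<in> UNIV \<and> spmf p v * spmf (f v) y \<noteq> 0. spmf p v * spmf (f v) y)"
    by (intro lebesgue_integral_count_space_finite_support finite_subset[OF _ assms])
      (auto simp: in_set_spmf_iff_spmf)
  also have "\<dots> = (\<Sum>v\<in>set_spmf p. spmf p v * spmf (f v) y)"
    using assms by (intro sum.mono_neutral_left) (auto simp: in_set_spmf_iff_spmf)
  finally show ?thesis .
qed

section \<open>Evaluation frames and their composition with continuations\<close>

lemma bind_eval_results: "halts t \<Longrightarrow> (\<And>v. v \<in> results t \<Longrightarrow> is_value v \<Longrightarrow> f v = g v) \<Longrightarrow>
    bind_spmf (eval t) f = bind_spmf (eval t) g"
  using halts_value by (intro bind_spmf_cong) auto

lemma eval_idem: "halts t \<Longrightarrow> bind_spmf (eval t) eval = eval t"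
  using bind_eval_results[of t eval return_spmf] by (simp add: eval_value)

text \<open>Evaluation contexts as functions on terms. The first condition makes
  \<open>E (Var x)\<close> a faithful syntactic form of \<open>E\<close>; the second says that
  evaluation may start at the hole.\<close>

definition frame :: "name \<Rightarrow> (tm \<Rightarrow> tm) \<Rightarrow> bool" where
  "frame x E \<longleftrightarrow> (\<forall>v. subst x v (E (Var x)) = E v) \<and>
     (\<forall>t. halts t \<longrightarrow> eval (E t) = bind_spmf (eval t) (\<lambda>v. eval (E v)))"

lemma frameI:
  assumes "\<And>v. subst x v (E (Var x)) = E v" "\<And>t. eval (E t) = bind_spmf (eval t) g"
  shows "frame x E"
proof -
  have "bind_spmf (eval t) (\<lambda>v. eval (E v)) = bind_spmf (eval t) g" if "halts t" for t
    using that by (rule bind_eval_results) (simp add: assms(2) eval_value)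
  with assms show ?thesis by (simp add: frame_def)
qed

lemma frame_id: "frame x (\<lambda>z. z)"
  by (simp add: frame_def eval_idem)

lemma frame_S0: "frame x S0"
  by (rule frameI) (simp, rule eval_simps)

lemma frame_S1: "frame x S1"
  by (rule frameI) (simp, rule eval_simps)

lemma frame_Tail: "frame x Tail"
  by (rule frameI) (simp, rule eval_simps)

lemma frame_AppL: "closed s \<Longrightarrow> frame x (\<lambda>z. App z s)"
  by (rule frameI) (simp add: closedD, rule eval_simps)

lemma frame_AppR: "closed w \<Longrightarrow> is_value w \<Longrightarrow> frame x (App w)"
  by (rule frameI[where g = "\<lambda>v. bind_spmf (the_lam w) (\<lambda>(x, r). eval (subst x v r))"])
    (simp_all add: closedD eval_value)

lemma frame_Case: "closed t0 \<Longrightarrow> closed t1 \<Longrightarrow> closed te \<Longrightarrow> frame x (\<lambda>z. Case A z t0 t1 te)"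
  by (rule frameI) (simp add: closedD, rule eval_simps)

lemma frame_Rec: "closed t0 \<Longrightarrow> closed t1 \<Longrightarrow> closed te \<Longrightarrow> frame x (\<lambda>z. Rec A z t0 t1 te)"
  by (rule frameI) (simp add: closedD, rule eval_Rec)

text \<open>Read as \<open>let x = E x in r\<close>: the value received goes through the frame
  \<open>E\<close> before \<open>r\<close> continues. The abstraction binds the \<open>x\<close> of
  \<open>r\<close>, so both may use one name.\<close>

abbreviation kcomp :: "name \<Rightarrow> tm \<Rightarrow> ty \<Rightarrow> (tm \<Rightarrow> tm) \<Rightarrow> tm" where
  "kcomp x r B E \<equiv> App (Lam x Box B r) (E (Var x))"

lemma prob_kont_comp:
  assumes "frame x E" "halts t"
  shows "prob_kont x (kcomp x r B E) t = prob_kont x r (E t)"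
proof -
  have "eval (subst x v (kcomp x r B E)) = bind_spmf (eval (E v)) (\<lambda>w. eval (subst x w r))" for v
    using assms(1) by (simp add: frame_def)
  then show ?thesis
    using assms unfolding prob_kont_def frame_def by simp
qed

text \<open>The aspect \<open>Box\<close> on both binders meets the condition that the application
  rule puts on the context of its argument.\<close>

lemma kont_comp:
  assumes "kont x r B" "[x \<mapsto> (Box, B')] \<turnstile> E (Var x) \<Ztypecolon> B"
  shows "kont x (kcomp x r B E) B'"
proof -
  have "[x \<mapsto> (Box, B')] \<turnstile> Lam x Box B r \<Ztypecolon> Arr Box B Str"
    using assms(1) by (auto intro!: ty_lam simp: kont_def)
  then have "\<turnstile> Lam x Box B r \<Ztypecolon> Arr Box B Str"
    using assms(1) by (auto intro!: ty_lam simp: kont_def)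
  then show ?thesis
    using ty_app[of Map.empty Map.empty "[x \<mapsto> (Box, B')]" "Lam x Box B r" Box B Str "E (Var x)"] assms(2)
    by (simp add: kont_def)
qed

lemma ty_hyp: "[x \<mapsto> (Box, B)] \<turnstile> Var x \<Ztypecolon> B"
  by (rule ty_var[where a = Box]) simp

text \<open>With the identity frame, \<open>kcomp\<close> is a coercion: a continuation for
  \<open>B\<close> becomes one for any subtype of \<open>B\<close>, with the same probabilities.
  This does the work of narrowing a declaration to a subtype.\<close>

lemma prob_kont_comp_id: "halts t \<Longrightarrow> prob_kont x (kcomp x r B (\<lambda>z. z)) t = prob_kont x r t"
  by (rule prob_kont_comp[OF frame_id])

lemma ty_App_hypL: "\<turnstile> s \<Ztypecolon> C \<Longrightarrow> [x \<mapsto> (Box, Arr a C B)] \<turnstile> App (Var x) s \<Ztypecolon> B"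
  using ty_app[of Map.empty "[x \<mapsto> (Box, Arr a C B)]" Map.empty "Var x" a C B s] by (simp add: ty_hyp)

lemma ty_App_hypR: "\<turnstile> t \<Ztypecolon> Arr a C B \<Longrightarrow> [x \<mapsto> (Box, C)] \<turnstile> App t (Var x) \<Ztypecolon> B"
  using ty_app[of Map.empty Map.empty "[x \<mapsto> (Box, C)]" t a C B "Var x"] by (simp add: ty_hyp)

lemma ty_Case_hyp:
  "\<turnstile> t0 \<Ztypecolon> B \<Longrightarrow> \<turnstile> t1 \<Ztypecolon> B \<Longrightarrow> \<turnstile> te \<Ztypecolon> B \<Longrightarrow> [x \<mapsto> (Box, Str)] \<turnstile> Case B (Var x) t0 t1 te \<Ztypecolon> B"
  using ty_case[of Map.empty "[x \<mapsto> (Box, Str)]" Map.empty Map.empty Map.empty "Var x" t0 B t1 te]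
  by (simp add: ty_hyp)

lemma ty_Rec_hyp:
  "\<lbrakk>\<turnstile> t0 \<Ztypecolon> Arr Box Str (Arr BlackBox B B); \<turnstile> t1 \<Ztypecolon> Arr Box Str (Arr BlackBox B B); \<turnstile> te \<Ztypecolon> B; box_free B\<rbrakk>
    \<Longrightarrow> [x \<mapsto> (Box, Str)] \<turnstile> Rec B (Var x) t0 t1 te \<Ztypecolon> B"
  using ty_rec[of Map.empty Map.empty Map.empty "[x \<mapsto> (Box, Str)]" Map.empty "Var x" t0 B t1 te]
  by (simp add: ty_hyp)

text \<open>Meant for the case that the part evaluated first is free of the hole: \<open>p\<close>
  and its finitely many weights are then the same for all fillings.\<close>

lemma prob_kont_sum:
  assumes "eval t = bind_spmf p (\<lambda>v. eval (E v))" "finite (set_spmf p)"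
  shows "prob_kont x r t = (\<Sum>v\<in>set_spmf p. spmf p v * prob_kont x r (E v))"
  using assms by (simp add: prob_kont_def spmf_bind_finite)

lemma prob_kont_AppR:
  assumes "is_value w" "halts t"
  shows "prob_kont x r (App w t) = (\<Sum>v\<in>results t. spmf (eval t) v * prob_kont x r (App w v))"
proof (rule prob_kont_sum)
  have "bind_spmf (eval t) (\<lambda>v. eval (App w v)) = bind_spmf (eval t) (\<lambda>v.
       bind_spmf (the_lam w) (\<lambda>(x, r). eval (subst x v r)))"
    using assms(2) by (rule bind_eval_results) (simp add: assms(1) eval_value)
  then show "eval (App w t) = bind_spmf (eval t) (\<lambda>v. eval (App w v))"
    using assms(1) by (simp add: eval_value)
qed (use assms halts_finite in auto)

lemma eval_beta: "is_value v \<Longrightarrow> eval (App (Lam x a A r) v) = eval (subst x v r)"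
  by (simp add: eval_value)

lemma prob_kont_beta: "is_value v \<Longrightarrow> prob_kont x r (App (Lam y a A r') v) = prob_kont x r (subst y v r')"
  by (simp add: eval_beta prob_kont_def del: eval_simps)

lemma prob_kont_App_left:
  assumes "halts t"
  shows "prob_kont x r (App t s) = (\<Sum>w\<in>results t. spmf (eval t) w * prob_kont x r (App w s))"
proof (rule prob_kont_sum)
  have "bind_spmf (eval t) (\<lambda>w. eval (App w s)) = bind_spmf (eval t) (\<lambda>w.
       bind_spmf (eval s) (\<lambda>v. bind_spmf (the_lam w) (\<lambda>(x, r). eval (subst x v r))))"
    using assms by (rule bind_eval_results) (simp add: eval_value)
  then show "eval (App t s) = bind_spmf (eval t) (\<lambda>w. eval (App w s))"
    by simp
qed (use assms halts_finite in auto)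

lemma sum_strs:
  assumes "Ball (results t) is_str"
  shows "(\<Sum>v\<in>results t. f v) = (\<Sum>m\<in>{m. Const m \<in> results t}. f (Const m))"
proof -
  define M where "M = {m. Const m \<in> results t}"
  have *: "results t = Const ` M"
    using assms by (auto simp: is_str_def M_def)
  have "inj_on Const M" by (auto intro: inj_onI)
  then show ?thesis
    unfolding M_def[symmetric] unfolding * by (simp add: sum.reindex)
qed

lemma prob_kont_Case:
  assumes "halts t" "Ball (results t) is_str"
  shows "prob_kont x r (Case A t t0 t1 te) = (\<Sum>m\<in>{m. Const m \<in> results t}. spmf (eval t) (Const m) *
    prob_kont x r (case m of [] \<Rightarrow> te | b # n \<Rightarrow> if b then t1 else t0))"
proof -
  have "prob_kont x r (Case A t t0 t1 te) = (\<Sum>v\<in>results t. spmf (eval t) v * prob_kont x r (Case A v t0 t1 te))"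
  proof (rule prob_kont_sum)
    show "eval (Case A t t0 t1 te) = bind_spmf (eval t) (\<lambda>v. eval (Case A v t0 t1 te))"
      unfolding eval_simps(8) using assms(1) by (intro bind_eval_results) (auto simp: eval_value)
  qed (use assms halts_finite in auto)
  moreover have "prob_kont x r (Case A (Const m) t0 t1 te) =
      prob_kont x r (case m of [] \<Rightarrow> te | b # n \<Rightarrow> if b then t1 else t0)" for m
    by (cases m) (simp_all add: prob_kont_def)
  ultimately show ?thesis by (simp add: sum_strs[OF assms(2)])
qed

lemma prob_kont_Rec:
  assumes "halts t" "Ball (results t) is_str"
  shows "prob_kont x r (Rec A t t0 t1 te) = (\<Sum>m\<in>{m. Const m \<in> results t}. spmf (eval t) (Const m) *
    prob_kont x r (case m of [] \<Rightarrow> te | b # n \<Rightarrow>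
      App (App (if b then t1 else t0) (Const (b # n))) (Rec A (Const n) t0 t1 te)))"
proof -
  have "prob_kont x r (Rec A t t0 t1 te) = (\<Sum>v\<in>results t. spmf (eval t) v * prob_kont x r (Rec A v t0 t1 te))"
  proof (rule prob_kont_sum)
    show "eval (Rec A t t0 t1 te) = bind_spmf (eval t) (\<lambda>v. eval (Rec A v t0 t1 te))"
      unfolding eval_Rec using assms(1) by (intro bind_eval_results) (auto simp: eval_value)
  qed (use assms halts_finite in auto)
  moreover have "prob_kont x r (Rec A (Const m) t0 t1 te) =
      prob_kont x r (case m of [] \<Rightarrow> te | b # n \<Rightarrow>
        App (App (if b then t1 else t0) (Const (b # n))) (Rec A (Const n) t0 t1 te))" for m
    by (cases m) (simp_all add: prob_kont_def eval_Rec del: eval_simps(7))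
  ultimately show ?thesis by (simp add: sum_strs[OF assms(2)])
qed

section \<open>Terms with a hole\<close>

text \<open>The terms \<open>e i\<close> arise from one typed context by filling in the closed terms \<open>h i\<close> of type \<open>A\<close>.
  The hole is not copied by evaluation: it occurs once, except that all branches of a case
  distinction may contain it. Unlike in \<open>ctxt\<close>, it may occur in the base case of a recursion, because
  substitution can move it there.\<close>

inductive htyping :: "('i \<Rightarrow> tm) \<Rightarrow> ty \<Rightarrow> tctx \<Rightarrow> ('i \<Rightarrow> tm) \<Rightarrow> ty \<Rightarrow> bool" for h A where
  ht_const: "\<Gamma> \<turnstile> t \<Ztypecolon> B \<Longrightarrow> htyping h A \<Gamma> (\<lambda>_. t) B"
| ht_hole: "htyping h A Map.empty h A"
| ht_weak: "htyping h A Map.empty e B \<Longrightarrow> htyping h A \<Gamma> e B"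
| ht_sub: "htyping h A \<Gamma> e B \<Longrightarrow> B <: C \<Longrightarrow> htyping h A \<Gamma> e C"
| ht_lam: "htyping h A (\<Gamma>(x \<mapsto> (a, C))) e B \<Longrightarrow> htyping h A \<Gamma> (\<lambda>i. Lam x a C (e i)) (Arr a C B)"
| ht_S0: "htyping h A \<Gamma> e Str \<Longrightarrow> htyping h A \<Gamma> (\<lambda>i. S0 (e i)) Str"
| ht_S1: "htyping h A \<Gamma> e Str \<Longrightarrow> htyping h A \<Gamma> (\<lambda>i. S1 (e i)) Str"
| ht_Tail: "htyping h A \<Gamma> e Str \<Longrightarrow> htyping h A \<Gamma> (\<lambda>i. Tail (e i)) Str"
| ht_appL:
    "\<lbrakk>str_only \<Gamma>; disjoint_ctxs [\<Gamma>, \<Delta>1, \<Delta>2];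
      htyping h A (\<Gamma> ++ \<Delta>1) e (Arr a C B); \<Gamma> ++ \<Delta>2 \<turnstile> s \<Ztypecolon> C; ctx_le \<Gamma> a; ctx_le \<Delta>2 a\<rbrakk>
     \<Longrightarrow> htyping h A (\<Gamma> ++ \<Delta>1 ++ \<Delta>2) (\<lambda>i. App (e i) s) B"
| ht_appR:
    "\<lbrakk>str_only \<Gamma>; disjoint_ctxs [\<Gamma>, \<Delta>1, \<Delta>2];
      \<Gamma> ++ \<Delta>1 \<turnstile> t \<Ztypecolon> Arr a C B; htyping h A (\<Gamma> ++ \<Delta>2) e C; ctx_le \<Gamma> a; ctx_le \<Delta>2 a\<rbrakk>
     \<Longrightarrow> htyping h A (\<Gamma> ++ \<Delta>1 ++ \<Delta>2) (\<lambda>i. App t (e i)) B"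
| ht_case:
    "\<lbrakk>str_only \<Gamma>; disjoint_ctxs [\<Gamma>, \<Delta>1, \<Delta>2, \<Delta>3, \<Delta>4];
      htyping h A (\<Gamma> ++ \<Delta>1) e Str; \<Gamma> ++ \<Delta>2 \<turnstile> t0 \<Ztypecolon> B; \<Gamma> ++ \<Delta>3 \<turnstile> t1 \<Ztypecolon> B; \<Gamma> ++ \<Delta>4 \<turnstile> te \<Ztypecolon> B\<rbrakk>
     \<Longrightarrow> htyping h A (\<Gamma> ++ \<Delta>1 ++ \<Delta>2 ++ \<Delta>3 ++ \<Delta>4) (\<lambda>i. Case B (e i) t0 t1 te) B"
| ht_branch:
    "\<lbrakk>str_only \<Gamma>; disjoint_ctxs [\<Gamma>, \<Delta>1, \<Delta>2, \<Delta>3, \<Delta>4];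
      \<Gamma> ++ \<Delta>1 \<turnstile> t \<Ztypecolon> Str; htyping h A (\<Gamma> ++ \<Delta>2) e0 B; htyping h A (\<Gamma> ++ \<Delta>3) e1 B;
      htyping h A (\<Gamma> ++ \<Delta>4) ee B\<rbrakk>
     \<Longrightarrow> htyping h A (\<Gamma> ++ \<Delta>1 ++ \<Delta>2 ++ \<Delta>3 ++ \<Delta>4) (\<lambda>i. Case B t (e0 i) (e1 i) (ee i)) B"
| ht_rec:
    "\<lbrakk>str_only \<Gamma>1; str_only \<Gamma>2; str_only \<Gamma>3; disjoint_ctxs [\<Gamma>1, \<Gamma>2, \<Gamma>3, \<Delta>1, \<Delta>2];
      htyping h A (\<Gamma>1 ++ \<Delta>1) e Str;
      \<Gamma>1 ++ \<Gamma>2 \<turnstile> t0 \<Ztypecolon> Arr Box Str (Arr BlackBox B B);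
      \<Gamma>1 ++ \<Gamma>3 \<turnstile> t1 \<Ztypecolon> Arr Box Str (Arr BlackBox B B);
      \<Gamma>1 ++ \<Gamma>2 ++ \<Gamma>3 ++ \<Delta>2 \<turnstile> te \<Ztypecolon> B;
      ctx_le \<Gamma>1 Box; ctx_le \<Delta>1 Box; box_free B\<rbrakk>
     \<Longrightarrow> htyping h A (\<Gamma>1 ++ \<Gamma>2 ++ \<Gamma>3 ++ \<Delta>1 ++ \<Delta>2) (\<lambda>i. Rec B (e i) t0 t1 te) B"
| ht_rec_base:
    "\<lbrakk>str_only \<Gamma>1; str_only \<Gamma>2; str_only \<Gamma>3; disjoint_ctxs [\<Gamma>1, \<Gamma>2, \<Gamma>3, \<Delta>1, \<Delta>2];
      \<Gamma>1 ++ \<Delta>1 \<turnstile> t \<Ztypecolon> Str;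
      \<Gamma>1 ++ \<Gamma>2 \<turnstile> t0 \<Ztypecolon> Arr Box Str (Arr BlackBox B B);
      \<Gamma>1 ++ \<Gamma>3 \<turnstile> t1 \<Ztypecolon> Arr Box Str (Arr BlackBox B B);
      htyping h A (\<Gamma>1 ++ \<Gamma>2 ++ \<Gamma>3 ++ \<Delta>2) ee B;
      ctx_le \<Gamma>1 Box; ctx_le \<Delta>1 Box; box_free B\<rbrakk>
     \<Longrightarrow> htyping h A (\<Gamma>1 ++ \<Gamma>2 ++ \<Gamma>3 ++ \<Delta>1 ++ \<Delta>2) (\<lambda>i. Rec B t t0 t1 (ee i)) B"

lemma htyping_typing:
  assumes "\<And>i. \<turnstile> h i \<Ztypecolon> A" "htyping h A \<Gamma> e B"
  shows "\<Gamma> \<turnstile> e i \<Ztypecolon> B"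
  using assms(2)
proof (induction rule: htyping.induct)
  case (ht_weak e B \<Gamma>)
  show ?case by (rule typing_weaken_closed[OF ht_weak.IH])
next
  case (ht_lam \<Gamma> x a C e B)
  show ?case by (rule ty_lam[OF ht_lam.IH])
next
  case (ht_appL \<Gamma> \<Delta>1 \<Delta>2 e a C B s)
  show ?case by (rule ty_app[OF ht_appL.hyps(1,2) ht_appL.IH ht_appL.hyps(4-6)])
next
  case (ht_appR \<Gamma> \<Delta>1 \<Delta>2 t a C B e)
  show ?case by (rule ty_app[OF ht_appR.hyps(1-3) ht_appR.IH ht_appR.hyps(5-6)])
qed (auto intro: typing.intros assms(1))

text \<open>Here the substituted term is free of the hole. The fillings are closed, so they stay as
  they are, and so does everything introduced by \<open>ht_weak\<close>.\<close>

lemma htyping_subst: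
  assumes h: "\<And>i. \<turnstile> h i \<Ztypecolon> A"
    and "htyping h A \<Gamma> e B" "\<And>a C. \<Gamma> y = Some (a, C) \<Longrightarrow> \<turnstile> v \<Ztypecolon> C"
  shows "htyping h A (ctx_del y \<Gamma>) (\<lambda>i. subst y v (e i)) B"
  using assms(2,3)
proof (induction rule: htyping.induct)
  case (ht_const \<Gamma> t B)
  then show ?case by (intro htyping.ht_const typing_subst)
next
  case ht_hole
  have "(\<lambda>i. subst y v (h i)) = h"
    using h typing_closed closedD by blast
  then show ?case by (simp add: htyping.ht_hole)
next
  case (ht_weak e B \<Gamma>)
  have "(\<lambda>i. subst y v (e i)) = e"
    using htyping_typing[OF h ht_weak.hyps] typing_closed closedD by blast
  then show ?case using ht_weak.hyps by (simp add: htyping.ht_weak)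
next
  case (ht_sub \<Gamma> e B C)
  then show ?case by (blast intro: htyping.ht_sub)
next
  case (ht_lam \<Gamma> x a C e B)
  show ?case
  proof (cases "x = y")
    case True
    then show ?thesis using ht_lam.hyps by (simp add: htyping.ht_lam)
  next
    case False
    have "htyping h A (ctx_del y (\<Gamma>(x \<mapsto> (a, C)))) (\<lambda>i. subst y v (e i)) B"
      by (rule ht_lam.IH) (use False ht_lam.prems in simp)
    then show ?thesis using False htyping.ht_lam by (simp add: ctx_del_upd_other)
  qed
next
  case (ht_appL \<Gamma> \<Delta>1 \<Delta>2 e a C B s)
  note le = split2[OF ht_appL.hyps(2), THEN map_le_SomeD]
  note ih = ht_appL.IH[OF ht_appL.prems[OF le(1)]] typing_subst[OF ht_appL.hyps(4) ht_appL.prems[OF le(2)]]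
  show ?case unfolding ctx_del_add subst.simps
    by (intro htyping.ht_appL[where a = a and C = C] str_only_del ctx_le_del ht_appL.hyps ih[unfolded ctx_del_add])
      (use ht_appL.hyps(2) in auto)
next
  case (ht_appR \<Gamma> \<Delta>1 \<Delta>2 t a C B e)
  note le = split2[OF ht_appR.hyps(2), THEN map_le_SomeD]
  note ih = typing_subst[OF ht_appR.hyps(3) ht_appR.prems[OF le(1)]] ht_appR.IH[OF ht_appR.prems[OF le(2)]]
  show ?case unfolding ctx_del_add subst.simps
    by (intro htyping.ht_appR[where a = a and C = C] str_only_del ctx_le_del ht_appR.hyps ih[unfolded ctx_del_add])
      (use ht_appR.hyps(2) in auto)
next
  case (ht_case \<Gamma> \<Delta>1 \<Delta>2 \<Delta>3 \<Delta>4 e t0 B t1 te)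
  note le = split4[OF ht_case.hyps(2), THEN map_le_SomeD]
  note ih = ht_case.IH[OF ht_case.prems[OF le(1)]] typing_subst[OF ht_case.hyps(4) ht_case.prems[OF le(2)]]
    typing_subst[OF ht_case.hyps(5) ht_case.prems[OF le(3)]] typing_subst[OF ht_case.hyps(6) ht_case.prems[OF le(4)]]
  show ?case unfolding ctx_del_add subst.simps
    by (intro htyping.ht_case str_only_del ht_case.hyps ih[unfolded ctx_del_add])
      (use ht_case.hyps(2) in auto)
next
  case (ht_branch \<Gamma> \<Delta>1 \<Delta>2 \<Delta>3 \<Delta>4 t e0 B e1 ee)
  note le = split4[OF ht_branch.hyps(2), THEN map_le_SomeD]
  note ih = typing_subst[OF ht_branch.hyps(3) ht_branch.prems[OF le(1)]] ht_branch.IH(1)[OF ht_branch.prems[OF le(2)]]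
    ht_branch.IH(2)[OF ht_branch.prems[OF le(3)]] ht_branch.IH(3)[OF ht_branch.prems[OF le(4)]]
  show ?case unfolding ctx_del_add subst.simps
    by (intro htyping.ht_branch str_only_del ht_branch.hyps ih[unfolded ctx_del_add])
      (use ht_branch.hyps(2) in auto)
next
  case (ht_rec \<Gamma>1 \<Gamma>2 \<Gamma>3 \<Delta>1 \<Delta>2 e t0 B t1 te)
  note le = split_rec[OF ht_rec.hyps(4), THEN map_le_SomeD]
  note ih = ht_rec.IH[OF ht_rec.prems[OF le(1)]] typing_subst[OF ht_rec.hyps(6) ht_rec.prems[OF le(2)]]
    typing_subst[OF ht_rec.hyps(7) ht_rec.prems[OF le(3)]] typing_subst[OF ht_rec.hyps(8) ht_rec.prems[OF le(4)]]
  show ?case unfolding ctx_del_add subst.simps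
    by (intro htyping.ht_rec str_only_del ctx_le_del ht_rec.hyps ih[unfolded ctx_del_add])
      (use ht_rec.hyps(4) in auto)
next
  case (ht_rec_base \<Gamma>1 \<Gamma>2 \<Gamma>3 \<Delta>1 \<Delta>2 t t0 B t1 ee)
  note le = split_rec[OF ht_rec_base.hyps(4), THEN map_le_SomeD]
  note ih = typing_subst[OF ht_rec_base.hyps(5) ht_rec_base.prems[OF le(1)]]
    typing_subst[OF ht_rec_base.hyps(6) ht_rec_base.prems[OF le(2)]]
    typing_subst[OF ht_rec_base.hyps(7) ht_rec_base.prems[OF le(3)]]
    ht_rec_base.IH[OF ht_rec_base.prems[OF le(4)]]
  show ?case unfolding ctx_del_add subst.simps
    by (intro htyping.ht_rec_base str_only_del ctx_le_del ht_rec_base.hyps ih[unfolded ctx_del_add])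
      (use ht_rec_base.hyps(4) in auto)
qed (auto intro: htyping.intros)

lemma str_only_not_Arr: "str_only \<Gamma> \<Longrightarrow> \<Gamma> y \<noteq> Some (a, Arr b C D)"
  by (auto simp: str_only_def ran_def)

lemma ctx_del_fresh: "\<Gamma> y = None \<Longrightarrow> ctx_del y \<Gamma> = \<Gamma>"
  by (auto simp: ctx_del_def)

lemma typing_del: "\<Gamma> \<turnstile> t \<Ztypecolon> B \<Longrightarrow> \<Gamma> y = None \<Longrightarrow> ctx_del y \<Gamma> \<turnstile> subst y v t \<Ztypecolon> B"
  by (simp add: ctx_del_fresh typing_subst_fresh)

lemma htyping_subst_fresh:
  "\<Gamma> \<turnstile> t \<Ztypecolon> B \<Longrightarrow> \<Gamma> y = None \<Longrightarrow> htyping h A (ctx_del y \<Gamma>) (\<lambda>i. subst y (g i) t) B"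
  by (simp add: ctx_del_fresh typing_subst_fresh ht_const)

text \<open>A variable of function type cannot be declared in a shared context, so it occurs in at most
  one subterm. This is what keeps the hole from being copied.\<close>

lemma htyping_subst_hole:
  assumes "\<Gamma> \<turnstile> t \<Ztypecolon> B" "\<Gamma> y = Some (a, Arr b C D)" "htyping h A Map.empty g (Arr b C D)"
  shows "htyping h A (ctx_del y \<Gamma>) (\<lambda>i. subst y (g i) t) B"
  using assms(1,2)
proof (induction rule: typing.induct)
  case (ty_var \<Gamma> x c E)
  show ?case
  proof (cases "x = y")
    case True
    then show ?thesis using ty_var assms(3) by (simp add: ht_weak)
  next
    case False
    then show ?thesis using ty_var by (auto intro!: ht_const typing.ty_var simp: ctx_del_def)
  qed
next
  case (ty_lam \<Gamma> x c E t B)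
  show ?case
  proof (cases "x = y")
    case True
    then show ?thesis using ty_lam.hyps by (simp add: typing.ty_lam ht_const)
  next
    case False
    have "htyping h A (ctx_del y (\<Gamma>(x \<mapsto> (c, E)))) (\<lambda>i. subst y (g i) t) B"
      by (rule ty_lam.IH) (use False ty_lam.prems in simp)
    then show ?thesis using False htyping.ht_lam by (simp add: ctx_del_upd_other)
  qed
next
  case (ty_sub \<Gamma> t E F)
  then show ?case by (blast intro: ht_sub)
next
  case (ty_app \<Gamma> \<Delta>1 \<Delta>2 t c E B s)
  have dis: "disjoint_ctxs [ctx_del y \<Gamma>, ctx_del y \<Delta>1, ctx_del y \<Delta>2]"
    using ty_app.hyps(2) by auto
  note side = str_only_del[OF ty_app.hyps(1)] dis
  note le = ctx_le_del[OF ty_app.hyps(5)] ctx_le_del[OF ty_app.hyps(6)]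
  have "\<Gamma> y = None"
    using ty_app.prems ty_app.hyps(1,2) str_only_not_Arr
    by (fastforce simp: map_add_def split: option.splits)
  then consider "(\<Gamma> ++ \<Delta>1) y = Some (a, Arr b C D)" "(\<Gamma> ++ \<Delta>2) y = None"
    | "(\<Gamma> ++ \<Delta>1) y = None" "(\<Gamma> ++ \<Delta>2) y = Some (a, Arr b C D)"
    using ty_app.prems ty_app.hyps(2) by (force simp: map_add_def split: option.splits)
  then show ?case
  proof cases
    case 1
    show ?thesis
      unfolding ctx_del_add subst.simps typing_subst_fresh[OF ty_app.hyps(4) 1(2)]
      by (rule ht_appL[OF side ty_app.IH(1)[OF 1(1), unfolded ctx_del_add] _ le])
        (use typing_del[OF ty_app.hyps(4) 1(2)] in \<open>simp add: typing_subst_fresh[OF ty_app.hyps(4) 1(2)] flip: ctx_del_add\<close>)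
  next
    case 2
    show ?thesis
      unfolding ctx_del_add subst.simps typing_subst_fresh[OF ty_app.hyps(3) 2(1)]
      by (rule ht_appR[OF side _ ty_app.IH(2)[OF 2(2), unfolded ctx_del_add] le])
        (use typing_del[OF ty_app.hyps(3) 2(1)] in \<open>simp add: typing_subst_fresh[OF ty_app.hyps(3) 2(1)] flip: ctx_del_add\<close>)
  qed
next
  case (ty_case \<Gamma> \<Delta>1 \<Delta>2 \<Delta>3 \<Delta>4 t t0 B t1 te)
  have dis: "disjoint_ctxs [ctx_del y \<Gamma>, ctx_del y \<Delta>1, ctx_del y \<Delta>2, ctx_del y \<Delta>3, ctx_del y \<Delta>4]"
    using ty_case.hyps(2) by auto
  note side = str_only_del[OF ty_case.hyps(1)] dis
  have G: "\<Gamma> y = None"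
    using ty_case.prems ty_case.hyps(1,2) str_only_not_Arr
    by (fastforce simp: map_add_def split: option.splits)
  \<comment> \<open>By disjointness \<open>y\<close> is declared in at most one branch context. The
    other branches are constant families, so \<open>ht_branch\<close> covers all three positions at
    once.\<close>
  have br: "htyping h A (ctx_del y (\<Gamma> ++ \<Delta>)) (\<lambda>i. subst y (g i) u) B"
    if "\<Gamma> ++ \<Delta> \<turnstile> u \<Ztypecolon> B" "(\<Gamma> ++ \<Delta>) y = Some (a, Arr b C D) \<Longrightarrow> htyping h A (ctx_del y (\<Gamma> ++ \<Delta>)) (\<lambda>i. subst y (g i) u) B"
      "\<Delta> y = None \<or> \<Delta> y = Some (a, Arr b C D)" for \<Delta> u
    using that htyping_subst_fresh[OF that(1), of y h A g] G by (auto simp: map_add_def)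
  consider "\<Delta>1 y = Some (a, Arr b C D)" "\<Delta>2 y = None" "\<Delta>3 y = None" "\<Delta>4 y = None"
    | "\<Delta>1 y = None" "\<And>\<Delta>. \<Delta> \<in> {\<Delta>2, \<Delta>3, \<Delta>4} \<Longrightarrow> \<Delta> y = None \<or> \<Delta> y = Some (a, Arr b C D)"
    using ty_case.prems ty_case.hyps(2) G by (force simp: map_add_def split: option.splits)
  then show ?case
  proof cases
    case 1
    have none: "(\<Gamma> ++ \<Delta>2) y = None" "(\<Gamma> ++ \<Delta>3) y = None" "(\<Gamma> ++ \<Delta>4) y = None"
      using 1 G by (auto simp: map_add_def)
    note fr = typing_subst_fresh[OF ty_case.hyps(4) none(1)] typing_subst_fresh[OF ty_case.hyps(5) none(2)]
      typing_subst_fresh[OF ty_case.hyps(6) none(3)]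
    have "(\<Gamma> ++ \<Delta>1) y = Some (a, Arr b C D)"
      using 1 by (simp add: map_add_def)
    then show ?thesis
      unfolding ctx_del_add subst.simps fr
      by (rule ht_case[OF side ty_case.IH(1)[unfolded ctx_del_add] ]; fold ctx_del_add)
        (use ty_case.hyps none in \<open>simp_all add: ctx_del_fresh\<close>)
  next
    case 2
    have none: "(\<Gamma> ++ \<Delta>1) y = None"
      using 2 G by (auto simp: map_add_def)
    note fr = typing_subst_fresh[OF ty_case.hyps(3) none]
    have "ctx_del y (\<Gamma> ++ \<Delta>1) \<turnstile> t \<Ztypecolon> Str"
      using ty_case.hyps(3) none by (simp add: ctx_del_fresh)
    moreover have "htyping h A (ctx_del y (\<Gamma> ++ \<Delta>2)) (\<lambda>i. subst y (g i) t0) B"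
      by (rule br[of \<Delta>2 t0, OF ty_case.hyps(4) _ 2(2)[of \<Delta>2]], erule ty_case.IH(2)) simp
    moreover have "htyping h A (ctx_del y (\<Gamma> ++ \<Delta>3)) (\<lambda>i. subst y (g i) t1) B"
      by (rule br[of \<Delta>3 t1, OF ty_case.hyps(5) _ 2(2)[of \<Delta>3]], erule ty_case.IH(3)) simp
    moreover have "htyping h A (ctx_del y (\<Gamma> ++ \<Delta>4)) (\<lambda>i. subst y (g i) te) B"
      by (rule br[of \<Delta>4 te, OF ty_case.hyps(6) _ 2(2)[of \<Delta>4]], erule ty_case.IH(4)) simp
    ultimately show ?thesis
      unfolding ctx_del_add subst.simps fr by (rule ht_branch[OF side])
  qed
next
  case (ty_rec \<Gamma>1 \<Gamma>2 \<Gamma>3 \<Delta>1 \<Delta>2 t t0 B t1 te)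
  have dis: "disjoint_ctxs [ctx_del y \<Gamma>1, ctx_del y \<Gamma>2, ctx_del y \<Gamma>3, ctx_del y \<Delta>1, ctx_del y \<Delta>2]"
    using ty_rec.hyps(4) by auto
  note side = str_only_del[OF ty_rec.hyps(1)] str_only_del[OF ty_rec.hyps(2)] str_only_del[OF ty_rec.hyps(3)] dis
  note le = ctx_le_del[OF ty_rec.hyps(9)] ctx_le_del[OF ty_rec.hyps(10)]
  \<comment> \<open>Unrolling copies the step functions, but their contexts declare only strings, so
    \<open>y\<close> cannot occur in them. It is left to the argument or to the base case.\<close>
  have G: "\<Gamma>1 y = None" "\<Gamma>2 y = None" "\<Gamma>3 y = None"
    using ty_rec.prems ty_rec.hyps(1-4) str_only_not_Arr
    by (fastforce simp: map_add_def split: option.splits)+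
  then have none: "(\<Gamma>1 ++ \<Gamma>2) y = None" "(\<Gamma>1 ++ \<Gamma>3) y = None"
    by (auto simp: map_add_def)
  note fr = typing_subst_fresh[OF ty_rec.hyps(6) none(1)] typing_subst_fresh[OF ty_rec.hyps(7) none(2)]
  have ty: "ctx_del y (\<Gamma>1 ++ \<Gamma>2) \<turnstile> t0 \<Ztypecolon> Arr Box Str (Arr BlackBox B B)"
    "ctx_del y (\<Gamma>1 ++ \<Gamma>3) \<turnstile> t1 \<Ztypecolon> Arr Box Str (Arr BlackBox B B)"
    using ty_rec.hyps(6,7) none by (simp_all add: ctx_del_fresh)
  consider "(\<Gamma>1 ++ \<Delta>1) y = Some (a, Arr b C D)" "(\<Gamma>1 ++ \<Gamma>2 ++ \<Gamma>3 ++ \<Delta>2) y = None"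
    | "(\<Gamma>1 ++ \<Delta>1) y = None" "(\<Gamma>1 ++ \<Gamma>2 ++ \<Gamma>3 ++ \<Delta>2) y = Some (a, Arr b C D)"
    using ty_rec.prems ty_rec.hyps(4) G by (force simp: map_add_def split: option.splits)
  then show ?case
  proof cases
    case 1
    note fr = fr typing_subst_fresh[OF ty_rec.hyps(8) 1(2)]
    show ?thesis
      unfolding ctx_del_add subst.simps fr
      by (rule ht_rec[OF side ty_rec.IH(1)[OF 1(1), unfolded ctx_del_add] ty[unfolded ctx_del_add] _ le ty_rec.hyps(11)]; fold ctx_del_add)
        (use ty_rec.hyps(8) 1(2) in \<open>simp add: ctx_del_fresh\<close>)
  next
    case 2
    note fr = fr typing_subst_fresh[OF ty_rec.hyps(5) 2(1)]
    show ?thesis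
      unfolding ctx_del_add subst.simps fr
      by (rule ht_rec_base[OF side _ ty[unfolded ctx_del_add] ty_rec.IH(4)[OF 2(2), unfolded ctx_del_add] le ty_rec.hyps(11)]; fold ctx_del_add)
        (use ty_rec.hyps(5) 2(1) in \<open>simp add: ctx_del_fresh\<close>)
  qed
qed (auto intro: htyping.intros typing.intros)

section \<open>Inversion for closed terms with a hole\<close>

definition is_const :: "('i \<Rightarrow> tm) \<Rightarrow> ty \<Rightarrow> bool" where
  "is_const e B \<longleftrightarrow> (\<exists>t. e = (\<lambda>_. t) \<and> \<turnstile> t \<Ztypecolon> B)"

lemma is_constI: "\<turnstile> t \<Ztypecolon> B \<Longrightarrow> is_const (\<lambda>_. t) B"
  by (auto simp: is_const_def)

lemma is_const_sub: "is_const e B \<Longrightarrow> B <: C \<Longrightarrow> is_const e C"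
  using ty_sub by (auto simp: is_const_def)

text \<open>These inversions inspect the shape at a single index \<open>i0\<close>, because the
  later induction follows the evaluation of one member. The family is then free of the hole, or the
  hole itself, whose shape elsewhere is unknown, or of the same shape everywhere; atoms leave only
  the first two cases.\<close>

lemma ht_atom_inv:
  "htyping h A \<Gamma> e B \<Longrightarrow> \<Gamma> = Map.empty \<Longrightarrow> e i0 = Const m \<or> e i0 = Rand \<Longrightarrow>
    is_const e B \<or> e = h \<and> A <: B"
  by (induction rule: htyping.induct) (auto intro: is_constI is_const_sub sub_refl sub_trans)

lemma ht_Lam_inv:
  "htyping h A \<Gamma> e B \<Longrightarrow> \<Gamma> = Map.empty \<Longrightarrow> e i0 = Lam x a C t \<Longrightarrow>
    is_const e B \<or> e = h \<and> A <: B \<or>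
    (\<exists>g B'. e = (\<lambda>i. Lam x a C (g i)) \<and> htyping h A [x \<mapsto> (a, C)] g B' \<and> Arr a C B' <: B)"
proof (induction rule: htyping.induct)
  case (ht_sub \<Gamma> e B C)
  then show ?case by (meson is_const_sub sub_trans)
next
  case (ht_lam \<Gamma> y b D e B)
  then have "y = x" "b = a" "D = C" "\<Gamma> = Map.empty" by auto
  then show ?case using ht_lam.hyps sub_refl by blast
qed (auto intro: is_constI sub_refl)

lemma ht_S0_inv:
  "htyping h A \<Gamma> e B \<Longrightarrow> \<Gamma> = Map.empty \<Longrightarrow> e i0 = S0 t \<Longrightarrow>
    is_const e B \<or> e = h \<and> A <: B \<or>
    (\<exists>g. e = (\<lambda>i. S0 (g i)) \<and> g i0 = t \<and> htyping h A Map.empty g Str \<and> B = Str)"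
proof (induction rule: htyping.induct)
  case (ht_sub \<Gamma> e B C)
  then show ?case using subty_Str_left by (meson is_const_sub sub_trans)
qed (auto intro: is_constI sub_refl)

lemma ht_S1_inv:
  "htyping h A \<Gamma> e B \<Longrightarrow> \<Gamma> = Map.empty \<Longrightarrow> e i0 = S1 t \<Longrightarrow>
    is_const e B \<or> e = h \<and> A <: B \<or>
    (\<exists>g. e = (\<lambda>i. S1 (g i)) \<and> g i0 = t \<and> htyping h A Map.empty g Str \<and> B = Str)"
proof (induction rule: htyping.induct)
  case (ht_sub \<Gamma> e B C)
  then show ?case using subty_Str_left by (meson is_const_sub sub_trans)
qed (auto intro: is_constI sub_refl)

lemma ht_Tail_inv:
  "htyping h A \<Gamma> e B \<Longrightarrow> \<Gamma> = Map.empty \<Longrightarrow> e i0 = Tail t \<Longrightarrow>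
    is_const e B \<or> e = h \<and> A <: B \<or>
    (\<exists>g. e = (\<lambda>i. Tail (g i)) \<and> g i0 = t \<and> htyping h A Map.empty g Str \<and> B = Str)"
proof (induction rule: htyping.induct)
  case (ht_sub \<Gamma> e B C)
  then show ?case using subty_Str_left by (meson is_const_sub sub_trans)
qed (auto intro: is_constI sub_refl)

lemma sub_arr_right: "B <: C \<Longrightarrow> Arr a A B <: Arr a A C"
  by (simp add: sub_arr sub_refl)

lemma ht_App_inv:
  "htyping h A \<Gamma> e B \<Longrightarrow> \<Gamma> = Map.empty \<Longrightarrow> e i0 = App t s \<Longrightarrow>
    is_const e B \<or> e = h \<and> A <: B \<or>
    (\<exists>g a C. e = (\<lambda>i. App (g i) s) \<and> g i0 = t \<and> htyping h A Map.empty g (Arr a C B) \<and> \<turnstile> s \<Ztypecolon> C) \<or>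
    (\<exists>g a C. e = (\<lambda>i. App t (g i)) \<and> g i0 = s \<and> \<turnstile> t \<Ztypecolon> Arr a C B \<and> htyping h A Map.empty g C)"
proof (induction rule: htyping.induct)
  case (ht_sub \<Gamma> e B C)
  note sub = ht_sub.hyps(2)
  from ht_sub.IH[OF ht_sub.prems] show ?case
  proof (elim disjE exE conjE)
    assume "is_const e B"
    then show ?thesis using is_const_sub[OF _ sub] by blast
  next
    assume "e = h" "A <: B"
    then show ?thesis using sub_trans[OF _ sub] by blast
  next
    fix g a D assume "e = (\<lambda>i. App (g i) s)" "g i0 = t" "htyping h A Map.empty g (Arr a D B)" "\<turnstile> s \<Ztypecolon> D"
    then show ?thesis using htyping.ht_sub[OF _ sub_arr_right[OF sub]] by blast
  next
    fix g a D assume "e = (\<lambda>i. App t (g i))" "g i0 = s" "\<turnstile> t \<Ztypecolon> Arr a D B" "htyping h A Map.empty g D"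
    then show ?thesis using ty_sub[OF _ sub_arr_right[OF sub]] by blast
  qed
next
  case (ht_appL \<Gamma> \<Delta>1 \<Delta>2 e a C B s')
  then show ?case by auto
next
  case (ht_appR \<Gamma> \<Delta>1 \<Delta>2 t' a C B e)
  then show ?case by auto
qed (auto intro: is_constI sub_refl)

lemma ht_Case_inv:
  "htyping h A \<Gamma> e B \<Longrightarrow> \<Gamma> = Map.empty \<Longrightarrow> e i0 = Case D t t0 t1 te \<Longrightarrow>
    is_const e B \<or> e = h \<and> A <: B \<or>
    (\<exists>g. e = (\<lambda>i. Case D (g i) t0 t1 te) \<and> g i0 = t \<and> htyping h A Map.empty g Str \<and>
      \<turnstile> t0 \<Ztypecolon> D \<and> \<turnstile> t1 \<Ztypecolon> D \<and> \<turnstile> te \<Ztypecolon> D \<and> D <: B) \<or>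
    (\<exists>e0 e1 ee. e = (\<lambda>i. Case D t (e0 i) (e1 i) (ee i)) \<and> e0 i0 = t0 \<and> e1 i0 = t1 \<and> ee i0 = te \<and>
      \<turnstile> t \<Ztypecolon> Str \<and> htyping h A Map.empty e0 D \<and> htyping h A Map.empty e1 D \<and>
      htyping h A Map.empty ee D \<and> D <: B)"
proof (induction rule: htyping.induct)
  case (ht_sub \<Gamma> e B C)
  note IH = ht_sub.IH[OF ht_sub.prems]
  note sub = is_const_sub[OF _ ht_sub.hyps(2)] sub_trans[OF _ ht_sub.hyps(2)]
  from IH show ?case by (elim disjE exE conjE) (use sub in blast)+
next
  case (ht_case \<Gamma> \<Delta>1 \<Delta>2 \<Delta>3 \<Delta>4 e t0' B t1' te')
  then show ?case using sub_refl by auto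
next
  case (ht_branch \<Gamma> \<Delta>1 \<Delta>2 \<Delta>3 \<Delta>4 t' e0 B e1 ee)
  then show ?case using sub_refl by auto
qed (auto intro: is_constI sub_refl)

lemma ht_Rec_inv:
  "htyping h A \<Gamma> e B \<Longrightarrow> \<Gamma> = Map.empty \<Longrightarrow> e i0 = Rec D t t0 t1 te \<Longrightarrow>
    is_const e B \<or> e = h \<and> A <: B \<or>
    \<turnstile> t0 \<Ztypecolon> Arr Box Str (Arr BlackBox D D) \<and> \<turnstile> t1 \<Ztypecolon> Arr Box Str (Arr BlackBox D D) \<and> box_free D \<and> D <: B \<and>
    ((\<exists>g. e = (\<lambda>i. Rec D (g i) t0 t1 te) \<and> g i0 = t \<and> htyping h A Map.empty g Str \<and> \<turnstile> te \<Ztypecolon> D) \<or>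
     (\<exists>g. e = (\<lambda>i. Rec D t t0 t1 (g i)) \<and> g i0 = te \<and> \<turnstile> t \<Ztypecolon> Str \<and> htyping h A Map.empty g D))"
proof (induction rule: htyping.induct)
  case (ht_sub \<Gamma> e B C)
  note IH = ht_sub.IH[OF ht_sub.prems]
  note sub = is_const_sub[OF _ ht_sub.hyps(2)] sub_trans[OF _ ht_sub.hyps(2)]
  from IH show ?case by (elim disjE exE conjE) (use sub in blast)+
next
  case (ht_rec \<Gamma>1 \<Gamma>2 \<Gamma>3 \<Delta>1 \<Delta>2 e t0' B t1' te')
  then show ?case using sub_refl by auto
next
  case (ht_rec_base \<Gamma>1 \<Gamma>2 \<Gamma>3 \<Delta>1 \<Delta>2 t' t0' B t1' ee)
  then show ?case using sub_refl by auto
qed (auto intro: is_constI sub_refl)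

section \<open>Evaluating a term with a hole\<close>

text \<open>\<open>val\<close> tells whether the hole is filled with values, in which case evaluation moves it around
  until it is applied, or with arbitrary terms, in which case evaluation stops when it reaches the
  hole.\<close>

locale hole =
  fixes h :: "'i \<Rightarrow> tm" and A :: ty and val :: bool and Obs :: "('i \<Rightarrow> real) \<Rightarrow> bool"
  assumes hole_typed: "\<turnstile> h i \<Ztypecolon> A"
    and Obs_const: "Obs (\<lambda>_. c)"
    and Obs_add: "Obs F \<Longrightarrow> Obs G \<Longrightarrow> Obs (\<lambda>i. F i + G i)"
    and Obs_scale: "Obs F \<Longrightarrow> Obs (\<lambda>i. c * F i)"
    and hole_eval: "\<not> val \<Longrightarrow> kont x r A \<Longrightarrow> Obs (\<lambda>i. prob_kont x r (h i))"
    and hole_value: "val \<Longrightarrow> is_value (h i)"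
    and hole_fun: "val \<Longrightarrow> A \<noteq> Str"
    and hole_app: "val \<Longrightarrow> A = Arr a C D \<Longrightarrow> \<turnstile> v \<Ztypecolon> C \<Longrightarrow> is_value v \<Longrightarrow> kont x r D \<Longrightarrow>
      Obs (\<lambda>i. prob_kont x r (App (h i) v))"
begin

lemma Obs_sum: "(\<And>k. k \<in> K \<Longrightarrow> Obs (F k)) \<Longrightarrow> Obs (\<lambda>i. \<Sum>k\<in>K. c k * F k i)"
proof (induction K rule: infinite_finite_induct)
  case (insert k K)
  then have "Obs (\<lambda>i. c k * F k i + (\<Sum>k\<in>K. c k * F k i))"
    by (intro Obs_add Obs_scale) auto
  with insert.hyps show ?case by simp
\<comment> \<open>For infinite \<open>K\<close> the sum has the default value 0, a constant.\<close>
qed (auto intro: Obs_const)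

lemma Obs_is_const: "is_const e B \<Longrightarrow> Obs (\<lambda>i. prob_kont x r (e i))"
  by (auto simp: is_const_def intro: Obs_const)

abbreviation ht :: "('i \<Rightarrow> tm) \<Rightarrow> ty \<Rightarrow> bool" where
  "ht \<equiv> htyping h A Map.empty"

text \<open>The typing derivation of the body is part of the definition: if all \<open>h i\<close> happen to be
  abstractions, the shape of \<open>f\<close> alone does not show whether the hole is below the abstraction.\<close>

definition holey_value :: "('i \<Rightarrow> tm) \<Rightarrow> ty \<Rightarrow> bool" where
  "holey_value f B \<longleftrightarrow> val \<and> f = h \<and> A <: B \<or>
    (\<exists>x a C g B'. f = (\<lambda>i. Lam x a C (g i)) \<and> htyping h A [x \<mapsto> (a, C)] g B' \<and> Arr a C B' <: B)"

lemma ht_typed: "ht e B \<Longrightarrow> \<turnstile> e i \<Ztypecolon> B"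
  using htyping_typing[OF hole_typed] .

lemma holey_value_ht: "holey_value f B \<Longrightarrow> ht f B"
  unfolding holey_value_def by (auto intro: ht_sub ht_hole ht_lam)

lemma holey_value_value: "holey_value f B \<Longrightarrow> is_value (f i)"
  unfolding holey_value_def using hole_value by auto

lemma holey_value_Arr: "holey_value f B \<Longrightarrow> \<exists>a C D. B = Arr a C D"
  unfolding holey_value_def using hole_fun subty_Str_right[of A B] subty_Str_right
  by (metis ty.distinct(1) ty.exhaust)

lemma holey_value_not_Str: "\<not> holey_value f Str"
  using holey_value_Arr by blast

text \<open>Evaluation has reached the hole. A filling by values is itself a holey value and goes to
  the last assumption; otherwise the continuation is handed to \<open>hole_eval\<close>, after a
  coercion from \<open>B\<close> to the subtype \<open>A\<close>.\<close>

lemma Obs_hole: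
  assumes "A <: B" "kont x r B" "\<And>f. holey_value f B \<Longrightarrow> f i0 \<in> results (h i0) \<Longrightarrow> Obs (\<lambda>i. prob_kont x r (f i))"
  shows "Obs (\<lambda>i. prob_kont x r (h i))"
proof (cases val)
  case True
  have "holey_value h B" using True assms(1) unfolding holey_value_def by blast
  moreover have "h i0 \<in> results (h i0)" by (simp add: eval_value hole_value[OF True])
  ultimately show ?thesis by (rule assms(3))
next
  case False
  have "kont x (kcomp x r B (\<lambda>z. z)) A"
    using assms(1,2) ty_sub[OF ty_hyp] by (intro kont_comp) auto
  from hole_eval[OF False this] show ?thesis
    by (simp add: prob_kont_comp_id typing_halts[OF hole_typed])
qed

text \<open>Induction hypotheses for a subterm hold for every continuation, so the frame around the
  subterm is moved into the continuation; \<open>comp_frameI\<close> moves it back once a holey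
  value has been found.\<close>

lemma Obs_frame:
  assumes "frame x E" "\<And>i. halts (g i)" "Obs (\<lambda>i. prob_kont x (kcomp x r B E) (g i))"
  shows "Obs (\<lambda>i. prob_kont x r (E (g i)))"
  using assms prob_kont_comp[OF assms(1,2)] by simp

lemma comp_frameI:
  assumes "holey_value f B'" "Obs (\<lambda>i. prob_kont x r (E (f i)))" "frame x E"
  shows "Obs (\<lambda>i. prob_kont x (kcomp x r B E) (f i))"
  using assms holey_value_value[OF assms(1)] by (simp add: prob_kont_comp halts_is_value)

lemma ht_App_closedR: "\<turnstile> t \<Ztypecolon> Arr a C B \<Longrightarrow> ht e C \<Longrightarrow> ht (\<lambda>i. App t (e i)) B"
  using ht_appR[of Map.empty Map.empty Map.empty t a C B h A e] by simp

lemma ht_Rec_closed: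
  "\<lbrakk>\<turnstile> t \<Ztypecolon> Str; \<turnstile> t0 \<Ztypecolon> Arr Box Str (Arr BlackBox B B); \<turnstile> t1 \<Ztypecolon> Arr Box Str (Arr BlackBox B B);
    ht e B; box_free B\<rbrakk> \<Longrightarrow> ht (\<lambda>i. Rec B t t0 t1 (e i)) B"
  using ht_rec_base[of Map.empty Map.empty Map.empty Map.empty Map.empty t t0 B t1 h A e] by simp

lemma ht_halts: "ht e B \<Longrightarrow> halts (e i)"
  using ht_typed typing_halts by blast

text \<open>Holey values have function type, so a holey term of type \<open>Str\<close> evaluates to a result that no
  longer depends on the hole.\<close>

lemma Obs_str_frame:
  assumes IH: "\<And>B x r. ht g B \<Longrightarrow> kont x r B \<Longrightarrow>
      (\<And>f. holey_value f B \<Longrightarrow> f i0 \<in> results t \<Longrightarrow> Obs (\<lambda>i. prob_kont x r (f i))) \<Longrightarrow> Obs (\<lambda>i. prob_kont x r (g i))"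
    and "ht g Str" "kont x r B" "frame x E" "[x \<mapsto> (Box, Str)] \<turnstile> E (Var x) \<Ztypecolon> B"
  shows "Obs (\<lambda>i. prob_kont x r (E (g i)))"
proof (rule Obs_frame[OF assms(4) ht_halts[OF assms(2)]])
  show "Obs (\<lambda>i. prob_kont x (kcomp x r B E) (g i))"
    using assms(2) kont_comp[OF assms(3), of Str E, OF assms(5)]
    by (rule IH) (simp add: holey_value_not_Str)
qed

text \<open>Applying the hole itself is the observation \<open>hole_app\<close>, up to a coercion of
  the result type; applying an abstraction whose body may contain the hole is a beta step, which
  leaves a holey term to be evaluated further.\<close>

lemma Obs_beta_left:
  assumes "holey_value f (Arr a C B)" "\<turnstile> v \<Ztypecolon> C" "is_value v" "kont x r B"
    and "\<And>y b C' e. f i0 = Lam y b C' (e i0) \<Longrightarrow> ht (\<lambda>i. subst y v (e i)) B \<Longrightarrow>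
      Obs (\<lambda>i. prob_kont x r (subst y v (e i)))"
  shows "Obs (\<lambda>i. prob_kont x r (App (f i) v))"
  using assms(1) unfolding holey_value_def
proof (elim disjE exE conjE)
  assume *: val "f = h" "A <: Arr a C B"
  obtain a' C' D where A: "A = Arr a' C' D" "C <: C'" "D <: B"
    using subty_Arr_right[OF *(3) refl] by blast
  have v: "\<turnstile> v \<Ztypecolon> C'" using assms(2) A ty_sub by blast
  have "kont x (kcomp x r B (\<lambda>z. z)) D"
    using A assms(4) ty_sub[OF ty_hyp] by (intro kont_comp) auto
  from hole_app[OF *(1) A(1) v assms(3) this]
  have "Obs (\<lambda>i. prob_kont x (kcomp x r B (\<lambda>z. z)) (App (h i) v))" .
  moreover have "halts (App (h i) v)" for i
    by (rule typing_halts[OF closed_AppI[OF hole_typed[unfolded A(1)] v]])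
  ultimately show ?thesis
    by (simp add: *(2) prob_kont_comp_id)
next
  fix y b C' g B'
  assume *: "f = (\<lambda>i. Lam y b C' (g i))" "htyping h A [y \<mapsto> (b, C')] g B'" "Arr b C' B' <: Arr a C B"
  then have sub: "C <: C'" "B' <: B" by (auto simp: subty_Arr_Arr)
  have "ht (\<lambda>i. subst y v (g i)) B'"
    using htyping_subst[OF hole_typed *(2), of y v] assms(2) sub(1) ty_sub by (auto split: if_splits)
  then have "ht (\<lambda>i. subst y v (g i)) B"
    using sub(2) by (rule ht_sub)
  from assms(5)[OF _ this] show ?thesis
    by (simp add: *(1) prob_kont_beta assms(3))
qed

text \<open>A holey value has an arrow type, hence so does the parameter, whose type is a supertype.
  Thus \<open>htyping_subst_hole\<close> applies and the hole is not copied.\<close>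

lemma ht_beta_right:
  assumes "holey_value f C" "\<turnstile> Lam y b C' r \<Ztypecolon> Arr a C B"
  shows "ht (\<lambda>i. subst y (f i) r) B"
proof -
  from closed_LamD[OF assms(2)] have r: "[y \<mapsto> (b, C')] \<turnstile> r \<Ztypecolon> B" "C <: C'" by auto
  obtain c D E where C: "C = Arr c D E" using holey_value_Arr[OF assms(1)] by blast
  obtain c' D' E' where C': "C' = Arr c' D' E'" using subty_Arr_left[OF r(2) C] by blast
  have "ht f C'" using holey_value_ht[OF assms(1)] r(2) by (rule ht_sub)
  then show ?thesis
    using htyping_subst_hole[OF r(1), of y b c' D' E' h A f] unfolding C' by simp
qed

text \<open>Induction along the evaluation of \<open>e i0\<close>, with a conclusion about the whole
  family. Family and continuation are generalised, since frames move from the one into the other.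
  The last premise takes over whenever evaluation ends in a holey value;
  \<open>f i0 \<in> results t\<close> ties such values to the results for which
  \<open>halts_App\<close> provides an induction hypothesis.\<close>

lemma Obs_main:
  "halts t \<Longrightarrow> e i0 = t \<Longrightarrow> ht e B \<Longrightarrow> kont x r B \<Longrightarrow>
    (\<And>f. holey_value f B \<Longrightarrow> f i0 \<in> results t \<Longrightarrow> Obs (\<lambda>i. prob_kont x r (f i))) \<Longrightarrow> Obs (\<lambda>i. prob_kont x r (e i))"
proof (induction arbitrary: e B x r rule: halts.induct)
  case (halts_Const m)
  note hole = Obs_hole[of B x r i0, OF _ halts_Const.prems(3)]
  show ?case
    using ht_atom_inv[OF halts_Const.prems(2) refl, of i0 m] Obs_is_const hole halts_Const.prems(1,4) by auto
next
  case halts_Rand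
  note hole = Obs_hole[of B x r i0, OF _ halts_Rand.prems(3)]
  show ?case
    using ht_atom_inv[OF halts_Rand.prems(2) refl, of i0] Obs_is_const hole halts_Rand.prems(1,4) by auto
next
  case (halts_Lam y a C t)
  note hole = Obs_hole[of B x r i0, OF _ halts_Lam.prems(3)]
  have "holey_value e B" if "e = (\<lambda>i. Lam y a C (g i))" "htyping h A [y \<mapsto> (a, C)] g B'" "Arr a C B' <: B" for g B'
    using that unfolding holey_value_def by blast
  then show ?case
    using ht_Lam_inv[OF halts_Lam.prems(2) refl halts_Lam.prems(1)] Obs_is_const[of e B] hole halts_Lam.prems(1,4)
    by (elim disjE exE conjE) (auto simp: halts_Lam.prems(1))
next
  case (halts_S0 t)
  note hole = Obs_hole[of B x r i0, OF _ halts_S0.prems(3)]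
  from ht_S0_inv[OF halts_S0.prems(2) refl halts_S0.prems(1)] show ?case
  proof (elim disjE exE conjE)
    fix g assume g: "e = (\<lambda>i. S0 (g i))" "g i0 = t" "ht g Str" "B = Str"
    show ?thesis
      unfolding g(1)
      by (rule Obs_str_frame[OF halts_S0.IH[of g, OF g(2)] g(3) halts_S0.prems(3) frame_S0])
        (auto simp: g(4) intro: ty_S0 ty_hyp)
  qed (use Obs_is_const hole halts_S0.prems(1,4) in auto)
next
  case (halts_S1 t)
  note hole = Obs_hole[of B x r i0, OF _ halts_S1.prems(3)]
  from ht_S1_inv[OF halts_S1.prems(2) refl halts_S1.prems(1)] show ?case
  proof (elim disjE exE conjE)
    fix g assume g: "e = (\<lambda>i. S1 (g i))" "g i0 = t" "ht g Str" "B = Str"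
    show ?thesis
      unfolding g(1)
      by (rule Obs_str_frame[OF halts_S1.IH[of g, OF g(2)] g(3) halts_S1.prems(3) frame_S1])
        (auto simp: g(4) intro: ty_S1 ty_hyp)
  qed (use Obs_is_const hole halts_S1.prems(1,4) in auto)
next
  case (halts_Tail t)
  note hole = Obs_hole[of B x r i0, OF _ halts_Tail.prems(3)]
  from ht_Tail_inv[OF halts_Tail.prems(2) refl halts_Tail.prems(1)] show ?case
  proof (elim disjE exE conjE)
    fix g assume g: "e = (\<lambda>i. Tail (g i))" "g i0 = t" "ht g Str" "B = Str"
    show ?thesis
      unfolding g(1)
      by (rule Obs_str_frame[OF halts_Tail.IH[of g, OF g(2)] g(3) halts_Tail.prems(3) frame_Tail])
        (auto simp: g(4) intro: ty_tail ty_hyp)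
  qed (use Obs_is_const hole halts_Tail.prems(1,4) in auto)
next
  case (halts_App t s)
  note hole = Obs_hole[of B x r i0, OF _ halts_App.prems(3)]
  have beta_results: "results (subst y v u) \<subseteq> results (App t s)"
    if "Lam y b C' u \<in> results t" "v \<in> results s" for y b C' u v
    using that unfolding results_App by force
  from ht_App_inv[OF halts_App.prems(2) refl halts_App.prems(1)] show ?case
  proof (elim disjE exE conjE)
    fix g a C
    assume g: "e = (\<lambda>i. App (g i) s)" "g i0 = t" "ht g (Arr a C B)" "\<turnstile> s \<Ztypecolon> C"
    let ?E = "\<lambda>z. App z s"
    have fr: "frame x ?E" by (rule frame_AppL[OF typing_closed[OF g(4)]])
    show ?thesis
      unfolding g(1)
    proof (rule Obs_frame[OF fr ht_halts[OF g(3)]])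
      show "Obs (\<lambda>i. prob_kont x (kcomp x r B ?E) (g i))"
      proof (rule halts_App.IH(1)[of g, OF g(2,3) kont_comp[of x r B _ ?E, OF halts_App.prems(3) ty_App_hypL[OF g(4)]]])
        fix f assume f: "holey_value f (Arr a C B)" "f i0 \<in> results t"
        \<comment> \<open>The argument is free of the hole, so its values \<open>v\<close> enter as
          weights common to all members.\<close>
        have "Obs (\<lambda>i. prob_kont x r (App (f i) v))" if v: "v \<in> results s" for v
        proof (rule Obs_beta_left[OF f(1) preservation[OF halts_App.hyps(2) g(4) v]
              halts_value[OF halts_App.hyps(2) v] halts_App.prems(3)])
          fix y b C' e' assume e': "f i0 = Lam y b C' (e' i0)" "ht (\<lambda>i. subst y v (e' i)) B"
          have l: "Lam y b C' (e' i0) \<in> results t" using f(2) e'(1) by simp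
          show "Obs (\<lambda>i. prob_kont x r (subst y v (e' i)))"
            by (rule halts_App.IH(3)[where e = "\<lambda>i. subst y v (e' i)", OF l v refl e'(2) halts_App.prems(3)])
              (use halts_App.prems(4) beta_results[OF l v] in blast)
        qed
        then have "Obs (\<lambda>i. \<Sum>v\<in>results s. spmf (eval s) v * prob_kont x r (App (f i) v))"
          by (rule Obs_sum)
        then show "Obs (\<lambda>i. prob_kont x (kcomp x r B ?E) (f i))"
          using prob_kont_AppR[OF holey_value_value[OF f(1)] halts_App.hyps(2)] by (intro comp_frameI[OF f(1) _ fr]) simp
      qed
    qed
  next
    fix g a C
    assume g: "e = (\<lambda>i. App t (g i))" "g i0 = s" "\<turnstile> t \<Ztypecolon> Arr a C B" "ht g C"
    \<comment> \<open>The function is free of the hole and evaluated first. Its values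
      \<open>w\<close> provide the frames \<open>App w\<close> and concrete bodies for the beta
      step.\<close>
    have "Obs (\<lambda>i. prob_kont x r (App w (g i)))" if w: "w \<in> results t" for w
    proof -
      have ty: "\<turnstile> w \<Ztypecolon> Arr a C B" by (rule preservation[OF halts_App.hyps(1) g(3) w])
      have isv: "is_value w" by (rule halts_value[OF halts_App.hyps(1) w])
      obtain y b C' u where W: "w = Lam y b C' u" using closed_value_Arr[OF ty isv] by blast
      have fr: "frame x (App w)" by (rule frame_AppR[OF typing_closed[OF ty] isv])
      show ?thesis
      proof (rule Obs_frame[OF fr ht_halts[OF g(4)]])
        show "Obs (\<lambda>i. prob_kont x (kcomp x r B (App w)) (g i))"
        proof (rule halts_App.IH(2)[of g, OF g(2,4) kont_comp[of x r B _ "App w", OF halts_App.prems(3) ty_App_hypR[OF ty]]])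
          fix f assume f: "holey_value f C" "f i0 \<in> results s"
          note l = w[unfolded W]
          have "Obs (\<lambda>i. prob_kont x r (subst y (f i) u))"
            by (rule halts_App.IH(3)[where e = "\<lambda>i. subst y (f i) u", OF l f(2) refl ht_beta_right[OF f(1) ty[unfolded W]] halts_App.prems(3)])
              (use halts_App.prems(4) beta_results[OF l f(2)] in blast)
          then show "Obs (\<lambda>i. prob_kont x (kcomp x r B (App w)) (f i))"
            by (intro comp_frameI[OF f(1) _ fr]) (simp add: W prob_kont_beta holey_value_value[OF f(1)])
        qed
      qed
    qed
    then have "Obs (\<lambda>i. \<Sum>w\<in>results t. spmf (eval t) w * prob_kont x r (App w (g i)))"
      by (rule Obs_sum)
    then show ?thesis
      unfolding g(1) using prob_kont_App_left[OF halts_App.hyps(1)] by simp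
  qed (use Obs_is_const hole halts_App.prems(1,4) in auto)
next
  case (halts_Case t te t1 t0 D)
  note hole = Obs_hole[of B x r i0, OF _ halts_Case.prems(3)]
  from ht_Case_inv[OF halts_Case.prems(2) refl halts_Case.prems(1)] show ?case
  proof (elim disjE exE conjE)
    fix g assume g: "e = (\<lambda>i. Case D (g i) t0 t1 te)" "g i0 = t" "ht g Str"
      "\<turnstile> t0 \<Ztypecolon> D" "\<turnstile> t1 \<Ztypecolon> D" "\<turnstile> te \<Ztypecolon> D" "D <: B"
    show ?thesis
      unfolding g(1)
      by (rule Obs_str_frame[OF halts_Case.IH(1)[of g, OF g(2)] g(3) halts_Case.prems(3)
            frame_Case[OF g(4-6)[THEN typing_closed]] ty_sub[OF ty_Case_hyp[OF g(4-6)] g(7)]])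
  next
    fix e0 e1 ee assume g: "e = (\<lambda>i. Case D t (e0 i) (e1 i) (ee i))" "e0 i0 = t0" "e1 i0 = t1" "ee i0 = te"
      "\<turnstile> t \<Ztypecolon> Str" "ht e0 D" "ht e1 D" "ht ee D" "D <: B"
    have "Obs (\<lambda>i. prob_kont x r (case m of [] \<Rightarrow> ee i | b # n \<Rightarrow> if b then e1 i else e0 i))"
      if m: "Const m \<in> results t" for m
    proof (cases m)
      case Nil
      have "results te \<subseteq> results (Case D t t0 t1 te)"
        using m Nil unfolding results_str[OF halts_Case.hyps(2)] by force
      then have "Obs (\<lambda>i. prob_kont x r (ee i))"
        using m Nil halts_Case.prems(4)
        by (intro halts_Case.IH(2)[of ee, OF _ g(4) ht_sub[OF g(8,9)] halts_Case.prems(3)]) auto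
      with Nil show ?thesis by simp
    next
      case (Cons b n)
      have "results (if b then t1 else t0) \<subseteq> results (Case D t t0 t1 te)"
        using m Cons unfolding results_str[OF halts_Case.hyps(2)] by force
      moreover have "ht (\<lambda>i. if b then e1 i else e0 i) B"
        using g(6,7,9) by (cases b) (auto intro: ht_sub)
      ultimately have "Obs (\<lambda>i. prob_kont x r (if b then e1 i else e0 i))"
        using m Cons g(2,3) halts_Case.prems(4)
        by (intro halts_Case.IH(3)[of b n "\<lambda>i. if b then e1 i else e0 i", OF _ _ _ halts_Case.prems(3)]) auto
      with Cons show ?thesis by simp
    qed
    then have "Obs (\<lambda>i. \<Sum>m\<in>{m. Const m \<in> results t}. spmf (eval t) (Const m) *
        prob_kont x r (case m of [] \<Rightarrow> ee i | b # n \<Rightarrow> if b then e1 i else e0 i))"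
      by (intro Obs_sum) simp
    then show ?thesis
      unfolding g(1) using prob_kont_Case[OF halts_Case.hyps(1,2)] by simp
  qed (use Obs_is_const hole halts_Case.prems(1,4) in auto)
next
  case (halts_Rec t te t1 t0 D)
  note hole = Obs_hole[of B x r i0, OF _ halts_Rec.prems(3)]
  from ht_Rec_inv[OF halts_Rec.prems(2) refl halts_Rec.prems(1)] show ?case
  proof (elim disjE exE conjE)
    fix g assume g: "e = (\<lambda>i. Rec D (g i) t0 t1 te)" "g i0 = t" "ht g Str" "\<turnstile> te \<Ztypecolon> D"
      "\<turnstile> t0 \<Ztypecolon> Arr Box Str (Arr BlackBox D D)" "\<turnstile> t1 \<Ztypecolon> Arr Box Str (Arr BlackBox D D)" "box_free D" "D <: B"
    show ?thesis
      unfolding g(1)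
      by (rule Obs_str_frame[OF halts_Rec.IH(1)[of g, OF g(2)] g(3) halts_Rec.prems(3)
            frame_Rec[OF g(5,6,4)[THEN typing_closed]] ty_sub[OF ty_Rec_hyp[OF g(5,6,4,7)] g(8)]])
  next
    fix g assume g: "e = (\<lambda>i. Rec D t t0 t1 (g i))" "g i0 = te" "\<turnstile> t \<Ztypecolon> Str" "ht g D"
      "\<turnstile> t0 \<Ztypecolon> Arr Box Str (Arr BlackBox D D)" "\<turnstile> t1 \<Ztypecolon> Arr Box Str (Arr BlackBox D D)" "box_free D" "D <: B"
    have "Obs (\<lambda>i. prob_kont x r (case m of [] \<Rightarrow> g i | b # n \<Rightarrow>
        App (App (if b then t1 else t0) (Const (b # n))) (Rec D (Const n) t0 t1 (g i))))"
      if m: "Const m \<in> results t" for m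
    proof (cases m)
      case Nil
      have "results te \<subseteq> results (Rec D t t0 t1 te)"
        using m Nil unfolding results_str[OF halts_Rec.hyps(2)] by force
      then have "Obs (\<lambda>i. prob_kont x r (g i))"
        using m Nil halts_Rec.prems(4)
        by (intro halts_Rec.IH(2)[of g, OF _ g(2) ht_sub[OF g(4,8)] halts_Rec.prems(3)]) auto
      with Nil show ?thesis by simp
    next
      case (Cons b n)
      \<comment> \<open>After one unrolling the hole still occurs once: in the base case of the
        recursive call, which is the argument of a term free of the hole.\<close>
      let ?u = "\<lambda>i. App (App (if b then t1 else t0) (Const (b # n))) (Rec D (Const n) t0 t1 (g i))"
      have "results (?u i0) \<subseteq> results (Rec D t t0 t1 te)"
        using m Cons g(2) unfolding results_str[OF halts_Rec.hyps(2)] by (force simp del: eval_simps)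
      moreover have "ht ?u B"
      proof (rule ht_sub[OF ht_App_closedR g(8)])
        show "ht (\<lambda>i. Rec D (Const n) t0 t1 (g i)) D"
          using g by (intro ht_Rec_closed ty_const)
        show "\<turnstile> App (if b then t1 else t0) (Const (b # n)) \<Ztypecolon> Arr BlackBox D D"
          using g by (intro closed_AppI[of _ Box Str] ty_const) auto
      qed
      ultimately have "Obs (\<lambda>i. prob_kont x r (?u i))"
        using m Cons g(2) halts_Rec.prems(4)
        by (intro halts_Rec.IH(3)[of b n ?u, OF _ _ _ halts_Rec.prems(3)]) (auto simp del: eval_simps)
      with Cons show ?thesis by simp
    qed
    then have "Obs (\<lambda>i. \<Sum>m\<in>{m. Const m \<in> results t}. spmf (eval t) (Const m) *
        prob_kont x r (case m of [] \<Rightarrow> g i | b # n \<Rightarrow>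
          App (App (if b then t1 else t0) (Const (b # n))) (Rec D (Const n) t0 t1 (g i))))"
      by (intro Obs_sum) simp
    then show ?thesis
      unfolding g(1) using prob_kont_Rec[OF halts_Rec.hyps(1,2)] by simp
  qed (use Obs_is_const hole halts_Rec.prems(1,4) in auto)
qed

lemma Obs_prob_eps:
  assumes "ht e Str"
  shows "Obs (\<lambda>i. prob_eps (e i))"
proof -
  \<comment> \<open>Any index can serve as the reference. The continuation is the identity, and at
    type \<open>Str\<close> the premise on holey values is void.\<close>
  fix i0
  have "Obs (\<lambda>i. prob_kont 0 (Var 0) (e i))"
    by (rule Obs_main[where e = e and t = "e i0" and B = Str, OF ht_halts[OF assms] refl assms])
      (auto simp: kont_def ty_hyp holey_value_not_Str)
  moreover have "prob_kont 0 (Var 0) (e i) = prob_eps (e i)" for i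
    by (simp add: prob_kont_def prob_eps_def eval_idem[OF ht_halts[OF assms]])
  ultimately show ?thesis by simp
qed

end

section \<open>Observing the hole through traces\<close>

text \<open>Serves twice: as a probe that recovers the typing of a context from its fillings, and as
  a default value that makes families total.\<close>

fun inhabitant :: "ty \<Rightarrow> tm" where
  "inhabitant Str = Const []"
| "inhabitant (Arr a A B) = Lam 0 a A (inhabitant B)"

lemma inhabitant_value: "is_value (inhabitant A)"
  by (cases A) auto

lemma typing_inhabitant: "\<Gamma> \<turnstile> inhabitant A \<Ztypecolon> A"
  by (induction A arbitrary: \<Gamma>) (auto intro: typing.intros)

text \<open>Since the least type of this term is exactly \<open>A\<close>, a context that is well typed when filled with
  it is typed with a hole of type \<open>A\<close>, although \<open>ctx_typed\<close> only speaks about filled contexts.\<close>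

lemma inhabitant_principal: "\<Gamma> \<turnstile> inhabitant A \<Ztypecolon> B \<Longrightarrow> A <: B"
proof (induction A arbitrary: \<Gamma> B)
  case Str
  then show ?case by (auto dest: typing_ConstD intro: sub_refl)
next
  case (Arr a A1 A2)
  then obtain B' where "\<Gamma>(0 \<mapsto> (a, A1)) \<turnstile> inhabitant A2 \<Ztypecolon> B'" "Arr a A1 B' <: B"
    using typing_LamD[of \<Gamma> 0 a A1 "inhabitant A2" B] by auto
  then show ?case using Arr.IH(2) sub_arr_right sub_trans by blast
qed

text \<open>The typing derivation for the probe is replayed. At the hole, principality yields
  \<open>A <: B\<close>, so any filling of type \<open>A\<close> can take its place by subsumption
  and weakening.\<close>

lemma htyping_fill: "\<Gamma> \<turnstile> fill C (inhabitant A) \<Ztypecolon> B \<Longrightarrow> htyping h A \<Gamma> (\<lambda>i. fill C (h i)) B"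
proof (induction C arbitrary: \<Gamma> B)
  case (CTerm t)
  then show ?case by (auto intro: ht_const)
next
  case Hole
  then have "A <: B" using inhabitant_principal by auto
  then show ?case using ht_weak[OF ht_sub[OF ht_hole]] by simp
next
  case (CLam x a E C)
  obtain B' where "\<Gamma>(x \<mapsto> (a, E)) \<turnstile> fill C (inhabitant A) \<Ztypecolon> B'" "Arr a E B' <: B"
    using typing_LamD[OF CLam.prems[unfolded fill.simps]] by blast
  then show ?case unfolding fill.simps using ht_sub[OF ht_lam[OF CLam.IH]] by blast
next
  case (CAppL C t)
  from typing_AppD[OF CAppL.prems[unfolded fill.simps]] show ?case
    unfolding fill.simps
  proof (elim exE conjE)
    fix \<Theta> \<Delta>1 \<Delta>2 a E B'
    assume *: "\<Gamma> = \<Theta> ++ \<Delta>1 ++ \<Delta>2" "str_only \<Theta>" "disjoint_ctxs [\<Theta>, \<Delta>1, \<Delta>2]"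
      "\<Theta> ++ \<Delta>1 \<turnstile> fill C (inhabitant A) \<Ztypecolon> Arr a E B'" "\<Theta> ++ \<Delta>2 \<turnstile> t \<Ztypecolon> E" "ctx_le \<Theta> a" "ctx_le \<Delta>2 a" "B' <: B"
    show "htyping h A \<Gamma> (\<lambda>i. App (fill C (h i)) t) B"
      unfolding *(1) by (rule ht_sub[OF ht_appL[OF *(2,3) CAppL.IH[OF *(4)] *(5-7)] *(8)])
  qed
next
  case (CAppR t C)
  from typing_AppD[OF CAppR.prems[unfolded fill.simps]] show ?case
    unfolding fill.simps
  proof (elim exE conjE)
    fix \<Theta> \<Delta>1 \<Delta>2 a E B'
    assume *: "\<Gamma> = \<Theta> ++ \<Delta>1 ++ \<Delta>2" "str_only \<Theta>" "disjoint_ctxs [\<Theta>, \<Delta>1, \<Delta>2]"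
      "\<Theta> ++ \<Delta>1 \<turnstile> t \<Ztypecolon> Arr a E B'" "\<Theta> ++ \<Delta>2 \<turnstile> fill C (inhabitant A) \<Ztypecolon> E" "ctx_le \<Theta> a" "ctx_le \<Delta>2 a" "B' <: B"
    show "htyping h A \<Gamma> (\<lambda>i. App t (fill C (h i))) B"
      unfolding *(1) by (rule ht_sub[OF ht_appR[OF *(2-4) CAppR.IH[OF *(5)] *(6,7)] *(8)])
  qed
next
  case (CS0 C)
  then show ?case by (auto dest!: typing_S0D intro: ht_S0)
next
  case (CS1 C)
  then show ?case by (auto dest!: typing_S1D intro: ht_S1)
next
  case (CTail C)
  then show ?case by (auto dest!: typing_TailD intro: ht_Tail)
next
  case (CCaseArg D C t0 t1 te)
  from typing_CaseD[OF CCaseArg.prems[unfolded fill.simps]] show ?case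
    unfolding fill.simps
  proof (elim exE conjE)
    fix \<Theta> \<Delta>1 \<Delta>2 \<Delta>3 \<Delta>4
    assume *: "\<Gamma> = \<Theta> ++ \<Delta>1 ++ \<Delta>2 ++ \<Delta>3 ++ \<Delta>4" "str_only \<Theta>" "disjoint_ctxs [\<Theta>, \<Delta>1, \<Delta>2, \<Delta>3, \<Delta>4]"
      "\<Theta> ++ \<Delta>1 \<turnstile> fill C (inhabitant A) \<Ztypecolon> Str" "\<Theta> ++ \<Delta>2 \<turnstile> t0 \<Ztypecolon> D" "\<Theta> ++ \<Delta>3 \<turnstile> t1 \<Ztypecolon> D" "\<Theta> ++ \<Delta>4 \<turnstile> te \<Ztypecolon> D" "D <: B"
    show "htyping h A \<Gamma> (\<lambda>i. Case D (fill C (h i)) t0 t1 te) B"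
      unfolding *(1) by (rule ht_sub[OF ht_case[OF *(2,3) CCaseArg.IH[OF *(4)] *(5-7)] *(8)])
  qed
next
  case (CCaseBranch D t C0 C1 Ce)
  from typing_CaseD[OF CCaseBranch.prems[unfolded fill.simps]] show ?case
    unfolding fill.simps
  proof (elim exE conjE)
    fix \<Theta> \<Delta>1 \<Delta>2 \<Delta>3 \<Delta>4
    assume *: "\<Gamma> = \<Theta> ++ \<Delta>1 ++ \<Delta>2 ++ \<Delta>3 ++ \<Delta>4" "str_only \<Theta>" "disjoint_ctxs [\<Theta>, \<Delta>1, \<Delta>2, \<Delta>3, \<Delta>4]"
      "\<Theta> ++ \<Delta>1 \<turnstile> t \<Ztypecolon> Str" "\<Theta> ++ \<Delta>2 \<turnstile> fill C0 (inhabitant A) \<Ztypecolon> D" "\<Theta> ++ \<Delta>3 \<turnstile> fill C1 (inhabitant A) \<Ztypecolon> D"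
      "\<Theta> ++ \<Delta>4 \<turnstile> fill Ce (inhabitant A) \<Ztypecolon> D" "D <: B"
    show "htyping h A \<Gamma> (\<lambda>i. Case D t (fill C0 (h i)) (fill C1 (h i)) (fill Ce (h i))) B"
      unfolding *(1)
      by (rule ht_sub[OF ht_branch[OF *(2-4) CCaseBranch.IH(1)[OF *(5)] CCaseBranch.IH(2)[OF *(6)]
            CCaseBranch.IH(3)[OF *(7)]] *(8)])
  qed
next
  case (CRec D C t0 t1 te)
  from typing_RecD[OF CRec.prems[unfolded fill.simps]] show ?case
    unfolding fill.simps
  proof (elim exE conjE)
    fix \<Gamma>1 \<Gamma>2 \<Gamma>3 \<Delta>1 \<Delta>2
    assume *: "\<Gamma> = \<Gamma>1 ++ \<Gamma>2 ++ \<Gamma>3 ++ \<Delta>1 ++ \<Delta>2" "str_only \<Gamma>1" "str_only \<Gamma>2" "str_only \<Gamma>3"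
      "disjoint_ctxs [\<Gamma>1, \<Gamma>2, \<Gamma>3, \<Delta>1, \<Delta>2]" "\<Gamma>1 ++ \<Delta>1 \<turnstile> fill C (inhabitant A) \<Ztypecolon> Str"
      "\<Gamma>1 ++ \<Gamma>2 \<turnstile> t0 \<Ztypecolon> Arr Box Str (Arr BlackBox D D)"
      "\<Gamma>1 ++ \<Gamma>3 \<turnstile> t1 \<Ztypecolon> Arr Box Str (Arr BlackBox D D)"
      "\<Gamma>1 ++ \<Gamma>2 ++ \<Gamma>3 ++ \<Delta>2 \<turnstile> te \<Ztypecolon> D" "ctx_le \<Gamma>1 Box" "ctx_le \<Delta>1 Box" "box_free D" "D <: B"
    show "htyping h A \<Gamma> (\<lambda>i. Rec D (fill C (h i)) t0 t1 te) B"
      unfolding *(1) by (rule ht_sub[OF ht_rec[OF *(2-5) CRec.IH[OF *(6)] *(7-12)] *(13)])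
  qed
qed

section \<open>Linearity of trace probabilities\<close>

lemma spmf_sum_le_1: "finite M \<Longrightarrow> inj_on g M \<Longrightarrow> (\<Sum>m\<in>M. spmf D (g m)) \<le> 1"
proof -
  assume M: "finite M" "inj_on g M"
  have "(\<Sum>m\<in>M. spmf D (g m)) = sum (pmf D) ((\<lambda>m. Some (g m)) ` M)"
    using M(2) by (subst sum.reindex) (auto simp: inj_on_def)
  also have "\<dots> = measure (measure_pmf D) ((\<lambda>m. Some (g m)) ` M)"
    using M(1) by (simp add: measure_measure_pmf_finite)
  also have "\<dots> \<le> 1" by simp
  finally show ?thesis .
qed

lemma prob_eps_range: "0 \<le> prob_eps t" "prob_eps t \<le> 1"
  by (simp_all add: prob_eps_def pmf_le_1)

lemma view_summable: "(\<lambda>m. spmf D (Const m) * prob_eps (App d (Const m))) summable_on UNIV"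
proof (rule nonneg_bdd_above_summable_on)
  show "bdd_above (sum (\<lambda>m. spmf D (Const m) * prob_eps (App d (Const m))) ` {F. F \<subseteq> UNIV \<and> finite F})"
  proof (rule bdd_aboveI2[where M = 1])
    fix F :: "bool list set" assume "F \<in> {F. F \<subseteq> UNIV \<and> finite F}"
    then have F: "finite F" by simp
    have "(\<Sum>m\<in>F. spmf D (Const m) * prob_eps (App d (Const m))) \<le> (\<Sum>m\<in>F. spmf D (Const m))"
      by (intro sum_mono mult_left_le) (auto simp: prob_eps_range)
    also have "\<dots> \<le> 1" by (rule spmf_sum_le_1[OF F]) (auto intro: inj_onI)
    finally show "(\<Sum>m\<in>F. spmf D (Const m) * prob_eps (App d (Const m))) \<le> 1" .
  qed
qed (simp add: prob_eps_range)

lemma has_sum_sum_finite: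
  fixes f :: "'a \<Rightarrow> 'b \<Rightarrow> real"
  assumes "finite W" "\<And>w. w \<in> W \<Longrightarrow> (f w has_sum s w) A"
  shows "((\<lambda>m. \<Sum>w\<in>W. f w m) has_sum (\<Sum>w\<in>W. s w)) A"
  using assms by (induction W rule: finite_induct) (auto intro: has_sum_add)

text \<open>A trace acts linearly on subdistributions. \<open>f\<close> is generalised because each
  \<open>Pass\<close> changes it; at \<open>View\<close>, finiteness allows the two sums to be
  exchanged.\<close>

lemma trace_prob_from_bind:
  assumes fin: "finite (set_spmf p)"
  shows "trace_prob_from (bind_spmf p f) T = (\<Sum>w\<in>set_spmf p. spmf p w * trace_prob_from (f w) T)"
proof (induction T arbitrary: f)
  case (View d)
  let ?q = "\<lambda>m. prob_eps (App d (Const m))"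
  have "((\<lambda>m. \<Sum>w\<in>set_spmf p. spmf p w * (spmf (f w) (Const m) * ?q m)) has_sum
      (\<Sum>w\<in>set_spmf p. spmf p w * (\<Sum>\<^sub>\<infinity>m. spmf (f w) (Const m) * ?q m))) UNIV"
    using fin by (intro has_sum_sum_finite has_sum_cmult_right has_sum_infsum view_summable)
  then have "(\<Sum>\<^sub>\<infinity>m. \<Sum>w\<in>set_spmf p. spmf p w * (spmf (f w) (Const m) * ?q m)) =
      (\<Sum>w\<in>set_spmf p. spmf p w * (\<Sum>\<^sub>\<infinity>m. spmf (f w) (Const m) * ?q m))"
    by (rule infsumI)
  then show ?case
    by (simp add: spmf_bind_finite[OF fin] sum_distrib_right mult.assoc)
next
  case (Pass v T)
  have "pass_dist (bind_spmf p f) v = bind_spmf p (\<lambda>w. pass_dist (f w) v)"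
    by (simp add: pass_dist_def)
  then show ?case using Pass by simp
qed

text \<open>Law of total probability, which reduces a term to the values it evaluates to.\<close>

lemma trace_prob_results:
  assumes "halts u"
  shows "trace_prob u T = (\<Sum>w\<in>results u. spmf (eval u) w * trace_prob w T)"
proof -
  have "trace_prob u T = trace_prob_from (bind_spmf (eval u) eval) T"
    by (simp add: trace_prob_def eval_idem[OF assms])
  also have "\<dots> = (\<Sum>w\<in>results u. spmf (eval u) w * trace_prob_from (eval w) T)"
    by (rule trace_prob_from_bind[OF halts_finite[OF assms]])
  finally show ?thesis by (simp add: trace_prob_def)
qed

lemma trace_prob_App: "is_value v \<Longrightarrow> trace_prob (App u v) T = trace_prob u (Pass v T)"
  by (simp add: trace_prob_def pass_dist_def eval_value)

text \<open>Application evaluates the distinguisher first, a trace the observed term. The two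
  evaluations are independent, so they commute.\<close>

lemma prob_eps_App:
  assumes "\<turnstile> t \<Ztypecolon> Str"
  shows "prob_eps (App d t) = trace_prob t (View d)"
proof -
  have h: "halts t" by (rule typing_halts[OF assms])
  have strs: "Ball (results t) is_str"
    using closed_value_Str preservation[OF h assms] halts_value[OF h] by (auto simp: is_str_def)
  let ?M = "{m. Const m \<in> results t}"
  let ?G = "\<lambda>f v. bind_spmf (the_lam f) (\<lambda>(x, r). eval (subst x v r))"
  have "eval (App d t) = bind_spmf (eval t) (\<lambda>v. bind_spmf (eval d) (\<lambda>f. ?G f v))"
    unfolding eval_simps by (rule bind_commute_spmf)
  also have "\<dots> = bind_spmf (eval t) (\<lambda>v. eval (App d v))"
    using h by (rule bind_eval_results) (simp add: eval_value)
  finally have "prob_eps (App d t) = (\<Sum>v\<in>results t. spmf (eval t) v * prob_eps (App d v))"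
    unfolding prob_eps_def by (simp only: spmf_bind_finite[OF halts_finite[OF h]])
  also have "\<dots> = (\<Sum>m\<in>?M. spmf (eval t) (Const m) * prob_eps (App d (Const m)))"
    by (rule sum_strs[OF strs])
  also have "\<dots> = (\<Sum>\<^sub>\<infinity>m\<in>?M. spmf (eval t) (Const m) * prob_eps (App d (Const m)))"
    by (simp add: finite_strs[OF halts_finite[OF h]])
  also have "\<dots> = (\<Sum>\<^sub>\<infinity>m. spmf (eval t) (Const m) * prob_eps (App d (Const m)))"
    by (rule infsum_cong_neutral) (auto simp: in_set_spmf_iff_spmf)
  finally show ?thesis by (simp add: trace_prob_def)
qed

text \<open>Finitely many traces with coefficients that do not depend on \<open>i\<close>: an infinite sum of negligible
  functions need not be negligible.\<close>

definition observable :: "('i \<Rightarrow> tm) \<Rightarrow> ty \<Rightarrow> ('i \<Rightarrow> real) \<Rightarrow> bool" where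
  "observable h A F \<longleftrightarrow> (\<exists>c ps. (\<forall>(p, T)\<in>set ps. compatible T A) \<and>
     (\<forall>i. F i = c + (\<Sum>(p, T)\<leftarrow>ps. p * trace_prob (h i) T)))"

lemma observable_const: "observable h A (\<lambda>_. c)"
  unfolding observable_def by (rule exI[of _ c], rule exI[of _ "[]"]) simp

lemma observable_add:
  assumes "observable h A F" "observable h A G"
  shows "observable h A (\<lambda>i. F i + G i)"
proof -
  obtain c ps where F: "\<forall>(p, T)\<in>set ps. compatible T A" "\<And>i. F i = c + (\<Sum>(p, T)\<leftarrow>ps. p * trace_prob (h i) T)"
    using assms(1) unfolding observable_def by blast
  obtain d qs where G: "\<forall>(p, T)\<in>set qs. compatible T A" "\<And>i. G i = d + (\<Sum>(p, T)\<leftarrow>qs. p * trace_prob (h i) T)"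
    using assms(2) unfolding observable_def by blast
  show ?thesis
    unfolding observable_def
    by (rule exI[of _ "c + d"], rule exI[of _ "ps @ qs"]) (use F G in auto)
qed

lemma observable_scale:
  assumes "observable h A F"
  shows "observable h A (\<lambda>i. k * F i)"
proof -
  obtain c ps where F: "\<forall>(p, T)\<in>set ps. compatible T A" "\<And>i. F i = c + (\<Sum>(p, T)\<leftarrow>ps. p * trace_prob (h i) T)"
    using assms(1) unfolding observable_def by blast
  have "(\<Sum>(p, T)\<leftarrow>map (\<lambda>(p, T). (k * p, T)) ps. p * g T) = k * (\<Sum>(p, T)\<leftarrow>ps. p * g T)" for g :: "trace \<Rightarrow> real"
    by (induction ps) (auto simp: algebra_simps)
  then show ?thesis
    unfolding observable_def
    by (intro exI[of _ "k * c"] exI[of _ "map (\<lambda>(p, T). (k * p, T)) ps"])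
      (use F in \<open>auto simp: algebra_simps\<close>)
qed

text \<open>Prefixing \<open>Pass v\<close> to every trace turns observations of the application
  into observations of the function, with the same coefficients.\<close>

lemma observable_App:
  assumes "observable (\<lambda>i. App (h i) v) C F" "is_value v" "\<turnstile> v \<Ztypecolon> B"
  shows "observable h (Arr a B C) F"
proof -
  obtain c ps where F: "\<forall>(p, T)\<in>set ps. compatible T C"
    "\<And>i. F i = c + (\<Sum>(p, T)\<leftarrow>ps. p * trace_prob (App (h i) v) T)"
    using assms(1) unfolding observable_def by blast
  have "(\<Sum>(p, T)\<leftarrow>map (\<lambda>(p, T). (p, Pass v T)) ps. p * g T) = (\<Sum>(p, T)\<leftarrow>ps. p * g (Pass v T))"
    for g :: "trace \<Rightarrow> real"
    by (induction ps) auto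
  then show ?thesis
    unfolding observable_def
    by (intro exI[of _ c] exI[of _ "map (\<lambda>(p, T). (p, Pass v T)) ps"])
      (use F assms(2,3) in \<open>auto simp: trace_prob_App intro: compatible.intros\<close>)
qed

lemma observable_reindex: "observable h A F \<Longrightarrow> observable (\<lambda>i. h (g i)) A (\<lambda>i. F (g i))"
  unfolding observable_def by blast

lemma prob_eps_subst_sum:
  "halts u \<Longrightarrow> prob_kont x r u = (\<Sum>w\<in>results u. spmf (eval u) w * prob_eps (subst x w r))"
  by (simp add: prob_kont_def prob_eps_def spmf_bind_finite halts_finite)

lemma sum_spmf_lossless:
  assumes "halts u"
  shows "(\<Sum>w\<in>results u. spmf (eval u) w) = 1"
proof -
  have "spmf (bind_spmf (eval u) (\<lambda>_. return_spmf ())) () = (\<Sum>w\<in>results u. spmf (eval u) w * spmf (return_spmf ()) ())"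
    by (rule spmf_bind_finite[OF halts_finite[OF assms]])
  then show ?thesis
    using halts_lossless[OF assms] by (simp add: bind_spmf_const lossless_weight_spmfD)
qed

text \<open>Induction on the type of the hole, whose arrow case runs the analysis of holes with
  values as fillings. That case uses a family indexed by terms, and an induction hypothesis cannot
  change the index type, so the index type is \<open>tm\<close> from the start.\<close>

lemma observable_kont_tm:
  fixes h :: "tm \<Rightarrow> tm"
  shows "kont x r A \<Longrightarrow> (\<And>i. \<turnstile> h i \<Ztypecolon> A) \<Longrightarrow> observable h A (\<lambda>i. prob_kont x r (h i))"
proof (induction A arbitrary: x r h)
  case Str
  let ?d = "Lam x Box Str r"
  have "distinguisher ?d"
    using Str.prems(1) by (auto simp: distinguisher_def kont_def intro: ty_lam)
  moreover have "prob_kont x r (h i) = trace_prob (h i) (View ?d)" for i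
    using prob_eps_App[OF Str.prems(2), of ?d i] by (simp add: prob_kont_def prob_eps_def)
  ultimately show ?case
    unfolding observable_def
    by (intro exI[of _ 0] exI[of _ "[(1, View ?d)]"]) (auto intro: compatible.intros)
next
  case (Arr a B C)
  let ?A = "Arr a B C"
  \<comment> \<open>The locale asks for a typed value at every index, so unsuitable terms are
    replaced by a default.\<close>
  define hv where "hv w = (if \<turnstile> w \<Ztypecolon> ?A \<and> is_value w then w else inhabitant ?A)" for w
  have hv_typed: "\<turnstile> hv w \<Ztypecolon> ?A" and hv_value: "is_value (hv w)" for w
    unfolding hv_def using typing_inhabitant[of Map.empty ?A] inhabitant_value[of ?A] by (auto simp del: inhabitant.simps)
  interpret hole hv ?A True "observable hv ?A"
  proof
    fix b D E v x r
    assume *: "?A = Arr b D E" "\<turnstile> v \<Ztypecolon> D" "is_value v" "kont x r E"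
    \<comment> \<open>Applied to \<open>v\<close>, the hole has the smaller type \<open>C\<close>,
      where the induction hypothesis gives the traces after \<open>Pass v\<close>.\<close>
    have "observable (\<lambda>i. App (hv i) v) C (\<lambda>i. prob_kont x r (App (hv i) v))"
      using *(1,4) closed_AppI[OF hv_typed] *(2) by (intro Arr.IH(2)) auto
    then show "observable hv ?A (\<lambda>i. prob_kont x r (App (hv i) v))"
      by (rule observable_App) (use * in auto)
  qed (use hv_typed hv_value observable_const observable_add observable_scale in auto)
  have "ht (\<lambda>i. subst x (hv i) r) Str"
    using htyping_subst_hole[OF Arr.prems(1)[unfolded kont_def], of x Box a B C hv ?A hv, OF _ ht_hole] by simp
  \<comment> \<open>One constant and one list of traces serve every value \<open>w\<close>. This
    uniformity allows averaging over the values of \<open>h i\<close>.\<close>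
  from Obs_prob_eps[OF this] obtain c ps where ps: "\<forall>(p, T)\<in>set ps. compatible T ?A"
    "\<And>w. prob_eps (subst x (hv w) r) = c + (\<Sum>(p, T)\<leftarrow>ps. p * trace_prob (hv w) T)"
    unfolding observable_def by blast
  have "prob_kont x r (h i) = c + (\<Sum>(p, T)\<leftarrow>ps. p * trace_prob (h i) T)" for i
  proof -
    have ha: "halts (h i)" by (rule typing_halts[OF Arr.prems(2)])
    have val: "hv w = w" if "w \<in> results (h i)" for w
      using preservation[OF ha Arr.prems(2) that] halts_value[OF ha that] by (simp add: hv_def)
    have "prob_kont x r (h i) = (\<Sum>w\<in>results (h i). spmf (eval (h i)) w * (c + (\<Sum>(p, T)\<leftarrow>ps. p * trace_prob w T)))"
      unfolding prob_eps_subst_sum[OF ha] using ps(2) val by (intro sum.cong) (simp, metis)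
    \<comment> \<open>The constant survives the averaging because the weights add up to 1.\<close>
    also have "\<dots> = c + (\<Sum>w\<in>results (h i). spmf (eval (h i)) w * (\<Sum>(p, T)\<leftarrow>ps. p * trace_prob w T))"
      using sum_spmf_lossless[OF ha] by (simp add: distrib_left sum.distrib flip: sum_distrib_right)
    also have "(\<Sum>w\<in>results (h i). spmf (eval (h i)) w * (\<Sum>(p, T)\<leftarrow>ps. p * trace_prob w T)) =
        (\<Sum>(p, T)\<leftarrow>ps. p * trace_prob (h i) T)"
      unfolding trace_prob_results[OF ha]
      by (induction ps) (auto simp: algebra_simps sum.distrib sum_distrib_left)
    finally show ?thesis .
  qed
  with ps(1) show ?case unfolding observable_def by blast
qed

text \<open>The result for the index type \<open>tm\<close> is applied to a total family of terms of
  type \<open>A\<close> and pulled back along \<open>h\<close>.\<close>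

lemma observable_kont:
  assumes "kont x r A" "\<And>i. \<turnstile> h i \<Ztypecolon> A"
  shows "observable h A (\<lambda>i. prob_kont x r (h i))"
proof -
  define k where "k u = (if \<turnstile> u \<Ztypecolon> A then u else inhabitant A)" for u
  have "k (h i) = h i" for i using assms(2) by (simp add: k_def)
  moreover have "observable k A (\<lambda>u. prob_kont x r (k u))"
    by (rule observable_kont_tm[OF assms(1)]) (simp add: k_def typing_inhabitant)
  ultimately show ?thesis
    using observable_reindex[of k A "\<lambda>u. prob_kont x r (k u)" h] by simp
qed

lemma observable_fill:
  assumes "ctx_typed C A Str" "\<And>i. \<turnstile> h i \<Ztypecolon> A"
  shows "observable h A (\<lambda>i. prob_eps (fill C (h i)))"
proof -
  interpret hole h A False "observable h A"
    by unfold_locales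
      (use assms(2) observable_const observable_add observable_scale observable_kont[OF _ assms(2)] in auto)
  have "\<turnstile> fill C (inhabitant A) \<Ztypecolon> Str"
    using assms(1) typing_inhabitant unfolding ctx_typed_def by blast
  from Obs_prob_eps[OF htyping_fill[OF this]] show ?thesis .
qed

section \<open>Negligible functions\<close>

lemma negligible_mono:
  assumes "negligible g" "\<And>n. \<bar>f n\<bar> \<le> \<bar>g n\<bar>"
  shows "negligible f"
  unfolding negligible_def
proof (intro allI impI)
  fix p :: "real poly"
  assume "\<forall>\<^sub>F n in sequentially. 0 < poly p (real n)"
  then have "\<forall>\<^sub>F n in sequentially. \<bar>g n\<bar> < 1 / poly p (real n)"
    using assms(1) unfolding negligible_def by blast
  then show "\<forall>\<^sub>F n in sequentially. \<bar>f n\<bar> < 1 / poly p (real n)"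
    by eventually_elim (use assms(2) le_less_trans in blast)
qed

lemma negligible_zero: "negligible (\<lambda>_. 0)"
  unfolding negligible_def by (auto elim: eventually_mono)

lemma negligible_add:
  assumes "negligible f" "negligible g"
  shows "negligible (\<lambda>n. f n + g n)"
  unfolding negligible_def
proof (intro allI impI)
  fix p :: "real poly"
  assume p: "\<forall>\<^sub>F n in sequentially. 0 < poly p (real n)"
  then have "\<forall>\<^sub>F n in sequentially. 0 < poly (smult 2 p) (real n)"
    by (auto elim: eventually_mono)
  then have "\<forall>\<^sub>F n in sequentially. \<bar>f n\<bar> < 1 / poly (smult 2 p) (real n)"
    "\<forall>\<^sub>F n in sequentially. \<bar>g n\<bar> < 1 / poly (smult 2 p) (real n)"
    using assms unfolding negligible_def by blast+
  then show "\<forall>\<^sub>F n in sequentially. \<bar>f n + g n\<bar> < 1 / poly p (real n)"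
    using p
  proof eventually_elim
    case (elim n)
    have "\<bar>f n + g n\<bar> \<le> \<bar>f n\<bar> + \<bar>g n\<bar>" by (rule abs_triangle_ineq)
    also have "\<dots> < 1 / (2 * poly p (real n)) + 1 / (2 * poly p (real n))"
      using elim by simp
    also have "\<dots> = 1 / poly p (real n)" by (simp add: field_simps)
    finally show ?case .
  qed
qed

lemma negligible_scale:
  assumes "negligible f"
  shows "negligible (\<lambda>n. c * f n)"
  unfolding negligible_def
proof (intro allI impI)
  fix p :: "real poly"
  assume p: "\<forall>\<^sub>F n in sequentially. 0 < poly p (real n)"
  \<comment> \<open>The summand 1 keeps the polynomial positive when \<open>c = 0\<close>.\<close>
  then have "\<forall>\<^sub>F n in sequentially. 0 < poly (smult (\<bar>c\<bar> + 1) p) (real n)"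
    by (auto elim!: eventually_mono)
  then have "\<forall>\<^sub>F n in sequentially. \<bar>f n\<bar> < 1 / poly (smult (\<bar>c\<bar> + 1) p) (real n)"
    using assms unfolding negligible_def by blast
  then show "\<forall>\<^sub>F n in sequentially. \<bar>c * f n\<bar> < 1 / poly p (real n)"
    using p
  proof eventually_elim
    case (elim n)
    have "\<bar>c * f n\<bar> \<le> (\<bar>c\<bar> + 1) * \<bar>f n\<bar>" by (simp add: abs_mult mult_right_mono)
    also have "\<dots> < (\<bar>c\<bar> + 1) * (1 / poly (smult (\<bar>c\<bar> + 1) p) (real n))"
      using elim(1) by (intro mult_strict_left_mono) auto
    also have "\<dots> = 1 / poly p (real n)" by simp
    finally show ?case .
  qed
qed

lemma negligible_sum_list:
  "(\<And>p T. (p, T) \<in> set ps \<Longrightarrow> negligible (f T)) \<Longrightarrow> negligible (\<lambda>n. \<Sum>(p, T)\<leftarrow>ps. p * f T n)"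
proof (induction ps)
  case (Cons q ps)
  obtain p T where q: "q = (p, T)" by (cases q)
  have "negligible (\<lambda>n. p * f T n + (\<Sum>(p, T)\<leftarrow>ps. p * f T n))"
    using Cons q by (intro negligible_add negligible_scale) auto
  then show ?case by (simp add: q)
qed (simp add: negligible_zero)

section \<open>Traces as contexts\<close>

fun trace_ctxt :: "ctxt \<Rightarrow> trace \<Rightarrow> ctxt" where
  "trace_ctxt C (View d) = CAppR d C"
| "trace_ctxt C (Pass v T) = trace_ctxt (CAppL C v) T"

lemma holes_trace_ctxt: "holes (trace_ctxt C T) = holes C"
  by (induction C T rule: trace_ctxt.induct) auto

text \<open>The context around the hole accumulates the arguments passed, hence the general
  \<open>C\<close>. Typing is carried along for \<open>ctx_typed\<close> and for exchanging the
  order of evaluation at the final \<open>View\<close>.\<close>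

lemma fill_trace_ctxt:
  "compatible T A \<Longrightarrow> \<turnstile> fill C u \<Ztypecolon> A \<Longrightarrow>
    \<turnstile> fill (trace_ctxt C T) u \<Ztypecolon> Str \<and> prob_eps (fill (trace_ctxt C T) u) = trace_prob (fill C u) T"
proof (induction arbitrary: C rule: compatible.induct)
  case (1 d)
  then show ?case by (auto simp: distinguisher_def prob_eps_App intro: closed_AppI)
next
  case (2 v B T E b)
  have "\<turnstile> fill (CAppL C v) u \<Ztypecolon> E"
    using 2 by (auto intro: closed_AppI)
  from "2.IH"[OF this] show ?case by (simp add: trace_prob_App[OF 2(1)])
qed

theorem mainTheorem11:
  fixes A :: ty and a :: aspect and t s :: tm
  assumes "\<turnstile> t \<Ztypecolon> Arr a Str A"
    and "\<turnstile> s \<Ztypecolon> Arr a Str A"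
  shows "param_trace_equiv A t s \<longleftrightarrow> param_context_equiv A t s"
proof
  have app: "\<turnstile> App t (ones n) \<Ztypecolon> A" "\<turnstile> App s (ones n) \<Ztypecolon> A" for n
    using closed_AppI[OF assms(1) ty_const] closed_AppI[OF assms(2) ty_const] by auto
  have pass: "trace_prob (App u (ones n)) T = trace_prob u (Pass (ones n) T)" for u n T
    by (rule trace_prob_App) simp
  {
    assume eq: "param_trace_equiv A t s"
    show "param_context_equiv A t s"
      unfolding param_context_equiv_def
    proof (intro allI impI, elim conjE)
      fix C assume C: "ctx_typed C A Str"
      \<comment> \<open>One family contains both terms at all parameters \<open>n\<close>, so that
        the same traces and coefficients apply to all of them.\<close>
      define h where "h = (\<lambda>(b, n). App (if b then t else s) (ones n))"
      have typed: "\<turnstile> h i \<Ztypecolon> A" for i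
        using app by (cases i) (auto simp: h_def)
      from observable_fill[OF C, of h, OF typed] obtain c ps where ps: "\<forall>(p, T)\<in>set ps. compatible T A"
        "\<And>i. prob_eps (fill C (h i)) = c + (\<Sum>(p, T)\<leftarrow>ps. p * trace_prob (h i) T)"
        unfolding observable_def by blast
      let ?f = "\<lambda>T n. trace_prob t (Pass (ones n) T) - trace_prob s (Pass (ones n) T)"
      have neg: "negligible (?f T)" if "(p, T) \<in> set ps" for p T
      proof -
        have "compatible T A" using ps(1) that by auto
        then obtain g where "negligible g" "\<And>n. \<bar>?f T n\<bar> \<le> g n"
          using eq unfolding param_trace_equiv_def by blast
        then show ?thesis by (meson abs_ge_self negligible_mono order_trans)
      qed
      \<comment> \<open>The constant \<open>c\<close> is common to both sides and cancels.\<close>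
      have diff: "prob_eps (fill C (App t (ones n))) - prob_eps (fill C (App s (ones n))) =
          (\<Sum>(p, T)\<leftarrow>ps. p * ?f T n)" for n
      proof -
        have "(\<Sum>(p, T)\<leftarrow>ps. p * f T) - (\<Sum>(p, T)\<leftarrow>ps. p * g T) = (\<Sum>(p, T)\<leftarrow>ps. p * (f T - g T))"
          for f g :: "trace \<Rightarrow> real"
          by (induction ps) (auto simp: algebra_simps)
        then show ?thesis
          using ps(2)[of "(True, n)"] ps(2)[of "(False, n)"] by (simp add: h_def pass)
      qed
      show "negligible (\<lambda>n. \<bar>prob_eps (fill C (App t (ones n))) - prob_eps (fill C (App s (ones n)))\<bar>)"
        unfolding diff
        by (rule negligible_mono[OF negligible_sum_list[where f = ?f and ps = ps]]) (auto intro: neg)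
    qed
  next
    assume eq: "param_context_equiv A t s"
    show "param_trace_equiv A t s"
      unfolding param_trace_equiv_def
    proof (intro allI impI)
      fix T assume T: "compatible T A"
      let ?C = "trace_ctxt Hole T"
      \<comment> \<open>The advantage of the trace context is itself the negligible bound; it lies
        in \<open>{0..1}\<close> as the distance of two probabilities.\<close>
      let ?g = "\<lambda>n. \<bar>prob_eps (fill ?C (App t (ones n))) - prob_eps (fill ?C (App s (ones n)))\<bar>"
      have fill: "\<turnstile> fill ?C u \<Ztypecolon> Str \<and> prob_eps (fill ?C u) = trace_prob u T" if "\<turnstile> u \<Ztypecolon> A" for u
        using fill_trace_ctxt[OF T, of Hole u] that by simp
      have "negligible ?g"
        using eq fill unfolding param_context_equiv_def ctx_typed_def
        by (auto simp: holes_trace_ctxt)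
      moreover have "?g n \<in> {0..1}" for n
        using prob_eps_range[of "fill ?C (App t (ones n))"] prob_eps_range[of "fill ?C (App s (ones n))"] by auto
      moreover have "\<bar>trace_prob t (Pass (ones n) T) - trace_prob s (Pass (ones n) T)\<bar> \<le> ?g n" for n
        using fill[OF app(1)] fill[OF app(2)] by (simp add: pass)
      ultimately show "\<exists>negl. negligible negl \<and> range negl \<subseteq> {0..1} \<and>
          (\<forall>n. \<bar>trace_prob t (Pass (ones n) T) - trace_prob s (Pass (ones n) T)\<bar> \<le> negl n)"
        by (intro exI[of _ ?g]) blast
    qed
  }
qed

end
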